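(* Let $p\in(0,1]$ be constant and let $G^N$ be the simple Erdős–Rényi graph with parameter $p$ on $\{1,\dots,N\}$ with adjacency indicators $a_{ij}^N$. Let all the rate functions $Q_{sk}$ be locally Lipschitz-continuous on $\mathbb{R}^S$. Let $x^N(t)$ be the normalized global state of the local density-dependent Markov process on $G^N$, let $y^N(t)$ be its NIMFA approximation, and let $u(t)$ be the homogeneous mean-field approximation (all defined in the context). Assume $x^N(0)\xrightarrow{p}u(0)$ and $y^N(0)\xrightarrow{p}u(0)$ as $N\to\infty$. Then for every fixed $T>0$, $$\sup_{0\le t\le T}\left\|x^N(t)-u(t)\right\|\xrightarrow{p}0\qquad\text{and}\qquad \sup_{0\le t\le T}\left\|y^N(t)-u(t)\right\|\xrightarrow{p}0$$ as $N\to\infty$.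
   Context: $\xrightarrow{p}$ denotes convergence in probability; $\|\cdot\|=\|\cdot\|_1$ on $\mathbb{R}^S$. Graph: for each $N\ge 2$, $a_{ij}^N=a_{ji}^N$, $a_{ii}^N=0$, and $(a_{ij}^N)_{i<j}$ are i.i.d. Bernoulli variables, equal to $1$ with probability $p$ and to $0$ with probability $1-p$. Put $\langle d\rangle=(N-1)p$. Rates: the local state space is $\mathcal{S}=\{1,\dots,S\}$. For $k\ne s$, $Q_{ks}:\mathbb{R}^S\to\mathbb{R}$ is a rate function for the transition from state $s$ to state $k$ (being a rate, it is nonnegative on $[0,\infty)^S$), and $Q_{ss}:=-\sum_{k\ne s}Q_{ks}$. $Q(\phi)=(Q_{ks}(\phi))_{k,s=1}^S$ is the corresponding matrix. $\Delta=\{v\in\mathbb{R}^S: v_s\ge 0\ \forall s,\ \sum_s v_s=1\}$. Local density-dependent Markov process: each vertex $i$ has a local state in $\mathcal{S}$ at each time $t\ge0$; $\xi_{s,i}^N(t)$ is the indicator that vertex $i$ is in state $s$ at time $t$, and $\xi_i^N(t)=(\xi_{s,i}^N(t))_{s\in\mathcal{S}}$. Put $$\phi_i^N(t)=\frac{1}{\langle d\rangle}\sum_{j=1}^N a_{ij}^N\xi_j^N(t).$$ Conditionally on $G^N$, $(\xi_i^N(t))_{i=1}^N$ is a continuous-time Markov chain in which vertex $i$, when in state $s$, jumps to state $k\neq s$ at rate $Q_{ks}(\phi_i^N(t))$ (one vertex changing at a time). The normalized global state is $x^N(t)=\frac1N\sum_{i=1}^N\xi_i^N(t)$. Homogeneous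 mean-field approximation: $u(t)\in\Delta$ is the unique solution of $\frac{\mathrm d}{\mathrm dt}u(t)=Q(u(t))u(t)$ with initial condition $u(0)\in\Delta$. NIMFA: given $G^N$ and initial conditions $z_i^N(0)\in\Delta$, $i=1,\dots,N$, let $(z_i^N(t))_{i=1}^N$ be the solution of $$\dot z_i^N(t)=Q(\rho_i^N(t))z_i^N(t),\qquad \rho_i^N(t)=\frac1{\langle d\rangle}\sum_{j=1}^N a_{ij}^Nz_j^N(t),$$ which exists, is unique for all $t\ge 0$ and stays in $\Delta$; and $y^N(t)=\frac1N\sum_{i=1}^N z_i^N(t)$. *)

theory Defs
  imports "HOL-Probability.Probability"
begin

(* The local state space {1,...,S} is a finite type 's, so R^S is real^'s; the vertex set of the
   N-th graph is {1..N}. *)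

definition prob_simplex :: "(real ^ 's::finite) set" where
  "prob_simplex = {v. (\<forall>s. 0 \<le> v $ s) \<and> (\<Sum>s\<in>UNIV. v $ s) = 1}"

definition l1_norm :: "real ^ 's::finite \<Rightarrow> real" where
  "l1_norm v = (\<Sum>s\<in>UNIV. \<bar>v $ s\<bar>)"

(* Convergence in probability of a sequence to a constant; the N-th variable lives on its own
   probability space M N. Measurability is part of the notion, since measure is 0 on
   non-measurable sets. *)

definition tendsto_in_prob ::
  "(nat \<Rightarrow> 'w measure) \<Rightarrow> (nat \<Rightarrow> 'w \<Rightarrow> 'v::metric_space) \<Rightarrow> 'v \<Rightarrow> bool" where
  "tendsto_in_prob M X c \<longleftrightarrow>
     (\<forall>\<^sub>F N in sequentially. X N \<in> borel_measurable (M N)) \<and>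
     (\<forall>\<epsilon>>0. (\<lambda>N. \<P>(\<omega> in M N. dist (X N \<omega>) c > \<epsilon>)) \<longlonglongrightarrow> 0)"

definition locally_lipschitz :: "('a::metric_space \<Rightarrow> 'b::metric_space) \<Rightarrow> bool" where
  "locally_lipschitz f \<longleftrightarrow> (\<forall>x. \<exists>r>0. \<exists>L. L-lipschitz_on (cball x r) f)"

(* q k s is the rate function of the transition from s to k. The values q s s are never used:
   the diagonal of the rate matrix is determined by the other entries. *)

definition rate_matrix ::
  "('s::finite \<Rightarrow> 's \<Rightarrow> real ^ 's \<Rightarrow> real) \<Rightarrow> real ^ 's \<Rightarrow> real ^ 's ^ 's" where
  "rate_matrix q \<phi> =
     (\<chi> k s. if k = s then - (\<Sum>l\<in>UNIV - {s}. q l s \<phi>) else q k s \<phi>)"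

(* A graph is given by its adjacency relation; a is the random one. *)

definition erdos_renyi ::
  "'w measure \<Rightarrow> nat \<Rightarrow> real \<Rightarrow> ('w \<Rightarrow> nat \<Rightarrow> nat \<Rightarrow> bool) \<Rightarrow> bool" where
  "erdos_renyi M N p a \<longleftrightarrow>
     (\<forall>\<omega>\<in>space M. \<forall>i\<in>{1..N}. \<not> a \<omega> i i) \<and>
     (\<forall>\<omega>\<in>space M. \<forall>i\<in>{1..N}. \<forall>j\<in>{1..N}. a \<omega> i j \<longleftrightarrow> a \<omega> j i) \<and>
     prob_space.indep_vars M (\<lambda>_. count_space UNIV) (\<lambda>(i, j) \<omega>. a \<omega> i j)
       {(i, j). 1 \<le> i \<and> i < j \<and> j \<le> N} \<and>
     (\<forall>i j. 1 \<le> i \<and> i < j \<and> j \<le> N \<longrightarrow>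
       distr M (count_space UNIV) (\<lambda>\<omega>. a \<omega> i j) = measure_pmf (bernoulli_pmf p))"

definition mean_degree :: "nat \<Rightarrow> real \<Rightarrow> real" where
  "mean_degree N p = (real N - 1) * p"

(* Both phi_i (for v j the indicator vector of the state of j) and rho_i (for v = z). *)

definition neighbourhood_density ::
  "nat \<Rightarrow> real \<Rightarrow> (nat \<Rightarrow> nat \<Rightarrow> bool) \<Rightarrow> (nat \<Rightarrow> real ^ 's::finite) \<Rightarrow> nat \<Rightarrow> real ^ 's" where
  "neighbourhood_density N p g v i =
     (1 / mean_degree N p) *\<^sub>R (\<Sum>j=1..N. of_bool (g i j) *\<^sub>R v j)"

definition vertex_mean :: "nat \<Rightarrow> (nat \<Rightarrow> real ^ 's::finite) \<Rightarrow> real ^ 's" where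
  "vertex_mean N v = (1 / real N) *\<^sub>R (\<Sum>i=1..N. v i)"

definition state_indicator :: "(nat \<Rightarrow> 's::finite) \<Rightarrow> nat \<Rightarrow> real ^ 's" where
  "state_indicator c i = axis (c i) 1"

(* Continuous-time Markov chains on a finite state space C with jump rates r c d from c to d
   (c \<noteq> d): the paths are right-continuous step functions, and the conditional law given the
   past is a transition function P solving the forward equation P' = P L, P 0 = 1. As C is
   finite, P t = exp (t L) is the only solution. The initial law is arbitrary. *)

definition generator :: "'c set \<Rightarrow> ('c \<Rightarrow> 'c \<Rightarrow> real) \<Rightarrow> 'c \<Rightarrow> 'c \<Rightarrow> real" where
  "generator C r c d = (if c = d then - (\<Sum>e\<in>C - {c}. r c e) else r c d)"

definition transition_function ::
  "'c set \<Rightarrow> ('c \<Rightarrow> 'c \<Rightarrow> real) \<Rightarrow> (real \<Rightarrow> 'c \<Rightarrow> 'c \<Rightarrow> real) \<Rightarrow> bool" where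
  "transition_function C r P \<longleftrightarrow>
     (\<forall>c\<in>C. \<forall>d\<in>C. P 0 c d = of_bool (c = d)) \<and>
     (\<forall>t\<ge>0. \<forall>c\<in>C. \<forall>d\<in>C.
        ((\<lambda>t. P t c d) has_real_derivative (\<Sum>e\<in>C. P t c e * generator C r e d))
          (at t within {0..}))"

definition markov_chain ::
  "'w measure \<Rightarrow> 'c set \<Rightarrow> ('c \<Rightarrow> 'c \<Rightarrow> real) \<Rightarrow> (real \<Rightarrow> 'w \<Rightarrow> 'c) \<Rightarrow> bool" where
  "markov_chain M C r X \<longleftrightarrow>
     (\<forall>t\<ge>0. X t \<in> measurable M (count_space C)) \<and>
     (\<forall>\<omega>\<in>space M. \<forall>t\<ge>0. \<forall>\<^sub>F s in at_right t. X s \<omega> = X t \<omega>) \<and>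
     (\<exists>P. transition_function C r P \<and>
        (\<forall>n (\<tau> :: nat \<Rightarrow> real) c.
           0 \<le> \<tau> 0 \<and> (\<forall>k\<le>n. \<tau> k \<le> \<tau> (Suc k)) \<and> (\<forall>k\<le>Suc n. c k \<in> C) \<and>
           \<P>(\<omega> in M. \<forall>k\<le>n. X (\<tau> k) \<omega> = c k) > 0 \<longrightarrow>
           \<P>(\<omega> in M. X (\<tau> (Suc n)) \<omega> = c (Suc n) \<bar> \<forall>k\<le>n. X (\<tau> k) \<omega> = c k) =
             P (\<tau> (Suc n) - \<tau> n) (c n) (c (Suc n))))"

(* Configurations are extensional, so that each one is represented by exactly one function. *)

definition configurations :: "nat \<Rightarrow> (nat \<Rightarrow> 's) set" where
  "configurations N = {1..N} \<rightarrow>\<^sub>E UNIV"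

definition jump_rate ::
  "nat \<Rightarrow> real \<Rightarrow> ('s::finite \<Rightarrow> 's \<Rightarrow> real ^ 's \<Rightarrow> real) \<Rightarrow> (nat \<Rightarrow> nat \<Rightarrow> bool) \<Rightarrow>
   (nat \<Rightarrow> 's) \<Rightarrow> (nat \<Rightarrow> 's) \<Rightarrow> real" where
  "jump_rate N p q g c d =
     (\<Sum>i=1..N. \<Sum>k\<in>UNIV - {c i}.
        if d = c(i := k)
        then q k (c i) (neighbourhood_density N p g (state_indicator c) i) else 0)"

(* uniform_measure M A is M conditioned on the event A; here A is the event that the random
   graph is g, for each graph g that occurs with positive probability. *)

definition local_density_dependent_process ::
  "'w measure \<Rightarrow> nat \<Rightarrow> real \<Rightarrow> ('s::finite \<Rightarrow> 's \<Rightarrow> real ^ 's \<Rightarrow> real) \<Rightarrow>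
   ('w \<Rightarrow> nat \<Rightarrow> nat \<Rightarrow> bool) \<Rightarrow> (real \<Rightarrow> 'w \<Rightarrow> nat \<Rightarrow> 's) \<Rightarrow> bool" where
  "local_density_dependent_process M N p q a \<sigma> \<longleftrightarrow>
     (\<forall>g. \<P>(\<omega> in M. \<forall>i\<in>{1..N}. \<forall>j\<in>{1..N}. a \<omega> i j \<longleftrightarrow> g i j) > 0 \<longrightarrow>
        markov_chain
          (uniform_measure M {\<omega>\<in>space M. \<forall>i\<in>{1..N}. \<forall>j\<in>{1..N}. a \<omega> i j \<longleftrightarrow> g i j})
          (configurations N) (jump_rate N p q g) (\<lambda>t \<omega>. restrict (\<sigma> t \<omega>) {1..N}))"

definition homogeneous_mean_field ::
  "('s::finite \<Rightarrow> 's \<Rightarrow> real ^ 's \<Rightarrow> real) \<Rightarrow> (real \<Rightarrow> real ^ 's) \<Rightarrow> bool" where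
  "homogeneous_mean_field q u \<longleftrightarrow>
     (\<forall>t\<ge>0. u t \<in> prob_simplex \<and>
        (u has_vector_derivative (rate_matrix q (u t) *v u t)) (at t within {0..}))"

definition nimfa ::
  "nat \<Rightarrow> real \<Rightarrow> ('s::finite \<Rightarrow> 's \<Rightarrow> real ^ 's \<Rightarrow> real) \<Rightarrow> (nat \<Rightarrow> nat \<Rightarrow> bool) \<Rightarrow>
   (real \<Rightarrow> nat \<Rightarrow> real ^ 's) \<Rightarrow> bool" where
  "nimfa N p q g z \<longleftrightarrow>
     (\<forall>i\<in>{1..N}. \<forall>t\<ge>0. z t i \<in> prob_simplex \<and>
        ((\<lambda>t. z t i) has_vector_derivative
           (rate_matrix q (neighbourhood_density N p g (z t) i) *v z t i)) (at t within {0..}))"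

end

(*
Let V(t, v) = exp(-K t) |v - u(t)|^2 + b_g (T - t), where b_g bounds the error made, on the graph g,
by replacing each neighbourhood density by the global mean.  Expanding squares, this error is
controlled, uniformly in the vertex states, by sum_{j,k} |sum_i b_ij b_ik| with b_ij = a_ij - p off the
diagonal; for j ~= k the inner sum has second moment at most N because distinct edges are
uncorrelated, so b_G -> 0 in mean.  The constant p keeps the neighbourhood densities in a fixed
compact set, on which the rates are Lipschitz and bounded.

Along the NIMFA solution, V(t, y(t)) is decreasing.  Along the Markov process on a given graph,
V(t, x(t)) is a nonnegative supermartingale, since the second-order part of the generator is O(1/N);
the maximal inequality, first on finite time grids and then by right-continuity on [0, T], bounds the
probability that sup_t |x(t) - u(t)| is large by a multiple of E|x(0) - u(0)|^2 + T E b_G, with no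
martingale decomposition of x.  Averaging over the graphs, both bounds tend to 0.
*)

theory Submission
  imports Defs "HOL-Real_Asymp.Real_Asymp"
begin

text \<open>The vertex states depend on the graph, possibly already at time 0, so they cannot be
  treated as fixed when averaging over the edges. The error must therefore be bounded for all states
  at once by a function of the graph alone. The price is the absolute values on the codegree sums:
  their total is of order N^(5/2) in mean, and division by N times the squared mean degree, of order
  N^3 for constant p, leaves N^(-1/2). The linear term of V pays for the constant error, so that the
  initial value is the only remaining input of the maximal inequality; since V has to be
  nonnegative, the horizon T is finite. The squared Euclidean norm is used because the generator
  acts on it by an exact second-order expansion. Convergence at time 0 is assumed in probability
  only, but the simplex is bounded, so the initial second moments tend to 0 as well. A separate
  obstacle is measurability: NIMFA solutions are assumed measurable at time 0, and continuous
  dependence on the initial values, graph by graph, is what makes the supremum of |y - u| a random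
  variable.\<close>

section \<open>Rate matrices on compact sets of densities\<close>

lemma prob_simplexD:
  assumes "v \<in> prob_simplex"
  shows "0 \<le> v $ s" and "v $ s \<le> 1" and "norm v \<le> 1"
proof -
  show nn: "0 \<le> v $ s" for s using assms by (simp add: prob_simplex_def)
  have one: "(\<Sum>s\<in>UNIV. v $ s) = 1" using assms by (simp add: prob_simplex_def)
  show "v $ s \<le> 1" using member_le_sum[of s UNIV "\<lambda>s. v $ s"] nn one by simp
  have "norm v \<le> (\<Sum>s\<in>UNIV. \<bar>v $ s\<bar>)" by (rule norm_le_l1_cart)
  then show "norm v \<le> 1" using nn one by simp
qed

lemma norm_prob_simplex_diff_le:
  assumes "v \<in> prob_simplex" "w \<in> prob_simplex"
  shows "norm (v - w) \<le> 2"
  using norm_triangle_ineq4[of v w] prob_simplexD(3)[OF assms(1)] prob_simplexD(3)[OF assms(2)] by simp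

lemma axis_in_prob_simplex: "axis s 1 \<in> (prob_simplex :: (real ^ 's::finite) set)"
  by (simp add: prob_simplex_def axis_def)

lemma vertex_mean_in_prob_simplex:
  assumes "0 < N" "\<And>i. i \<in> {1..N} \<Longrightarrow> v i \<in> prob_simplex"
  shows "vertex_mean N v \<in> prob_simplex"
proof -
  have "(\<Sum>s\<in>UNIV. vertex_mean N v $ s) = (1 / real N) * (\<Sum>i=1..N. \<Sum>s\<in>UNIV. v i $ s)"
    unfolding vertex_mean_def by (simp add: sum_divide_distrib[symmetric]) (metis sum.swap)
  also have "(\<Sum>i=1..N. \<Sum>s\<in>UNIV. v i $ s) = (\<Sum>i=1..N. 1)"
    by (intro sum.cong) (use assms in \<open>auto simp: prob_simplex_def\<close>)
  finally show ?thesis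
    using assms by (auto simp: prob_simplex_def vertex_mean_def intro!: divide_nonneg_nonneg sum_nonneg)
qed

definition density_region :: "real \<Rightarrow> (real ^ 's::finite) set" where
  "density_region r = {v. (\<forall>s. 0 \<le> v $ s) \<and> (\<Sum>s\<in>UNIV. v $ s) \<le> r}"

lemma compact_density_region: "compact (density_region r :: (real ^ 's::finite) set)"
proof -
  have "bounded (density_region r :: (real ^ 's) set)"
  proof (rule boundedI)
    fix v :: "real ^ 's" assume "v \<in> density_region r"
    then have "(\<Sum>s\<in>UNIV. \<bar>v $ s\<bar>) \<le> r" by (simp add: density_region_def)
    then show "norm v \<le> r" using norm_le_l1_cart[of v] by linarith
  qed
  moreover have "closed (density_region r :: (real ^ 's) set)"
    unfolding density_region_def
    by (intro closed_Collect_conj closed_Collect_all closed_Collect_le continuous_intros)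
  ultimately show ?thesis by (simp add: compact_eq_bounded_closed)
qed

lemma prob_simplex_subset_density_region: "1 \<le> r \<Longrightarrow> prob_simplex \<subseteq> density_region r"
  by (auto simp: prob_simplex_def density_region_def)

text \<open>At most N - 1 neighbours contribute unit mass each, against a normalisation (N - 1) p.
  Absence of a loop at \<open>i\<close> gives N - 1 instead of N, and the radius 1/p is the same for
  all N because p is constant.\<close>

lemma neighbourhood_density_in_region:
  assumes N: "2 \<le> N" and p: "0 < p" and irr: "\<not> g i i" and i: "i \<in> {1..N}"
    and v: "\<And>j. j \<in> {1..N} \<Longrightarrow> v j \<in> prob_simplex"
  shows "neighbourhood_density N p g v i \<in> density_region (1 / p)"
proof -
  have d: "0 < mean_degree N p" using N p by (simp add: mean_degree_def)
  have nn: "0 \<le> v j $ s" if "j \<in> {1..N}" for j s using prob_simplexD[OF v[OF that]] by simp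
  have "(\<Sum>s\<in>UNIV. \<Sum>j=1..N. of_bool (g i j) * v j $ s) = (\<Sum>j=1..N. of_bool (g i j) * (\<Sum>s\<in>UNIV. v j $ s))"
    by (subst sum.swap) (simp add: sum_distrib_left)
  also have "\<dots> = (\<Sum>j=1..N. of_bool (g i j))"
    by (intro sum.cong) (use v in \<open>auto simp: prob_simplex_def\<close>)
  also have "\<dots> \<le> (\<Sum>j\<in>{1..N}. if j = i then 0 else 1)"
    by (intro sum_mono) (use irr in auto)
  also have "\<dots> = real N - 1"
  proof -
    have "(\<Sum>j\<in>{1..N}. if j = i then 0 else (1::real)) = (\<Sum>j\<in>{1..N}. 1 - (if j = i then 1 else 0))"
      by (intro sum.cong) auto
    also have "\<dots> = real N - 1" using i by (simp add: sum_subtractf)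
    finally show ?thesis .
  qed
  finally have le: "(\<Sum>s\<in>UNIV. \<Sum>j=1..N. of_bool (g i j) * v j $ s) \<le> real N - 1" .
  have "(\<Sum>s\<in>UNIV. neighbourhood_density N p g v i $ s)
      = (\<Sum>s\<in>UNIV. \<Sum>j=1..N. of_bool (g i j) * v j $ s) / mean_degree N p"
    by (simp add: neighbourhood_density_def sum_divide_distrib)
  also have "\<dots> \<le> (real N - 1) / mean_degree N p" using le d by (simp add: divide_right_mono)
  also have "\<dots> = 1 / p" using N by (simp add: mean_degree_def)
  finally have "(\<Sum>s\<in>UNIV. neighbourhood_density N p g v i $ s) \<le> 1 / p" .
  moreover have "0 \<le> neighbourhood_density N p g v i $ s" for s
    unfolding neighbourhood_density_def using d nn
    by (auto intro!: divide_nonneg_pos sum_nonneg mult_nonneg_nonneg)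
  ultimately show ?thesis by (simp add: density_region_def)
qed

lemma locally_lipschitz_compact_lipschitz:
  fixes f :: "'a::metric_space \<Rightarrow> 'b::metric_space"
  assumes f: "locally_lipschitz f" and K: "compact K"
  obtains L where "L-lipschitz_on K f"
proof -
  \<comment> \<open>The compactness theorem for \<open>local_lipschitz\<close> concerns families
    indexed by time; a constant family over the single time 0 carries it over to
    \<open>f\<close>.\<close>
  have "local_lipschitz {0::real} K (\<lambda>_. f)"
    unfolding local_lipschitz_def
  proof (intro ballI)
    fix x and t :: real
    obtain r L where "r > 0" "L-lipschitz_on (cball x r) f"
      using f unfolding locally_lipschitz_def by blast
    then show "\<exists>u>0. \<exists>L. \<forall>t\<in>cball t u \<inter> {0}. L-lipschitz_on (cball x u \<inter> K) f"
      by (meson inf_le1 lipschitz_on_subset)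
  qed
  from local_lipschitz_compact_implies_lipschitz[OF this K] that show ?thesis by auto
qed

lemma norm_matrix_vector_mult_le:
  fixes A :: "real ^ 's::finite ^ 's"
  assumes A: "\<And>k s. \<bar>A $ k $ s\<bar> \<le> c"
  shows "norm (A *v w) \<le> (real CARD('s))\<^sup>2 * c * norm w"
proof -
  have "\<bar>(A *v w) $ k\<bar> \<le> real CARD('s) * (c * norm w)" for k
  proof -
    have "\<bar>(A *v w) $ k\<bar> \<le> (\<Sum>s\<in>UNIV. \<bar>A $ k $ s * w $ s\<bar>)"
      unfolding matrix_vector_mult_def by simp
    also have "\<dots> \<le> (\<Sum>s\<in>(UNIV::'s set). c * norm w)"
      unfolding abs_mult by (intro sum_mono mult_mono A component_le_norm_cart) (use A in \<open>auto intro: order_trans[OF abs_ge_zero]\<close>)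
    finally show ?thesis by simp
  qed
  then have "(\<Sum>k\<in>UNIV. \<bar>(A *v w) $ k\<bar>) \<le> (\<Sum>k\<in>(UNIV::'s set). real CARD('s) * (c * norm w))"
    by (intro sum_mono) auto
  then show ?thesis using norm_le_l1_cart[of "A *v w"] by (simp add: power2_eq_square mult.assoc)
qed

text \<open>The column of the rate matrix at state \<open>s\<close> is the mean velocity of a vertex
  in that state: each rate times its jump vector. Through this identity the chain and the NIMFA
  equations have the same drift.\<close>

lemma rate_matrix_axis:
  fixes q :: "'s::finite \<Rightarrow> 's \<Rightarrow> real ^ 's \<Rightarrow> real"
  shows "rate_matrix q \<phi> *v axis s 1 = (\<Sum>k\<in>UNIV - {s}. q k s \<phi> *\<^sub>R (axis k 1 - axis s 1))"
proof (rule vec_eq_iff[THEN iffD2], rule allI)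
  fix l
  have "(rate_matrix q \<phi> *v axis s 1) $ l = rate_matrix q \<phi> $ l $ s"
    by (simp add: matrix_vector_mul_component inner_axis)
  moreover have "(\<Sum>k\<in>UNIV - {s}. q k s \<phi> *\<^sub>R (axis k 1 - axis s 1)) $ l = rate_matrix q \<phi> $ l $ s"
  proof (cases "l = s")
    case True
    have "(\<Sum>k\<in>UNIV - {s}. q k s \<phi> * ((axis k 1 :: real ^ 's) $ s - 1)) = (\<Sum>k\<in>UNIV - {s}. - q k s \<phi>)"
      by (intro sum.cong) (auto simp: axis_def)
    then show ?thesis using True by (simp add: rate_matrix_def sum_negf)
  next
    case False
    have "(\<Sum>k\<in>UNIV - {s}. q k s \<phi> * ((axis k 1 :: real ^ 's) $ l - (axis s 1 :: real ^ 's) $ l))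
        = (\<Sum>k\<in>UNIV - {s}. if k = l then q l s \<phi> else 0)"
      using False by (intro sum.cong) (auto simp: axis_def)
    then show ?thesis using False by (simp add: rate_matrix_def)
  qed
  ultimately show "(rate_matrix q \<phi> *v axis s 1) $ l
    = (\<Sum>k\<in>UNIV - {s}. q k s \<phi> *\<^sub>R (axis k 1 - axis s 1)) $ l" by simp
qed

text \<open>One compact set gives constants valid for all graphs and all times. \<open>L\<close>
  controls the change of the drift with the density, \<open>R\<close> both the drift itself and the
  total jump rate out of a state; the latter bounds the noise of the chain.\<close>

lemma rate_matrix_regular:
  fixes q :: "'s::finite \<Rightarrow> 's \<Rightarrow> real ^ 's \<Rightarrow> real"
  assumes q: "\<And>k s. k \<noteq> s \<Longrightarrow> locally_lipschitz (q k s)" and K: "compact K"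
  obtains L R where "0 \<le> L" "0 \<le> R"
    "\<And>\<phi> \<psi> w. \<phi> \<in> K \<Longrightarrow> \<psi> \<in> K \<Longrightarrow>
       norm (rate_matrix q \<phi> *v w - rate_matrix q \<psi> *v w) \<le> L * norm (\<phi> - \<psi>) * norm w"
    "\<And>\<phi> w. \<phi> \<in> K \<Longrightarrow> norm (rate_matrix q \<phi> *v w) \<le> R * norm w"
    "\<And>\<phi> s. \<phi> \<in> K \<Longrightarrow> (\<Sum>k\<in>UNIV - {s}. q k s \<phi>) \<le> R"
proof -
  have "\<exists>l. k \<noteq> s \<longrightarrow> l-lipschitz_on K (q k s)" for k s
    using locally_lipschitz_compact_lipschitz[OF q K, of k s] by metis
  then obtain l where l: "\<And>k s. k \<noteq> s \<Longrightarrow> (l k s)-lipschitz_on K (q k s)" by metis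
  have lip_entry: "\<exists>c. c-lipschitz_on K (\<lambda>\<phi>. rate_matrix q \<phi> $ k $ s)" for k s
  proof (cases "k = s")
    case True
    \<comment> \<open>Regularity is given for off-diagonal rates, so the induction runs over index
      sets that avoid \<open>s\<close>.\<close>
    have "\<exists>c. c-lipschitz_on K (\<lambda>\<phi>. \<Sum>l\<in>A. q l s \<phi>)" if "s \<notin> A" for A
      using finite[of A] that
    proof (induction A rule: finite_induct)
      case empty
      then show ?case by (auto intro: exI[of _ 0] lipschitz_on_constant)
    next
      case (insert k A)
      then obtain c where "c-lipschitz_on K (\<lambda>\<phi>. \<Sum>l\<in>A. q l s \<phi>)" by auto
      with l[of k s] insert show ?case by (auto intro!: exI lipschitz_on_add)
    qed
    from this[of "UNIV - {s}"] obtain c where "c-lipschitz_on K (\<lambda>\<phi>. \<Sum>l\<in>UNIV - {s}. q l s \<phi>)" by auto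
    then show ?thesis using True by (auto simp: rate_matrix_def intro!: exI lipschitz_on_minus)
  next
    case False
    then show ?thesis using l by (auto simp: rate_matrix_def)
  qed
  then obtain c where c: "\<And>k s. (c k s)-lipschitz_on K (\<lambda>\<phi>. rate_matrix q \<phi> $ k $ s)" by metis
  have c0: "0 \<le> c k s" for k s using c by (rule lipschitz_on_nonneg)
  define C where "C = (\<Sum>k\<in>UNIV. \<Sum>s\<in>UNIV. c k s)"
  have C: "c k s \<le> C" for k s
  proof -
    have "c k s \<le> (\<Sum>s\<in>UNIV. c k s)" by (intro member_le_sum) (use c0 in auto)
    also have "\<dots> \<le> C" unfolding C_def
      by (rule member_le_sum[where f = "\<lambda>k. sum (c k) UNIV"]) (use c0 in \<open>auto intro: sum_nonneg\<close>)
    finally show ?thesis .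
  qed
  have "\<exists>B. \<forall>\<phi>\<in>K. \<bar>rate_matrix q \<phi> $ k $ s\<bar> \<le> B" for k s
  proof -
    have "compact ((\<lambda>\<phi>. rate_matrix q \<phi> $ k $ s) ` K)"
      using c K by (intro compact_continuous_image lipschitz_on_continuous_on)
    then show ?thesis unfolding compact_eq_bounded_closed bounded_iff by auto
  qed
  then obtain b where b: "\<And>k s \<phi>. \<phi> \<in> K \<Longrightarrow> \<bar>rate_matrix q \<phi> $ k $ s\<bar> \<le> b k s" by metis
  define B where "B = (\<Sum>k\<in>UNIV. \<Sum>s\<in>UNIV. \<bar>b k s\<bar>)"
  have B: "b k s \<le> B" for k s
  proof -
    have "b k s \<le> (\<Sum>s\<in>UNIV. \<bar>b k s\<bar>)"
      using member_le_sum[of s UNIV "\<lambda>s. \<bar>b k s\<bar>"] by auto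
    also have "\<dots> \<le> B" unfolding B_def
      by (rule member_le_sum[where f = "\<lambda>k. \<Sum>s\<in>UNIV. \<bar>b k s\<bar>"]) (auto intro: sum_nonneg)
    finally show ?thesis .
  qed
  have B0: "0 \<le> B" unfolding B_def by (intro sum_nonneg) auto
  have C0: "0 \<le> C" unfolding C_def by (intro sum_nonneg c0)
  let ?n = "(real CARD('s))\<^sup>2"
  show ?thesis
  \<comment> \<open>In the second constant, \<open>?n * B\<close> covers the matrix norm and the
    extra \<open>B\<close> the total jump rate, which is minus a diagonal entry.\<close>
  proof (rule that[of "?n * C" "?n * B + B"])
    show "0 \<le> ?n * C" "0 \<le> ?n * B + B" using B0 C0 by auto
  next
    fix \<phi> \<psi> w assume K': "\<phi> \<in> K" "\<psi> \<in> K"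
    have "\<bar>(rate_matrix q \<phi> - rate_matrix q \<psi>) $ k $ s\<bar> \<le> C * norm (\<phi> - \<psi>)" for k s
    proof -
      have "\<bar>(rate_matrix q \<phi> - rate_matrix q \<psi>) $ k $ s\<bar> \<le> c k s * norm (\<phi> - \<psi>)"
        using lipschitz_onD[OF c K'] by (simp add: dist_norm)
      also have "\<dots> \<le> C * norm (\<phi> - \<psi>)" by (intro mult_right_mono C) auto
      finally show ?thesis .
    qed
    from norm_matrix_vector_mult_le[OF this, of w]
    show "norm (rate_matrix q \<phi> *v w - rate_matrix q \<psi> *v w) \<le> ?n * C * norm (\<phi> - \<psi>) * norm w"
      by (simp add: matrix_vector_mult_diff_rdistrib mult.assoc)
  next
    fix \<phi> w assume "\<phi> \<in> K"
    then have "\<bar>rate_matrix q \<phi> $ k $ s\<bar> \<le> B" for k s using b B order_trans by blast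
    from norm_matrix_vector_mult_le[OF this, of w]
    show "norm (rate_matrix q \<phi> *v w) \<le> (?n * B + B) * norm w"
      using B0 by (simp add: distrib_right add_increasing2)
  next
    fix \<phi> s assume "\<phi> \<in> K"
    have "(\<Sum>k\<in>UNIV - {s}. q k s \<phi>) = - (rate_matrix q \<phi> $ s $ s)" by (simp add: rate_matrix_def)
    also have "\<dots> \<le> B" using b[OF \<open>\<phi> \<in> K\<close>, of s s] B[of s s] by linarith
    finally show "(\<Sum>k\<in>UNIV - {s}. q k s \<phi>) \<le> ?n * B + B" using B0 by (simp add: add_increasing)
  qed
qed

section \<open>Uniform closeness of neighbourhood densities to the mean\<close>

lemma sum_squared_le_card:
  fixes f :: "nat \<Rightarrow> real"
  shows "(\<Sum>i=1..N. f i)\<^sup>2 \<le> real N * (\<Sum>i=1..N. (f i)\<^sup>2)"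
  using sum_squared_le_sum_of_squares[of f "{1..N}"] by (simp add: mult.commute)

lemma norm_vertex_mean_le:
  "norm (vertex_mean N v) \<le> (\<Sum>i=1..N. norm (v i)) / real N"
  unfolding vertex_mean_def using norm_sum[of v "{1..N}"] by (simp add: divide_right_mono)

text \<open>Three replacements lead from one vector field to the other: each density
  \<open>\<rho> i\<close> by the common mean, then the matrix at the mean by the matrix at
  \<open>u\<close>, then the vector. The left side is the derivative of the squared distance when
  both points follow their drifts. The vectors \<open>v i\<close> may be NIMFA probabilities or
  indicators of actual states, so one estimate serves both processes.\<close>

lemma mean_field_drift_bound:
  fixes q :: "'s::finite \<Rightarrow> 's \<Rightarrow> real ^ 's \<Rightarrow> real"
  assumes L: "0 \<le> L"
    and lip: "\<And>\<phi> \<psi> w. \<phi> \<in> K \<Longrightarrow> \<psi> \<in> K \<Longrightarrow>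
       norm (rate_matrix q \<phi> *v w - rate_matrix q \<psi> *v w) \<le> L * norm (\<phi> - \<psi>) * norm w"
    and bnd: "\<And>\<phi> w. \<phi> \<in> K \<Longrightarrow> norm (rate_matrix q \<phi> *v w) \<le> R * norm w"
    and K: "prob_simplex \<subseteq> K" and N: "0 < N"
    and v: "\<And>i. i \<in> {1..N} \<Longrightarrow> v i \<in> prob_simplex"
    and \<rho>: "\<And>i. i \<in> {1..N} \<Longrightarrow> \<rho> i \<in> K" and u: "u \<in> prob_simplex"
  shows "2 * ((vertex_mean N v - u) \<bullet> (vertex_mean N (\<lambda>i. rate_matrix q (\<rho> i) *v v i) - rate_matrix q u *v u))
     \<le> (2 * (L + R) + 1) * (norm (vertex_mean N v - u))\<^sup>2
        + L\<^sup>2 * ((\<Sum>i=1..N. (norm (\<rho> i - vertex_mean N v))\<^sup>2) / real N)"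
proof -
  define y where "y = vertex_mean N v"
  define w where "w = norm (y - u)"
  define m where "m = (\<Sum>i=1..N. norm (\<rho> i - y)) / real N"
  have y: "y \<in> prob_simplex" unfolding y_def by (rule vertex_mean_in_prob_simplex[OF N v])
  let ?D1 = "vertex_mean N (\<lambda>i. rate_matrix q (\<rho> i) *v v i - rate_matrix q y *v v i)"
  let ?D2 = "rate_matrix q y *v y - rate_matrix q u *v y"
  let ?D3 = "rate_matrix q u *v (y - u)"
  \<comment> \<open>Once all vertices see the same density, averaging commutes with the matrix and
    the averaged equation closes.\<close>
  have lin: "vertex_mean N (\<lambda>i. rate_matrix q y *v v i) = rate_matrix q y *v y"
    unfolding y_def vertex_mean_def
    by (simp add: linear_cmul[OF matrix_vector_mul_linear] linear_sum[OF matrix_vector_mul_linear])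
  have "vertex_mean N (\<lambda>i. rate_matrix q (\<rho> i) *v v i) = ?D1 + rate_matrix q y *v y"
    unfolding lin[symmetric] by (simp add: vertex_mean_def sum_subtractf scaleR_diff_right)
  then have D: "vertex_mean N (\<lambda>i. rate_matrix q (\<rho> i) *v v i) - rate_matrix q u *v u = ?D1 + ?D2 + ?D3"
    by (simp add: matrix_vector_mult_diff_distrib)
  have "norm ?D1 \<le> (\<Sum>i=1..N. L * norm (\<rho> i - y)) / real N"
  proof (rule order_trans[OF norm_vertex_mean_le], intro divide_right_mono sum_mono)
    fix i assume i: "i \<in> {1..N}"
    have "norm (rate_matrix q (\<rho> i) *v v i - rate_matrix q y *v v i) \<le> L * norm (\<rho> i - y) * norm (v i)"
      using \<rho>[OF i] y K by (intro lip) auto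
    also have "\<dots> \<le> L * norm (\<rho> i - y) * 1"
      using prob_simplexD(3)[OF v[OF i]] L by (intro mult_left_mono) auto
    finally show "norm (rate_matrix q (\<rho> i) *v v i - rate_matrix q y *v v i) \<le> L * norm (\<rho> i - y)" by simp
  qed simp
  then have D1: "norm ?D1 \<le> L * m" by (simp add: m_def sum_distrib_left)
  have "norm ?D2 \<le> L * w * norm y" unfolding w_def using y u K by (intro lip) auto
  also have "\<dots> \<le> L * w * 1"
    using prob_simplexD(3)[OF y] L by (intro mult_left_mono) (auto simp: w_def)
  finally have D2: "norm ?D2 \<le> L * w" by simp
  have D3: "norm ?D3 \<le> R * w" unfolding w_def using u K by (intro bnd) auto
  have "norm (?D1 + ?D2 + ?D3) \<le> norm ?D1 + norm ?D2 + norm ?D3"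
    using norm_triangle_ineq[of "?D1 + ?D2" ?D3] norm_triangle_ineq[of ?D1 ?D2] by linarith
  then have nD: "norm (?D1 + ?D2 + ?D3) \<le> L * m + (L + R) * w"
    using D1 D2 D3 by (simp add: algebra_simps)
  have w0: "0 \<le> w" by (simp add: w_def)
  have "(y - u) \<bullet> (?D1 + ?D2 + ?D3) \<le> w * norm (?D1 + ?D2 + ?D3)"
    unfolding w_def by (rule norm_cauchy_schwarz)
  also have "\<dots> \<le> w * (L * m + (L + R) * w)" using nD w0 by (rule mult_left_mono)
  finally have "2 * ((y - u) \<bullet> (?D1 + ?D2 + ?D3)) \<le> 2 * w * (L * m) + 2 * (L + R) * w\<^sup>2"
    by (simp add: power2_eq_square algebra_simps)
  \<comment> \<open>Young's inequality trades the mixed term for squares; this is the source of the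
    summand 1 in the growth constant.\<close>
  also have "2 * w * (L * m) \<le> w\<^sup>2 + (L * m)\<^sup>2" by (rule sum_squares_bound)
  also have "(L * m)\<^sup>2 = L\<^sup>2 * m\<^sup>2" by (rule power_mult_distrib)
  also have "m\<^sup>2 \<le> (\<Sum>i=1..N. (norm (\<rho> i - y))\<^sup>2) / real N"
  proof -
    have "m\<^sup>2 \<le> real N * (\<Sum>i=1..N. (norm (\<rho> i - y))\<^sup>2) / (real N)\<^sup>2"
      unfolding m_def power_divide by (intro divide_right_mono sum_squared_le_card) auto
    then show ?thesis using N by (simp add: power2_eq_square)
  qed
  finally have "2 * ((y - u) \<bullet> (?D1 + ?D2 + ?D3)) \<le> w\<^sup>2 + L\<^sup>2 * ((\<Sum>i=1..N. (norm (\<rho> i - y))\<^sup>2) / real N)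
      + 2 * (L + R) * w\<^sup>2"
    by (simp add: mult_left_mono)
  then show ?thesis unfolding D y_def[symmetric] w_def[symmetric]
    by (simp only: distrib_right mult_1_left)
qed

text \<open>The diagonal is 0 and not -p, so that every entry has mean 0 in the random graph. The
  loop term left out here reappears as the correction (y - v i)/(N - 1) to the density.\<close>

definition centred_edge :: "real \<Rightarrow> (nat \<Rightarrow> nat \<Rightarrow> bool) \<Rightarrow> nat \<Rightarrow> nat \<Rightarrow> real" where
  "centred_edge p g i j = (if i = j then 0 else of_bool (g i j) - p)"

text \<open>With B the centred adjacency matrix, this is the entrywise l1 norm of B^T B, whose
  off-diagonal entries are centred versions of the number of common neighbours.\<close>

definition codegree_deviation :: "nat \<Rightarrow> real \<Rightarrow> (nat \<Rightarrow> nat \<Rightarrow> bool) \<Rightarrow> real" where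
  "codegree_deviation N p g =
     (\<Sum>j=1..N. \<Sum>k=1..N. \<bar>\<Sum>i=1..N. centred_edge p g i j * centred_edge p g i k\<bar>)"

text \<open>Expanding the square, the dependence on the weights enters only through their bound, which
  makes the estimate uniform in \<open>f\<close>.\<close>

lemma sum_centred_edge_squared_le:
  assumes f: "\<And>j. j \<in> {1..N} \<Longrightarrow> \<bar>f j\<bar> \<le> 1"
  shows "(\<Sum>i=1..N. (\<Sum>j=1..N. centred_edge p g i j * f j)\<^sup>2) \<le> codegree_deviation N p g"
proof -
  let ?b = "centred_edge p g"
  have "(\<Sum>i=1..N. (\<Sum>j=1..N. ?b i j * f j)\<^sup>2)
      = (\<Sum>i=1..N. \<Sum>j=1..N. \<Sum>k=1..N. (?b i j * f j) * (?b i k * f k))"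
    by (simp add: power2_eq_square sum_product)
  also have "\<dots> = (\<Sum>j=1..N. \<Sum>i=1..N. \<Sum>k=1..N. (?b i j * f j) * (?b i k * f k))"
    by (rule sum.swap)
  also have "\<dots> = (\<Sum>j=1..N. \<Sum>k=1..N. \<Sum>i=1..N. (?b i j * f j) * (?b i k * f k))"
    by (rule sum.cong[OF refl], rule sum.swap)
  also have "\<dots> = (\<Sum>j=1..N. \<Sum>k=1..N. (f j * f k) * (\<Sum>i=1..N. ?b i j * ?b i k))"
    by (simp add: sum_distrib_left algebra_simps)
  also have "\<dots> \<le> codegree_deviation N p g"
    unfolding codegree_deviation_def
  proof (intro sum_mono)
    fix j k assume jk: "j \<in> {1..N}" "k \<in> {1..N}"
    let ?c = "\<Sum>i=1..N. ?b i j * ?b i k"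
    have "(f j * f k) * ?c \<le> \<bar>f j\<bar> * \<bar>f k\<bar> * \<bar>?c\<bar>"
      by (metis abs_ge_self abs_mult)
    also have "\<dots> \<le> 1 * 1 * \<bar>?c\<bar>" using f jk by (intro mult_mono) auto
    finally show "(f j * f k) * ?c \<le> \<bar>?c\<bar>" by simp
  qed
  finally show ?thesis .
qed

text \<open>First term: fluctuation of the edges. Second term: a vertex is not its own neighbour.
  Both factors 2 come from (a + b)^2 <= 2 a^2 + 2 b^2, applied in each coordinate.\<close>

definition density_error :: "nat \<Rightarrow> real \<Rightarrow> (nat \<Rightarrow> nat \<Rightarrow> bool) \<Rightarrow> real" where
  "density_error N p g =
     2 * codegree_deviation N p g / (real N * (mean_degree N p)\<^sup>2) + 2 / (real N - 1)\<^sup>2"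

lemma mean_square_density_error_le:
  fixes v :: "nat \<Rightarrow> real ^ 's::finite"
  assumes N: "2 \<le> N" and p: "0 < p" and irr: "\<And>i. i \<in> {1..N} \<Longrightarrow> \<not> g i i"
    and v: "\<And>i. i \<in> {1..N} \<Longrightarrow> v i \<in> prob_simplex"
  shows "(\<Sum>i=1..N. (norm (neighbourhood_density N p g v i - vertex_mean N v))\<^sup>2) / real N
     \<le> real CARD('s) * density_error N p g"
proof -
  define y where "y = vertex_mean N v"
  define d where "d = mean_degree N p"
  have y: "y \<in> prob_simplex" unfolding y_def using N by (intro vertex_mean_in_prob_simplex v) auto
  have d: "0 < d" using N p by (simp add: d_def mean_degree_def)
  \<comment> \<open>Writing each off-diagonal edge as p plus its fluctuation turns the density into
    (N y - v i)/(N - 1) plus the fluctuation term; subtracting y leaves the correction (y - v i)/(N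
    - 1).\<close>
  have split: "(neighbourhood_density N p g v i - y) $ s
      = (\<Sum>j=1..N. centred_edge p g i j * v j $ s) / d + (y $ s - v i $ s) / (real N - 1)"
    if i: "i \<in> {1..N}" for i s
  proof -
    have "(\<Sum>j=1..N. of_bool (g i j) * v j $ s)
        = (\<Sum>j=1..N. centred_edge p g i j * v j $ s + p * v j $ s - (if j = i then p * v i $ s else 0))"
      using irr[OF i] by (intro sum.cong) (auto simp: centred_edge_def algebra_simps)
    also have "\<dots> = (\<Sum>j=1..N. centred_edge p g i j * v j $ s) + p * (\<Sum>j=1..N. v j $ s) - p * v i $ s"
      using i by (simp add: sum_subtractf sum.distrib sum_distrib_left)
    also have "(\<Sum>j=1..N. v j $ s) = real N * y $ s"
      using N by (simp add: y_def vertex_mean_def)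
    finally have *: "(\<Sum>j=1..N. of_bool (g i j) * v j $ s)
        = (\<Sum>j=1..N. centred_edge p g i j * v j $ s) + p * (real N * y $ s - v i $ s)"
      by (simp add: algebra_simps)
    have "(neighbourhood_density N p g v i) $ s
        = ((\<Sum>j=1..N. centred_edge p g i j * v j $ s) + p * (real N * y $ s - v i $ s)) / d"
      using * by (simp add: neighbourhood_density_def flip: d_def)
    also have "\<dots> = (\<Sum>j=1..N. centred_edge p g i j * v j $ s) / d + (real N * y $ s - v i $ s) / (real N - 1)"
      using p N by (simp add: add_divide_distrib d_def mean_degree_def)
    finally show ?thesis using N by (simp add: field_simps)
  qed
  have sq: "((neighbourhood_density N p g v i - y) $ s)\<^sup>2
      \<le> 2 * (\<Sum>j=1..N. centred_edge p g i j * v j $ s)\<^sup>2 / d\<^sup>2 + 2 / (real N - 1)\<^sup>2"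
    if i: "i \<in> {1..N}" for i s
  proof -
    have *: "(a + b)\<^sup>2 \<le> 2 * a\<^sup>2 + 2 * b\<^sup>2" for a b :: real
      using sum_squares_bound[of a b] by (simp add: power2_sum)
    have "\<bar>y $ s - v i $ s\<bar> \<le> 1"
      using prob_simplexD(1,2)[OF y, of s] prob_simplexD(1,2)[OF v[OF i], of s] by linarith
    then have "(y $ s - v i $ s)\<^sup>2 \<le> 1" by (simp add: abs_square_le_1)
    then have "((y $ s - v i $ s) / (real N - 1))\<^sup>2 \<le> 1 / (real N - 1)\<^sup>2"
      by (simp add: power_divide divide_right_mono)
    then show ?thesis unfolding split[OF i]
      using *[of "(\<Sum>j=1..N. centred_edge p g i j * v j $ s) / d" "(y $ s - v i $ s) / (real N - 1)"]
      by (simp add: power_divide)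
  qed
  have "(\<Sum>i=1..N. (norm (neighbourhood_density N p g v i - y))\<^sup>2)
      = (\<Sum>s\<in>UNIV. \<Sum>i=1..N. ((neighbourhood_density N p g v i - y) $ s)\<^sup>2)"
    by (subst sum.swap) (simp add: norm_vec_def L2_set_def sum_nonneg)
  also have "\<dots> \<le> (\<Sum>s\<in>(UNIV::'s set). 2 * codegree_deviation N p g / d\<^sup>2 + real N * (2 / (real N - 1)\<^sup>2))"
  proof (intro sum_mono)
    fix s :: 's
    have "(\<Sum>i=1..N. ((neighbourhood_density N p g v i - y) $ s)\<^sup>2)
        \<le> (\<Sum>i=1..N. 2 * (\<Sum>j=1..N. centred_edge p g i j * v j $ s)\<^sup>2 / d\<^sup>2 + 2 / (real N - 1)\<^sup>2)"
      by (intro sum_mono sq)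
    also have "\<dots> = 2 * (\<Sum>i=1..N. (\<Sum>j=1..N. centred_edge p g i j * v j $ s)\<^sup>2) / d\<^sup>2 + real N * (2 / (real N - 1)\<^sup>2)"
      by (simp add: sum.distrib sum_distrib_left sum_divide_distrib)
    also have "(\<Sum>i=1..N. (\<Sum>j=1..N. centred_edge p g i j * v j $ s)\<^sup>2) \<le> codegree_deviation N p g"
      by (rule sum_centred_edge_squared_le) (use prob_simplexD(1,2)[OF v] in auto)
    finally show "(\<Sum>i=1..N. ((neighbourhood_density N p g v i - y) $ s)\<^sup>2)
        \<le> 2 * codegree_deviation N p g / d\<^sup>2 + real N * (2 / (real N - 1)\<^sup>2)"
      by (simp add: divide_right_mono)
  qed
  also have "\<dots> = real N * (real CARD('s) * density_error N p g)"
    using N d by (simp add: density_error_def d_def[symmetric] field_simps)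
  finally show ?thesis using N unfolding y_def by (simp add: field_simps)
qed

lemma density_error_nonneg: "0 \<le> density_error N p g"
  unfolding density_error_def codegree_deviation_def
  by (intro add_nonneg_nonneg divide_nonneg_nonneg mult_nonneg_nonneg sum_nonneg) auto

section \<open>Edge correlations in the random graph\<close>

text \<open>Independence yields measurability for pairs in increasing order; a loop is absent
  throughout the sample space, and a decreasing pair is the mirror of an increasing one.\<close>

lemma (in prob_space) erdos_renyi_edge_measurable:
  assumes er: "erdos_renyi M N p a" and ij: "i \<in> {1..N}" "j \<in> {1..N}"
  shows "(\<lambda>\<omega>. a \<omega> i j) \<in> measurable M (count_space UNIV)"
proof -
  have lt: "(\<lambda>\<omega>. a \<omega> i j) \<in> measurable M (count_space UNIV)" if "1 \<le> i" "i < j" "j \<le> N" for i j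
    using er that unfolding erdos_renyi_def indep_vars_def by auto
  consider "i < j" | "i = j" | "j < i" by linarith
  then show ?thesis
  proof cases
    case 1
    then show ?thesis using ij by (intro lt) auto
  next
    case 2
    have "(\<lambda>\<omega>. False) \<in> measurable M (count_space UNIV)" by simp
    then show ?thesis
      by (rule measurable_cong[THEN iffD2, rotated]) (use er ij 2 in \<open>auto simp: erdos_renyi_def\<close>)
  next
    case 3
    then have "(\<lambda>\<omega>. a \<omega> j i) \<in> measurable M (count_space UNIV)" using ij by (intro lt) auto
    then show ?thesis
      by (rule measurable_cong[THEN iffD2, rotated]) (use er ij in \<open>auto simp: erdos_renyi_def\<close>)
  qed
qed

lemma (in prob_space) erdos_renyi_centred_edge_measurable:
  assumes "erdos_renyi M N p a" and "i \<in> {1..N}" "j \<in> {1..N}"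
  shows "(\<lambda>\<omega>. centred_edge p (a \<omega>) i j) \<in> borel_measurable M"
proof -
  have [measurable]: "(\<lambda>\<omega>. a \<omega> i j) \<in> measurable M (count_space UNIV)"
    using assms by (rule erdos_renyi_edge_measurable)
  show ?thesis unfolding centred_edge_def by (cases "i = j") simp_all
qed

lemma abs_centred_edge_le: "0 < p \<Longrightarrow> p \<le> 1 \<Longrightarrow> \<bar>centred_edge p g i j\<bar> \<le> 1"
  by (simp add: centred_edge_def)

text \<open>Four pairwise distinct edges occur here unless one of the factors vanishes.\<close>

lemma (in prob_space) expectation_centred_edge_cycle:
  assumes er: "erdos_renyi M N p a" and p: "0 < p" "p \<le> 1"
    and ij: "i \<in> {1..N}" "i' \<in> {1..N}" "j \<in> {1..N}" "k \<in> {1..N}" and ne: "i \<noteq> i'" "j \<noteq> k"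
  shows "expectation (\<lambda>\<omega>. centred_edge p (a \<omega>) i j * centred_edge p (a \<omega>) i k *
     (centred_edge p (a \<omega>) i' j * centred_edge p (a \<omega>) i' k)) = 0"
proof (cases "{i, i'} \<inter> {j, k} = {}")
  case False
  then show ?thesis by (auto simp: centred_edge_def)
next
  case True
  define E where "E = {(i, j). 1 \<le> i \<and> i < j \<and> j \<le> N}"
  define X where "X e \<omega> = of_bool (a \<omega> (fst e) (snd e)) - p" for e :: "nat \<times> nat" and \<omega>
  \<comment> \<open>Independence is stated for pairs in increasing order, so each unordered edge is
    represented by its sorted pair.\<close>
  define h where "h i j = (min i j, max i j)" for i j :: nat
  have "indep_vars (\<lambda>_. count_space UNIV) (\<lambda>(i, j) \<omega>. a \<omega> i j) E"
    using er by (simp add: erdos_renyi_def E_def)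
  from indep_vars_compose2[OF this, of "\<lambda>_ x. of_bool x - p" "\<lambda>_. borel"]
  have indep: "indep_vars (\<lambda>_. borel) X E" by (simp add: X_def[abs_def] case_prod_beta)
  have zero: "expectation (X e) = 0" if "e \<in> E" for e
  proof -
    obtain i j where e: "e = (i, j)" by fastforce
    have d: "distr M (count_space UNIV) (\<lambda>\<omega>. a \<omega> i j) = measure_pmf (bernoulli_pmf p)"
      and m: "(\<lambda>\<omega>. a \<omega> i j) \<in> measurable M (count_space UNIV)"
      using er that erdos_renyi_edge_measurable[OF er, of i j] unfolding erdos_renyi_def E_def e by auto
    have "expectation (X e) = integral\<^sup>L (distr M (count_space UNIV) (\<lambda>\<omega>. a \<omega> i j)) (\<lambda>x. of_bool x - p)"
      using m by (subst integral_distr) (auto simp: X_def[abs_def] e)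
    also have "\<dots> = 0" unfolding d using p by (simp add: algebra_simps)
    finally show ?thesis .
  qed
  let ?I = "{h i j, h i k, h i' j, h i' k}"
  have I: "?I \<subseteq> E" using True ij by (auto simp: h_def E_def min_def max_def)
  have ce: "centred_edge p (a \<omega>) i j = X (h i j) \<omega>"
    if "\<omega> \<in> space M" "i \<in> {1..N}" "j \<in> {1..N}" "i \<noteq> j" for \<omega> i j
  proof -
    have "a \<omega> i j \<longleftrightarrow> a \<omega> j i" using er that unfolding erdos_renyi_def by blast
    then show ?thesis using that by (auto simp: centred_edge_def X_def h_def min_def max_def)
  qed
  have dist: "h i j \<noteq> h i k" "h i j \<noteq> h i' j" "h i j \<noteq> h i' k" "h i k \<noteq> h i' j" "h i k \<noteq> h i' k" "h i' j \<noteq> h i' k"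
    using True ne by (auto simp: h_def min_def max_def split: if_splits)
  have "expectation (\<lambda>\<omega>. centred_edge p (a \<omega>) i j * centred_edge p (a \<omega>) i k *
     (centred_edge p (a \<omega>) i' j * centred_edge p (a \<omega>) i' k)) = expectation (\<lambda>\<omega>. \<Prod>e\<in>?I. X e \<omega>)"
    using dist True ij by (intro Bochner_Integration.integral_cong refl) (simp add: ce)
  also have "\<dots> = (\<Prod>e\<in>?I. expectation (X e))"
  proof (rule indep_vars_lebesgue_integral)
    show "indep_vars (\<lambda>_. borel) X ?I" by (rule indep_vars_subset[OF indep I])
    fix e assume "e \<in> ?I"
    then have "e \<in> E" using I by auto
    then have [measurable]: "X e \<in> borel_measurable M" using indep by (auto simp: indep_vars_def)
    show "integrable M (X e)"
      by (rule integrable_const_bound[of _ 1]) (use p in \<open>auto simp: X_def\<close>)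
  qed simp
  also have "\<dots> = 0" using zero I by (auto intro!: prod_zero)
  finally show ?thesis .
qed

text \<open>For j different from k the mean of the expanded square keeps only the N terms with i =
  i', by \<open>expectation_centred_edge_cycle\<close>, so the mean absolute value is at most sqrt
  N. There are at most N^2 such entries; the N diagonal ones are not centred and are bounded
  trivially by N each.\<close>

lemma (in prob_space) expectation_codegree_deviation_le:
  assumes er: "erdos_renyi M N p a" and p: "0 < p" "p \<le> 1" and N: "0 < N"
  shows "integrable M (\<lambda>\<omega>. codegree_deviation N p (a \<omega>))"
    and "expectation (\<lambda>\<omega>. codegree_deviation N p (a \<omega>)) \<le> (real N)\<^sup>2 * sqrt (real N) + (real N)\<^sup>2"
proof -
  define b where "b \<omega> i j = centred_edge p (a \<omega>) i j" for \<omega> i j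
  define Y where "Y j k \<omega> = (\<Sum>i=1..N. b \<omega> i j * b \<omega> i k)" for j k \<omega>
  have bm: "(\<lambda>\<omega>. b \<omega> i j) \<in> borel_measurable M" if "i \<in> {1..N}" "j \<in> {1..N}" for i j
    unfolding b_def using er that by (rule erdos_renyi_centred_edge_measurable)
  have b1: "\<bar>b \<omega> i j\<bar> \<le> 1" for \<omega> i j unfolding b_def using p by (rule abs_centred_edge_le)
  have bb1: "\<bar>b \<omega> i j * b \<omega> i' j'\<bar> \<le> 1" for \<omega> i j i' j'
    unfolding abs_mult using b1 by (simp add: mult_le_one)
  have Ym: "Y j k \<in> borel_measurable M" if "j \<in> {1..N}" "k \<in> {1..N}" for j k
    unfolding Y_def[abs_def] using bm that by (intro borel_measurable_sum borel_measurable_times) auto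
  have YN: "\<bar>Y j k \<omega>\<bar> \<le> real N" for j k \<omega>
  proof -
    have "\<bar>Y j k \<omega>\<bar> \<le> (\<Sum>i=1..N. \<bar>b \<omega> i j * b \<omega> i k\<bar>)" unfolding Y_def by (rule sum_abs)
    also have "\<dots> \<le> (\<Sum>i=1..N. 1)" by (intro sum_mono bb1)
    finally show ?thesis by simp
  qed
  have Yint: "integrable M (\<lambda>\<omega>. \<bar>Y j k \<omega>\<bar>)" if "j \<in> {1..N}" "k \<in> {1..N}" for j k
    by (rule integrable_const_bound[of _ "real N"]) (use YN Ym[OF that] in auto)
  have cd: "codegree_deviation N p (a \<omega>) = (\<Sum>j=1..N. \<Sum>k=1..N. \<bar>Y j k \<omega>\<bar>)" for \<omega>
    by (simp add: codegree_deviation_def Y_def b_def)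
  show "integrable M (\<lambda>\<omega>. codegree_deviation N p (a \<omega>))"
    unfolding cd by (intro Bochner_Integration.integrable_sum Yint)
  have sq: "expectation (\<lambda>\<omega>. (Y j k \<omega>)\<^sup>2) \<le> real N" and sqint: "integrable M (\<lambda>\<omega>. (Y j k \<omega>)\<^sup>2)"
    if jk: "j \<in> {1..N}" "k \<in> {1..N}" "j \<noteq> k" for j k
  proof -
    show "integrable M (\<lambda>\<omega>. (Y j k \<omega>)\<^sup>2)"
      by (rule integrable_const_bound[of _ "(real N)\<^sup>2"])
        (use YN Ym[OF jk(1,2)] in \<open>auto simp: abs_le_square_iff[symmetric]\<close>)
    have int: "integrable M (\<lambda>\<omega>. b \<omega> i j * b \<omega> i k * (b \<omega> i' j * b \<omega> i' k))" and
      le: "expectation (\<lambda>\<omega>. b \<omega> i j * b \<omega> i k * (b \<omega> i' j * b \<omega> i' k)) \<le> (if i' = i then 1 else 0)"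
      if ii: "i \<in> {1..N}" "i' \<in> {1..N}" for i i'
    proof -
      have le1: "\<bar>b \<omega> i j * b \<omega> i k * (b \<omega> i' j * b \<omega> i' k)\<bar> \<le> 1" for \<omega>
        using mult_le_one[OF bb1[of \<omega> i j i k] _ bb1[of \<omega> i' j i' k]]
        by (simp only: abs_mult) simp
      show int: "integrable M (\<lambda>\<omega>. b \<omega> i j * b \<omega> i k * (b \<omega> i' j * b \<omega> i' k))"
        by (rule integrable_const_bound[of _ 1])
          (use le1 ii jk bm in \<open>auto intro!: borel_measurable_times\<close>)
      show "expectation (\<lambda>\<omega>. b \<omega> i j * b \<omega> i k * (b \<omega> i' j * b \<omega> i' k)) \<le> (if i' = i then 1 else 0)"
      proof (cases "i' = i")
        case True
        have "expectation (\<lambda>\<omega>. b \<omega> i j * b \<omega> i k * (b \<omega> i' j * b \<omega> i' k)) \<le> expectation (\<lambda>_. 1)"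
          by (rule integral_mono[OF int]) (use le1 abs_le_D1 in auto)
        then show ?thesis using True by (simp add: prob_space)
      next
        case False
        then show ?thesis using expectation_centred_edge_cycle[OF er p ii jk(1,2) _ jk(3)]
          by (simp add: b_def)
      qed
    qed
    have "expectation (\<lambda>\<omega>. (Y j k \<omega>)\<^sup>2)
        = expectation (\<lambda>\<omega>. \<Sum>i=1..N. \<Sum>i'=1..N. b \<omega> i j * b \<omega> i k * (b \<omega> i' j * b \<omega> i' k))"
      by (simp add: Y_def power2_eq_square sum_product)
    also have "\<dots> = (\<Sum>i=1..N. \<Sum>i'=1..N. expectation (\<lambda>\<omega>. b \<omega> i j * b \<omega> i k * (b \<omega> i' j * b \<omega> i' k)))"
      by (subst Bochner_Integration.integral_sum, intro Bochner_Integration.integrable_sum int, assumption+,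
          intro sum.cong refl Bochner_Integration.integral_sum int)
    also have "\<dots> \<le> (\<Sum>i=1..N. \<Sum>i'=1..N. if i' = i then 1 else 0)"
      by (intro sum_mono le)
    also have "\<dots> = (\<Sum>i=1..N. 1)" by (intro sum.cong refl) simp
    also have "\<dots> = real N" by simp
    finally show "expectation (\<lambda>\<omega>. (Y j k \<omega>)\<^sup>2) \<le> real N" .
  qed
  have Y1: "expectation (\<lambda>\<omega>. \<bar>Y j k \<omega>\<bar>) \<le> sqrt (real N) + (if k = j then real N else 0)"
    if jk: "j \<in> {1..N}" "k \<in> {1..N}" for j k
  proof (cases "k = j")
    case True
    have "expectation (\<lambda>\<omega>. \<bar>Y j k \<omega>\<bar>) \<le> expectation (\<lambda>_. real N)"
      by (rule integral_mono[OF Yint[OF jk]]) (use YN in auto)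
    then show ?thesis using True by (simp add: prob_space add_increasing)
  next
    case False
    have s: "0 < sqrt (real N)" using N by simp
    \<comment> \<open>The arithmetic-geometric mean inequality with weight sqrt N replaces
      Cauchy-Schwarz for expectations; each half contributes sqrt N / 2.\<close>
    have "expectation (\<lambda>\<omega>. \<bar>Y j k \<omega>\<bar>) \<le> expectation (\<lambda>\<omega>. (Y j k \<omega>)\<^sup>2 / (2 * sqrt (real N)) + sqrt (real N) / 2)"
    proof (rule integral_mono[OF Yint[OF jk]])
      show "integrable M (\<lambda>\<omega>. (Y j k \<omega>)\<^sup>2 / (2 * sqrt (real N)) + sqrt (real N) / 2)"
        using sqint[OF jk] False by auto
      fix \<omega>
      have "2 * \<bar>Y j k \<omega>\<bar> * sqrt (real N) \<le> (Y j k \<omega>)\<^sup>2 + (sqrt (real N))\<^sup>2"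
        using sum_squares_bound[of "\<bar>Y j k \<omega>\<bar>" "sqrt (real N)"] by simp
      then show "\<bar>Y j k \<omega>\<bar> \<le> (Y j k \<omega>)\<^sup>2 / (2 * sqrt (real N)) + sqrt (real N) / 2"
        using s by (simp add: field_simps power2_eq_square)
    qed
    also have "\<dots> = expectation (\<lambda>\<omega>. (Y j k \<omega>)\<^sup>2) / (2 * sqrt (real N)) + sqrt (real N) / 2"
      using sqint[OF jk] False by (simp add: prob_space)
    also have "\<dots> \<le> real N / (2 * sqrt (real N)) + sqrt (real N) / 2"
      using sq[OF jk] False by (intro add_right_mono divide_right_mono) auto
    also have "\<dots> = sqrt (real N)" using N by (simp add: real_div_sqrt field_simps)
    finally show ?thesis using False by simp
  qed
  have "expectation (\<lambda>\<omega>. codegree_deviation N p (a \<omega>)) = (\<Sum>j=1..N. \<Sum>k=1..N. expectation (\<lambda>\<omega>. \<bar>Y j k \<omega>\<bar>))"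
    unfolding cd
    by (subst Bochner_Integration.integral_sum, intro Bochner_Integration.integrable_sum Yint, assumption+,
        intro sum.cong refl Bochner_Integration.integral_sum Yint)
  also have "\<dots> \<le> (\<Sum>j=1..N. \<Sum>k=1..N. sqrt (real N) + (if k = j then real N else 0))"
    by (intro sum_mono Y1)
  also have "\<dots> = (\<Sum>j=1..N. real N * sqrt (real N) + real N)"
    by (intro sum.cong refl) (simp add: sum.distrib)
  also have "\<dots> = (real N)\<^sup>2 * sqrt (real N) + (real N)\<^sup>2"
    by (simp add: power2_eq_square distrib_left)
  finally show "expectation (\<lambda>\<omega>. codegree_deviation N p (a \<omega>)) \<le> (real N)\<^sup>2 * sqrt (real N) + (real N)\<^sup>2" .
qed

lemma (in prob_space) expectation_density_error_le:
  assumes er: "erdos_renyi M N p a" and p: "0 < p" "p \<le> 1" and N: "2 \<le> N"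
  shows "integrable M (\<lambda>\<omega>. density_error N p (a \<omega>))"
    and "expectation (\<lambda>\<omega>. density_error N p (a \<omega>))
      \<le> 2 * ((real N)\<^sup>2 * sqrt (real N) + (real N)\<^sup>2) / (real N * (mean_degree N p)\<^sup>2) + 2 / (real N - 1)\<^sup>2"
proof -
  have "0 < N" using N by simp
  note cd = expectation_codegree_deviation_le[OF er p this]
  show "integrable M (\<lambda>\<omega>. density_error N p (a \<omega>))"
    unfolding density_error_def using cd(1) by auto
  have "expectation (\<lambda>\<omega>. density_error N p (a \<omega>))
      = 2 * expectation (\<lambda>\<omega>. codegree_deviation N p (a \<omega>)) / (real N * (mean_degree N p)\<^sup>2) + 2 / (real N - 1)\<^sup>2"
    unfolding density_error_def using cd(1) by (simp add: prob_space)
  also have "\<dots> \<le> 2 * ((real N)\<^sup>2 * sqrt (real N) + (real N)\<^sup>2) / (real N * (mean_degree N p)\<^sup>2) + 2 / (real N - 1)\<^sup>2"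
    using cd(2) by (intro add_right_mono divide_right_mono mult_left_mono) auto
  finally show "expectation (\<lambda>\<omega>. density_error N p (a \<omega>))
      \<le> 2 * ((real N)\<^sup>2 * sqrt (real N) + (real N)\<^sup>2) / (real N * (mean_degree N p)\<^sup>2) + 2 / (real N - 1)\<^sup>2" .
qed


lemma tendsto_density_error_bound:
  assumes p: "0 < p"
  shows "(\<lambda>N. 2 * ((real N)\<^sup>2 * sqrt (real N) + (real N)\<^sup>2) / (real N * (mean_degree N p)\<^sup>2)
     + 2 / (real N - 1)\<^sup>2) \<longlonglongrightarrow> 0"
  unfolding mean_degree_def using p by real_asymp

section \<open>Supermartingales of finite Markov chains\<close>

text \<open>Dynkin's formula for finite \<open>C\<close>: by the forward equation, the derivative in
  t of the mean of V(s + t, .) after time t is the mean of the time derivative plus the generator of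
  V, which is nonpositive. The sign of \<open>P\<close> is a hypothesis because
  \<open>transition_function\<close> does not contain it.\<close>

lemma transition_function_supersolution:
  fixes V V' :: "real \<Rightarrow> 'c \<Rightarrow> real"
  assumes P: "transition_function C r P" and fin: "finite C" and c: "c \<in> C"
    and nonneg: "\<And>t d. 0 \<le> t \<Longrightarrow> d \<in> C \<Longrightarrow> 0 \<le> P t c d"
    and V: "\<And>t d. 0 \<le> t \<Longrightarrow> d \<in> C \<Longrightarrow> ((\<lambda>t. V t d) has_real_derivative V' t d) (at t within {0..})"
    and super: "\<And>t d. 0 \<le> t \<Longrightarrow> d \<in> C \<Longrightarrow> V' t d + (\<Sum>e\<in>C. generator C r d e * V t e) \<le> 0"
    and s: "0 \<le> s" and \<delta>: "0 \<le> \<delta>"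
  shows "(\<Sum>d\<in>C. P \<delta> c d * V (s + \<delta>) d) \<le> V s c"
proof -
  define h where "h t = (\<Sum>d\<in>C. P t c d * V (s + t) d)" for t
  define D where "D t = (\<Sum>e\<in>C. P t c e * (V' (s + t) e + (\<Sum>d\<in>C. generator C r e d * V (s + t) d)))" for t
  have dV: "((\<lambda>t. V (s + t) d) has_real_derivative V' (s + t) d) (at t within {0..})"
    if "0 \<le> t" "d \<in> C" for t d
  proof -
    have "((\<lambda>t. V t d) has_real_derivative V' (s + t) d) (at (s + t) within ((+) s) ` {0..})"
      by (rule DERIV_subset[OF V]) (use that s in auto)
    moreover have "((\<lambda>t. s + t) has_real_derivative 1) (at t within {0..})"
      by (auto intro!: derivative_eq_intros)
    ultimately show ?thesis using DERIV_image_chain[of "\<lambda>t. V t d" _ "(+) s" t "{0..}" 1]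
      by (simp add: comp_def)
  qed
  have dP: "((\<lambda>t. P t c d) has_real_derivative (\<Sum>e\<in>C. P t c e * generator C r e d)) (at t within {0..})"
    if "0 \<le> t" "d \<in> C" for t d
    using P c that unfolding transition_function_def by blast
  have dh: "(h has_real_derivative D t) (at t within {0..})" if t: "0 \<le> t" for t
  proof -
    have "(h has_real_derivative (\<Sum>d\<in>C. (\<Sum>e\<in>C. P t c e * generator C r e d) * V (s + t) d + V' (s + t) d * P t c d)) (at t within {0..})"
      unfolding h_def[abs_def] by (intro DERIV_sum DERIV_mult dP dV t)
    also have "(\<Sum>d\<in>C. (\<Sum>e\<in>C. P t c e * generator C r e d) * V (s + t) d + V' (s + t) d * P t c d)
        = (\<Sum>d\<in>C. \<Sum>e\<in>C. P t c e * generator C r e d * V (s + t) d) + (\<Sum>d\<in>C. V' (s + t) d * P t c d)"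
      by (simp add: sum.distrib sum_distrib_right)
    also have "(\<Sum>d\<in>C. \<Sum>e\<in>C. P t c e * generator C r e d * V (s + t) d)
        = (\<Sum>e\<in>C. \<Sum>d\<in>C. P t c e * generator C r e d * V (s + t) d)"
      by (rule sum.swap)
    also have "\<dots> + (\<Sum>d\<in>C. V' (s + t) d * P t c d) = D t"
      by (simp add: D_def sum.distrib sum_distrib_left algebra_simps)
    finally show ?thesis .
  qed
  have "h \<delta> \<le> h 0"
  proof (rule DERIV_nonpos_imp_decreasing_open[OF \<delta>])
    fix t assume t: "0 < t" "t < \<delta>"
    have "(h has_real_derivative D t) (at t within {0<..})"
      by (rule DERIV_subset[OF dh]) (use t in auto)
    then have "(h has_real_derivative D t) (at t)"
      using t by (simp add: at_within_open[of t "{0<..}"])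
    moreover have "D t \<le> 0"
      unfolding D_def by (intro sum_nonpos mult_nonneg_nonpos nonneg super) (use t s in auto)
    ultimately show "\<exists>y. (h has_real_derivative y) (at t) \<and> y \<le> 0" by blast
  next
    have "continuous_on {0..} h"
      by (rule DERIV_continuous_on[OF dh]) auto
    then show "continuous_on {0..\<delta>} h" by (rule continuous_on_subset) auto
  qed
  moreover have "h 0 = V s c"
  proof -
    have "h 0 = (\<Sum>d\<in>C. if d = c then V s c else 0)"
      unfolding h_def using P c by (intro sum.cong) (auto simp: transition_function_def)
    then show ?thesis using fin c by simp
  qed
  ultimately show ?thesis by (simp add: h_def)
qed

text \<open>Only states that are reached with positive probability are considered, since the defining
  identities of a Markov chain do not constrain the transition function elsewhere.\<close>

lemma (in prob_space) markov_chain_supersolution_step: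
  fixes V V' :: "real \<Rightarrow> 'c \<Rightarrow> real"
  assumes mc: "markov_chain M C r X" and fin: "finite C"
    and V: "\<And>t d. 0 \<le> t \<Longrightarrow> d \<in> C \<Longrightarrow> ((\<lambda>t. V t d) has_real_derivative V' t d) (at t within {0..})"
    and super: "\<And>t d. 0 \<le> t \<Longrightarrow> d \<in> C \<Longrightarrow> V' t d + (\<Sum>e\<in>C. generator C r d e * V t e) \<le> 0"
    and \<tau>: "0 \<le> \<tau> 0" "mono (\<tau> :: nat \<Rightarrow> real)"
  shows "expectation (\<lambda>\<omega>. of_bool (Q (restrict (\<lambda>k. X (\<tau> k) \<omega>) {..n})) * V (\<tau> (Suc n)) (X (\<tau> (Suc n)) \<omega>))
       \<le> expectation (\<lambda>\<omega>. of_bool (Q (restrict (\<lambda>k. X (\<tau> k) \<omega>) {..n})) * V (\<tau> n) (X (\<tau> n) \<omega>))"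
proof -
  obtain P where P: "transition_function C r P" and
    markov: "\<And>n (\<tau> :: nat \<Rightarrow> real) c. 0 \<le> \<tau> 0 \<Longrightarrow> (\<forall>k\<le>n. \<tau> k \<le> \<tau> (Suc k)) \<Longrightarrow> (\<forall>k\<le>Suc n. c k \<in> C) \<Longrightarrow>
           prob {\<omega>\<in>space M. \<forall>k\<le>n. X (\<tau> k) \<omega> = c k} > 0 \<Longrightarrow>
           \<P>(\<omega> in M. X (\<tau> (Suc n)) \<omega> = c (Suc n) \<bar> \<forall>k\<le>n. X (\<tau> k) \<omega> = c k) =
             P (\<tau> (Suc n) - \<tau> n) (c n) (c (Suc n))"
    using mc unfolding markov_chain_def by blast
  have X: "X t \<in> measurable M (count_space C)" if "0 \<le> t" for t
    using mc that unfolding markov_chain_def by blast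
  have \<tau>0: "0 \<le> \<tau> k" for k using \<tau> monoD[OF \<tau>(2), of 0 k] by simp
  have XC: "X (\<tau> k) \<omega> \<in> C" if "\<omega> \<in> space M" for k \<omega>
    using measurable_space[OF X[OF \<tau>0] that] by simp
  have eqm: "{\<omega>\<in>space M. X t \<omega> = c} \<in> events" if "0 \<le> t" "c \<in> C" for t c
    using measurable_sets[OF X[OF that(1)], of "{c}"] that(2) by (simp add: vimage_def Int_def conj_commute)
  \<comment> \<open>\<open>C\<close> is finite, so any event \<open>Q\<close> about the past at the
    grid times is a finite disjoint union of these path events.\<close>
  define A where "A c = {\<omega>\<in>space M. \<forall>k\<le>n. X (\<tau> k) \<omega> = c k}" for c
  have Am: "A c \<in> events" if "c \<in> {..n} \<rightarrow>\<^sub>E C" for c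
  proof -
    have "A c = (\<Inter>k\<in>{..n}. {\<omega>\<in>space M. X (\<tau> k) \<omega> = c k})" by (auto simp: A_def)
    also have "\<dots> \<in> events"
      by (intro sets.finite_INT) (use eqm[OF \<tau>0] that in auto)
    finally show ?thesis .
  qed
  let ?G = "{c \<in> {..n} \<rightarrow>\<^sub>E C. Q c}"
  have finG: "finite ?G" using finite_PiE[of "{..n}" "\<lambda>_. C"] fin by simp
  have path: "of_bool (Q (restrict (\<lambda>k. X (\<tau> k) \<omega>) {..n})) = (\<Sum>c\<in>?G. indicat_real (A c) \<omega>)"
    if \<omega>: "\<omega> \<in> space M" for \<omega>
  proof -
    let ?p = "restrict (\<lambda>k. X (\<tau> k) \<omega>) {..n}"
    have p: "?p \<in> {..n} \<rightarrow>\<^sub>E C" using XC[OF \<omega>] by auto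
    have "(\<Sum>c\<in>?G. indicat_real (A c) \<omega>) = (\<Sum>c\<in>?G. if c = ?p then 1 else 0)"
    proof (intro sum.cong refl)
      fix c assume "c \<in> ?G"
      then have "c = restrict c {..n}" by (auto simp: PiE_def extensional_restrict)
      then have "\<omega> \<in> A c \<longleftrightarrow> c = ?p" using \<omega> unfolding A_def by (auto simp: fun_eq_iff restrict_def split: if_splits)
      then show "indicat_real (A c) \<omega> = (if c = ?p then 1 else 0)" by (simp add: indicator_def)
    qed
    also have "\<dots> = of_bool (Q ?p)" using finG p by simp
    finally show ?thesis by simp
  qed
  have step: "expectation (\<lambda>\<omega>. indicat_real (A c) \<omega> * V (\<tau> (Suc n)) (X (\<tau> (Suc n)) \<omega>))
      \<le> prob (A c) * V (\<tau> n) (c n)" if c: "c \<in> {..n} \<rightarrow>\<^sub>E C" for c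
  proof -
    have cn: "c n \<in> C" using c by auto
    let ?B = "\<lambda>d. A c \<inter> {\<omega>\<in>space M. X (\<tau> (Suc n)) \<omega> = d}"
    have "expectation (\<lambda>\<omega>. indicat_real (A c) \<omega> * V (\<tau> (Suc n)) (X (\<tau> (Suc n)) \<omega>))
        = expectation (\<lambda>\<omega>. \<Sum>d\<in>C. indicat_real (?B d) \<omega> * V (\<tau> (Suc n)) d)"
    proof (intro Bochner_Integration.integral_cong refl)
      fix \<omega> assume \<omega>: "\<omega> \<in> space M"
      have "(\<Sum>d\<in>C. indicat_real (?B d) \<omega> * V (\<tau> (Suc n)) d)
          = (\<Sum>d\<in>C. if d = X (\<tau> (Suc n)) \<omega> then indicat_real (A c) \<omega> * V (\<tau> (Suc n)) d else 0)"
        by (intro sum.cong) (use \<omega> in \<open>auto simp: indicator_def\<close>)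
      then show "indicat_real (A c) \<omega> * V (\<tau> (Suc n)) (X (\<tau> (Suc n)) \<omega>)
          = (\<Sum>d\<in>C. indicat_real (?B d) \<omega> * V (\<tau> (Suc n)) d)"
        using fin XC[OF \<omega>] by simp
    qed
    also have "\<dots> = (\<Sum>d\<in>C. prob (?B d) * V (\<tau> (Suc n)) d)"
      using Am[OF c] eqm[OF \<tau>0] by (subst Bochner_Integration.integral_sum) (auto simp: less_top[symmetric])
    also have "\<dots> \<le> prob (A c) * V (\<tau> n) (c n)"
    proof (cases "prob (A c) = 0")
      case True
      have "prob (?B d) = 0" if "d \<in> C" for d
        using finite_measure_mono[of "?B d" "A c"] Am[OF c] True measure_nonneg[of M "?B d"] by auto
      then show ?thesis using True by simp
    next
      case False
      then have pos: "0 < prob (A c)" by (simp add: zero_less_measure_iff)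
      have trans: "prob (?B d) = prob (A c) * P (\<tau> (Suc n) - \<tau> n) (c n) d" if d: "d \<in> C" for d
      proof -
        \<comment> \<open>The Markov property takes past and next state as one path:
          \<open>c\<close> up to \<open>n\<close>, then \<open>d\<close>.\<close>
        let ?c = "\<lambda>k. if k \<le> n then c k else d"
        have eq: "A c = {\<omega>\<in>space M. \<forall>k\<le>n. X (\<tau> k) \<omega> = ?c k}" unfolding A_def by auto
        have "P (\<tau> (Suc n) - \<tau> n) (?c n) (?c (Suc n))
            = \<P>(\<omega> in M. X (\<tau> (Suc n)) \<omega> = ?c (Suc n) \<bar> \<forall>k\<le>n. X (\<tau> k) \<omega> = ?c k)"
        proof (rule markov[symmetric])
          show "0 < prob {\<omega>\<in>space M. \<forall>k\<le>n. X (\<tau> k) \<omega> = ?c k}" using pos unfolding eq .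
          show "\<forall>k\<le>n. \<tau> k \<le> \<tau> (Suc k)" using \<tau>(2) by (simp add: monoD)
          show "\<forall>k\<le>Suc n. ?c k \<in> C" using c d by auto
        qed (rule \<tau>(1))
        also have "\<dots> = prob (?B d) / prob (A c)"
        proof -
          have "{\<omega>\<in>space M. X (\<tau> (Suc n)) \<omega> = ?c (Suc n) \<and> (\<forall>k\<le>n. X (\<tau> k) \<omega> = ?c k)} = ?B d"
            by (auto simp: A_def)
          then show ?thesis unfolding cond_prob_def eq by (rule arg_cong)
        qed
        finally have "P (\<tau> (Suc n) - \<tau> n) (c n) d = prob (?B d) / prob (A c)"
          by (simp only: le_refl if_True if_False Suc_n_not_le_n)
        then show ?thesis using pos by (metis eq_divide_eq mult.commute order_less_irrefl)
      qed
      have posn: "0 < prob {\<omega>\<in>space M. X (\<tau> n) \<omega> = c n}"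
      proof (rule less_le_trans[OF pos], rule finite_measure_mono)
        show "A c \<subseteq> {\<omega>\<in>space M. X (\<tau> n) \<omega> = c n}" by (auto simp: A_def)
      qed (rule eqm[OF \<tau>0 cn])
      \<comment> \<open>Since \<open>c n\<close> is visited at time \<open>\<tau> n\<close> with
        positive probability, \<open>P t (c n) d\<close> is a genuine conditional probability, read
        off from the two times \<open>\<tau> n\<close> and \<open>\<tau> n + t\<close>.\<close>
      have "0 \<le> P t (c n) d" if "0 \<le> t" "d \<in> C" for t d
      proof -
        let ?t = "\<lambda>k::nat. if k = 0 then \<tau> n else \<tau> n + t" and ?c = "\<lambda>k::nat. if k = 0 then c n else d"
        have M: "\<P>(\<omega> in M. X (?t (Suc 0)) \<omega> = ?c (Suc 0) \<bar> \<forall>k\<le>0. X (?t k) \<omega> = ?c k) = P (?t (Suc 0) - ?t 0) (?c 0) (?c (Suc 0))"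
          by (rule markov) (use \<tau>0 that cn posn in auto)
        have "0 \<le> P (?t (Suc 0) - ?t 0) (?c 0) (?c (Suc 0))"
          unfolding M[symmetric] cond_prob_def by (intro divide_nonneg_nonneg measure_nonneg)
        then show ?thesis by simp
      qed
      from transition_function_supersolution[OF P fin cn this V super \<tau>0, of "\<tau> (Suc n) - \<tau> n" n] monoD[OF \<tau>(2), of n "Suc n"]
      have "(\<Sum>d\<in>C. P (\<tau> (Suc n) - \<tau> n) (c n) d * V (\<tau> (Suc n)) d) \<le> V (\<tau> n) (c n)" by simp
      then have "prob (A c) * (\<Sum>d\<in>C. P (\<tau> (Suc n) - \<tau> n) (c n) d * V (\<tau> (Suc n)) d) \<le> prob (A c) * V (\<tau> n) (c n)"
        by (rule mult_left_mono) simp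
      moreover have "(\<Sum>d\<in>C. prob (?B d) * V (\<tau> (Suc n)) d)
          = prob (A c) * (\<Sum>d\<in>C. P (\<tau> (Suc n) - \<tau> n) (c n) d * V (\<tau> (Suc n)) d)"
        unfolding sum_distrib_left by (intro sum.cong refl) (simp only: trans mult.assoc)
      ultimately show ?thesis by simp
    qed
    finally show ?thesis .
  qed
  have vX: "(\<lambda>\<omega>. V t (X (\<tau> k) \<omega>)) \<in> borel_measurable M" for t k
    using measurable_compose[OF X[OF \<tau>0], of "V t" borel] by simp
  have int: "integrable M (\<lambda>\<omega>. indicat_real (A c) \<omega> * V t (X (\<tau> k) \<omega>))" if "c \<in> ?G" for c t k
  proof (rule integrable_const_bound[of _ "\<Sum>d\<in>C. \<bar>V t d\<bar>"])
    show "AE \<omega> in M. norm (indicat_real (A c) \<omega> * V t (X (\<tau> k) \<omega>)) \<le> (\<Sum>d\<in>C. \<bar>V t d\<bar>)"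
    proof (rule AE_I2)
      fix \<omega> assume "\<omega> \<in> space M"
      have "\<bar>V t (X (\<tau> k) \<omega>)\<bar> \<le> (\<Sum>d\<in>C. \<bar>V t d\<bar>)"
        by (rule member_le_sum[OF XC[OF \<open>\<omega> \<in> space M\<close>], where f = "\<lambda>d. \<bar>V t d\<bar>"]) (use fin in auto)
      then show "norm (indicat_real (A c) \<omega> * V t (X (\<tau> k) \<omega>)) \<le> (\<Sum>d\<in>C. \<bar>V t d\<bar>)"
        by (auto simp: indicator_def intro: sum_nonneg)
    qed
  qed (use that Am vX in auto)
  have "expectation (\<lambda>\<omega>. of_bool (Q (restrict (\<lambda>k. X (\<tau> k) \<omega>) {..n})) * V (\<tau> (Suc n)) (X (\<tau> (Suc n)) \<omega>))
      = expectation (\<lambda>\<omega>. \<Sum>c\<in>?G. indicat_real (A c) \<omega> * V (\<tau> (Suc n)) (X (\<tau> (Suc n)) \<omega>))"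
    by (intro Bochner_Integration.integral_cong refl) (simp only: path sum_distrib_right)
  also have "\<dots> = (\<Sum>c\<in>?G. expectation (\<lambda>\<omega>. indicat_real (A c) \<omega> * V (\<tau> (Suc n)) (X (\<tau> (Suc n)) \<omega>)))"
    by (intro Bochner_Integration.integral_sum int)
  also have "\<dots> \<le> (\<Sum>c\<in>?G. prob (A c) * V (\<tau> n) (c n))"
    by (intro sum_mono step) auto
  also have "\<dots> = (\<Sum>c\<in>?G. expectation (\<lambda>\<omega>. indicat_real (A c) \<omega> * V (\<tau> n) (X (\<tau> n) \<omega>)))"
  proof (intro sum.cong refl)
    fix c assume "c \<in> ?G"
    have "expectation (\<lambda>\<omega>. indicat_real (A c) \<omega> * V (\<tau> n) (X (\<tau> n) \<omega>)) = expectation (\<lambda>\<omega>. indicat_real (A c) \<omega> * V (\<tau> n) (c n))"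
      by (intro Bochner_Integration.integral_cong refl) (auto simp: indicator_def A_def)
    also have "\<dots> = prob (A c) * V (\<tau> n) (c n)"
      using Am \<open>c \<in> ?G\<close> by simp
    finally show "prob (A c) * V (\<tau> n) (c n) = expectation (\<lambda>\<omega>. indicat_real (A c) \<omega> * V (\<tau> n) (X (\<tau> n) \<omega>))" by simp
  qed
  also have "\<dots> = expectation (\<lambda>\<omega>. \<Sum>c\<in>?G. indicat_real (A c) \<omega> * V (\<tau> n) (X (\<tau> n) \<omega>))"
    by (intro Bochner_Integration.integral_sum[symmetric] int)
  also have "\<dots> = expectation (\<lambda>\<omega>. of_bool (Q (restrict (\<lambda>k. X (\<tau> k) \<omega>) {..n})) * V (\<tau> n) (X (\<tau> n) \<omega>))"
    by (intro Bochner_Integration.integral_cong refl) (simp only: path sum_distrib_right)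
  finally show ?thesis .
qed


text \<open>Doob's argument without stopping times: \<open>J\<close> freezes at the level
  \<open>l\<close> at the first exceedance, and its mean does not increase. At the last grid point
  it dominates \<open>l\<close> times the indicator of an exceedance because \<open>V\<close> is
  nonnegative there.\<close>

lemma (in prob_space) markov_chain_maximal_grid:
  fixes V V' :: "real \<Rightarrow> 'c \<Rightarrow> real"
  assumes mc: "markov_chain M C r X" and fin: "finite C"
    and V: "\<And>t d. 0 \<le> t \<Longrightarrow> d \<in> C \<Longrightarrow> ((\<lambda>t. V t d) has_real_derivative V' t d) (at t within {0..})"
    and super: "\<And>t d. 0 \<le> t \<Longrightarrow> d \<in> C \<Longrightarrow> V' t d + (\<Sum>e\<in>C. generator C r d e * V t e) \<le> 0"
    and V0: "\<And>d. d \<in> C \<Longrightarrow> 0 \<le> V (\<tau> n) d"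
    and \<tau>: "\<tau> 0 = 0" "mono (\<tau> :: nat \<Rightarrow> real)"
  shows "l * prob {\<omega>\<in>space M. \<exists>k\<le>n. V (\<tau> k) (X (\<tau> k) \<omega>) > l} \<le> expectation (\<lambda>\<omega>. V 0 (X 0 \<omega>))"
proof -
  have X: "X t \<in> measurable M (count_space C)" if "0 \<le> t" for t
    using mc that unfolding markov_chain_def by blast
  have \<tau>0: "0 \<le> \<tau> k" for k using \<tau>(1) monoD[OF \<tau>(2), of 0 k] by simp
  have XC: "X (\<tau> k) \<omega> \<in> C" if "\<omega> \<in> space M" for k \<omega>
    using measurable_space[OF X[OF \<tau>0] that] by simp
  define Z where "Z k \<omega> = V (\<tau> k) (X (\<tau> k) \<omega>)" for k \<omega>
  have Zm [measurable]: "Z k \<in> borel_measurable M" for k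
    unfolding Z_def[abs_def] using measurable_compose[OF X[OF \<tau>0], of "V (\<tau> k)" borel] by simp
  have Zint: "integrable M (Z k)" for k
  proof (rule integrable_const_bound[of _ "\<Sum>d\<in>C. \<bar>V (\<tau> k) d\<bar>"])
    show "AE \<omega> in M. norm (Z k \<omega>) \<le> (\<Sum>d\<in>C. \<bar>V (\<tau> k) d\<bar>)"
    proof (rule AE_I2)
      fix \<omega> assume "\<omega> \<in> space M"
      then show "norm (Z k \<omega>) \<le> (\<Sum>d\<in>C. \<bar>V (\<tau> k) d\<bar>)"
        unfolding Z_def real_norm_def
        by (intro member_le_sum[where f = "\<lambda>d. \<bar>V (\<tau> k) d\<bar>"]) (use fin XC in auto)
    qed
  qed simp
  have bint: "integrable M (\<lambda>\<omega>. of_bool (\<forall>j\<le>k. Z j \<omega> \<le> l) * Z m \<omega>)" for k m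
    by (rule Bochner_Integration.integrable_bound[OF Zint[of m]]) auto
  have pint: "integrable M (\<lambda>\<omega>. l * of_bool (\<exists>j\<le>k. l < Z j \<omega>))" for k
    by (rule integrable_const_bound[of _ "\<bar>l\<bar>"]) auto
  define J where "J k \<omega> = l * of_bool (\<exists>j\<le>k. l < Z j \<omega>) + of_bool (\<forall>j\<le>k. Z j \<omega> \<le> l) * Z k \<omega>" for k \<omega>
  have Jint: "integrable M (J k)" for k
    unfolding J_def[abs_def] by (intro Bochner_Integration.integrable_add pint bint)
  have J: "expectation (J k) \<le> expectation (Z 0)" for k
  proof (induction k)
    case 0
    show ?case by (rule integral_mono[OF Jint Zint]) (auto simp: J_def)
  next
    case (Suc k)
    let ?I = "\<lambda>\<omega>. l * of_bool (\<exists>j\<le>k. l < Z j \<omega>)"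
    have "expectation (J (Suc k)) \<le> expectation (\<lambda>\<omega>. ?I \<omega> + of_bool (\<forall>j\<le>k. Z j \<omega> \<le> l) * Z (Suc k) \<omega>)"
    proof (rule integral_mono[OF Jint])
      show "integrable M (\<lambda>\<omega>. ?I \<omega> + of_bool (\<forall>j\<le>k. Z j \<omega> \<le> l) * Z (Suc k) \<omega>)"
        by (intro Bochner_Integration.integrable_add pint bint)
      fix \<omega>
      show "J (Suc k) \<omega> \<le> ?I \<omega> + of_bool (\<forall>j\<le>k. Z j \<omega> \<le> l) * Z (Suc k) \<omega>"
      proof (cases "\<exists>j\<le>k. l < Z j \<omega>")
        case True
        then have e: "(\<forall>j\<le>k. Z j \<omega> \<le> l) = False" "(\<exists>j\<le>Suc k. l < Z j \<omega>) = True"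
          "(\<forall>j\<le>Suc k. Z j \<omega> \<le> l) = False" "(\<exists>j\<le>k. l < Z j \<omega>) = True"
          by (auto simp: not_le intro: le_SucI)
        show ?thesis unfolding J_def e by simp
      next
        case False
        then have 1: "\<forall>j\<le>k. Z j \<omega> \<le> l" by (simp add: not_less)
        then have 2: "(\<exists>j\<le>Suc k. l < Z j \<omega>) \<longleftrightarrow> l < Z (Suc k) \<omega>"
          "(\<forall>j\<le>Suc k. Z j \<omega> \<le> l) \<longleftrightarrow> Z (Suc k) \<omega> \<le> l"
          by (auto simp: le_Suc_eq not_less)
        show ?thesis unfolding J_def 2 using 1 False by auto
      qed
    qed
    also have "\<dots> = expectation ?I + expectation (\<lambda>\<omega>. of_bool (\<forall>j\<le>k. Z j \<omega> \<le> l) * Z (Suc k) \<omega>)"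
      by (intro Bochner_Integration.integral_add pint bint)
    \<comment> \<open>The past event is that no exceedance has occurred up to \<open>k\<close>; on
      it the chain takes one more supermartingale step.\<close>
    also have "expectation (\<lambda>\<omega>. of_bool (\<forall>j\<le>k. Z j \<omega> \<le> l) * Z (Suc k) \<omega>)
        \<le> expectation (\<lambda>\<omega>. of_bool (\<forall>j\<le>k. Z j \<omega> \<le> l) * Z k \<omega>)"
      using markov_chain_supersolution_step[OF mc fin V super \<tau>0 \<tau>(2),
          of "\<lambda>c. \<forall>j\<le>k. V (\<tau> j) (c j) \<le> l" k]
      by (simp add: Z_def cong: conj_cong imp_cong)
    also have "expectation ?I + expectation (\<lambda>\<omega>. of_bool (\<forall>j\<le>k. Z j \<omega> \<le> l) * Z k \<omega>) = expectation (J k)"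
      unfolding J_def[abs_def] by (intro Bochner_Integration.integral_add[symmetric] pint bint)
    finally show ?case using Suc.IH by simp
  qed
  have "l * prob {\<omega>\<in>space M. \<exists>k\<le>n. l < Z k \<omega>} = expectation (\<lambda>\<omega>. l * indicator {\<omega>\<in>space M. \<exists>k\<le>n. l < Z k \<omega>} \<omega>)"
    by simp
  also have "\<dots> = expectation (\<lambda>\<omega>. l * of_bool (\<exists>j\<le>n. l < Z j \<omega>))"
    by (intro Bochner_Integration.integral_cong refl) (auto simp: indicator_def)
  also have "\<dots> \<le> expectation (J n)"
  proof (rule integral_mono[OF pint Jint])
    fix \<omega> assume "\<omega> \<in> space M"
    then have "0 \<le> Z n \<omega>" using V0 XC by (simp add: Z_def)
    then show "l * of_bool (\<exists>j\<le>n. l < Z j \<omega>) \<le> J n \<omega>" by (simp add: J_def)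
  qed
  also have "\<dots> \<le> expectation (Z 0)" by (rule J)
  finally show ?thesis unfolding Z_def[abs_def] \<tau>(1) .
qed

text \<open>An exceedance before \<open>T\<close> persists on an interval to the right, which meets
  every sufficiently fine grid; \<open>T\<close> itself belongs to every grid. Asking for all large
  \<open>m\<close>, instead of some \<open>m\<close>, makes the conditions for fixed
  \<open>n\<close> weaken as \<open>n\<close> grows, while each still implies an exceedance on the
  single grid \<open>m = n\<close>.\<close>

lemma exceedance_iff_grid:
  fixes Y :: "real \<Rightarrow> real"
  assumes T: "0 < T"
    and right: "\<And>t. 0 \<le> t \<Longrightarrow> t < T \<Longrightarrow> l < Y t \<Longrightarrow> \<forall>\<^sub>F s in at_right t. l < Y s"
  shows "(\<exists>t\<in>{0..T}. l < Y t) \<longleftrightarrow> (\<exists>n. \<forall>m\<ge>n. \<exists>k\<le>Suc m. l < Y (real k * T / real (Suc m)))"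
proof
  assume "\<exists>t\<in>{0..T}. l < Y t"
  then obtain t where t: "0 \<le> t" "t \<le> T" "l < Y t" by auto
  show "\<exists>n. \<forall>m\<ge>n. \<exists>k\<le>Suc m. l < Y (real k * T / real (Suc m))"
  proof (cases "t = T")
    case True
    then have "l < Y (real (Suc m) * T / real (Suc m))" for m using t by simp
    then show ?thesis by blast
  next
    case False
    then have "t < T" using t by simp
    from right[OF t(1) this t(3)] obtain b where b: "t < b" "\<And>s. t < s \<Longrightarrow> s < b \<Longrightarrow> l < Y s"
      by (auto simp: eventually_at_right[of t "t + 1"])
    define e where "e = min b T - t"
    have e: "0 < e" using b \<open>t < T\<close> by (simp add: e_def)
    obtain n :: nat where n: "T / e < real n" using reals_Archimedean2 by blast
    have "\<exists>k\<le>Suc m. l < Y (real k * T / real (Suc m))" if m: "n \<le> m" for m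
    proof -
      define M where "M = real (Suc m)"
      have M: "0 < M" by (simp add: M_def)
      have "T / e < M" using n m unfolding M_def by linarith
      then have TM: "T / M < e" using M e by (simp add: field_simps)
      \<comment> \<open>The first grid index at or after \<open>t\<close>; the grid point overshoots
        \<open>t\<close> by less than the mesh \<open>T / M\<close>.\<close>
      define k where "k = nat \<lceil>t * M / T\<rceil>"
      have "0 \<le> t * M / T" using t M T by auto
      then have k1: "t * M / T \<le> real k" and k2: "real k < t * M / T + 1"
        unfolding k_def by linarith+
      have lo: "t \<le> real k * T / M" using k1 M T by (simp add: field_simps)
      have "real k * T / M < t + T / M" using k2 M T by (simp add: field_simps)
      then have hi: "real k * T / M < t + e" using TM by linarith
      then have "real k * T / M < T" by (simp add: e_def)
      then have "real k < M" using M T by (simp add: field_simps)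
      then have "k \<le> Suc m" by (simp add: M_def)
      moreover have "l < Y (real k * T / M)"
        using lo hi b(2)[of "real k * T / M"] t(3) by (cases "real k * T / M = t") (auto simp: e_def)
      ultimately show ?thesis unfolding M_def by blast
    qed
    then show ?thesis by blast
  qed
next
  assume "\<exists>n. \<forall>m\<ge>n. \<exists>k\<le>Suc m. l < Y (real k * T / real (Suc m))"
  then obtain k m where "k \<le> Suc m" "l < Y (real k * T / real (Suc m))" by blast
  moreover from this T have "real k * T / real (Suc m) \<in> {0..T}"
    by (auto simp: divide_simps mult.commute intro: mult_left_mono)
  ultimately show "\<exists>t\<in>{0..T}. l < Y t" by blast
qed

lemma exceedance_measurable:
  fixes Y :: "real \<Rightarrow> 'w \<Rightarrow> real"
  assumes T: "0 < T"
    and right: "\<And>\<omega> t. \<omega> \<in> space M \<Longrightarrow> 0 \<le> t \<Longrightarrow> t < T \<Longrightarrow> l < Y t \<omega> \<Longrightarrow> \<forall>\<^sub>F s in at_right t. l < Y s \<omega>"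
    and Y: "\<And>t. 0 \<le> t \<Longrightarrow> {\<omega>\<in>space M. l < Y t \<omega>} \<in> sets M"
  shows "{\<omega>\<in>space M. \<exists>t\<in>{0..T}. l < Y t \<omega>} \<in> sets M"
proof -
  have "{\<omega>\<in>space M. \<exists>t\<in>{0..T}. l < Y t \<omega>}
      = {\<omega>\<in>space M. \<exists>n. \<forall>m\<ge>n. \<exists>k\<le>Suc m. l < Y (real k * T / real (Suc m)) \<omega>}"
    by (intro Collect_cong conj_cong refl exceedance_iff_grid[OF T] right)
  also have "\<dots> \<in> sets M"
    by (intro sets.sets_Collect_countable_Ex sets.sets_Collect_countable_All sets.sets_Collect_imp
        sets.sets_Collect_conj sets.sets_Collect_const Y) (use T in auto)
  finally show ?thesis .
qed

text \<open>A bound uniform over grids survives the limit without a union bound: the events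
  \<open>G n\<close> increase to the exceedance event, and \<open>G n\<close> is contained in the
  grid event \<open>F n\<close>, whose probability is at most \<open>B\<close>.\<close>

lemma (in prob_space) exceedance_prob_le:
  fixes Y :: "real \<Rightarrow> 'a \<Rightarrow> real"
  assumes T: "0 < T"
    and right: "\<And>\<omega> t. \<omega> \<in> space M \<Longrightarrow> 0 \<le> t \<Longrightarrow> t < T \<Longrightarrow> l < Y t \<omega> \<Longrightarrow> \<forall>\<^sub>F s in at_right t. l < Y s \<omega>"
    and Y: "\<And>t. 0 \<le> t \<Longrightarrow> {\<omega>\<in>space M. l < Y t \<omega>} \<in> events"
    and grid: "\<And>m. prob {\<omega>\<in>space M. \<exists>k\<le>Suc m. l < Y (real k * T / real (Suc m)) \<omega>} \<le> B"
  shows "prob {\<omega>\<in>space M. \<exists>t\<in>{0..T}. l < Y t \<omega>} \<le> B"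
proof -
  define F where "F m = {\<omega>\<in>space M. \<exists>k\<le>Suc m. l < Y (real k * T / real (Suc m)) \<omega>}" for m
  define G where "G n = {\<omega>\<in>space M. \<forall>m\<ge>n. \<exists>k\<le>Suc m. l < Y (real k * T / real (Suc m)) \<omega>}" for n
  have Fm: "F m \<in> events" for m
    unfolding F_def
    by (intro sets.sets_Collect_countable_Ex sets.sets_Collect_conj sets.sets_Collect_const Y) (use T in auto)
  have Gm: "G n \<in> events" for n
    unfolding G_def
    by (intro sets.sets_Collect_countable_Ex sets.sets_Collect_countable_All sets.sets_Collect_imp
        sets.sets_Collect_conj sets.sets_Collect_const Y) (use T in auto)
  have "incseq G" unfolding G_def incseq_def by auto
  with Gm have "(\<lambda>n. prob (G n)) \<longlonglongrightarrow> prob (\<Union>n. G n)"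
    by (intro finite_Lim_measure_incseq) auto
  moreover have "prob (G n) \<le> B" for n
  proof -
    have "prob (G n) \<le> prob (F n)" by (intro finite_measure_mono Fm) (auto simp: F_def G_def)
    then show ?thesis using grid[of n] by (simp add: F_def)
  qed
  ultimately have "prob (\<Union>n. G n) \<le> B" by (intro LIMSEQ_le_const2) auto
  moreover have "(\<Union>n. G n) = {\<omega>\<in>space M. \<exists>n. \<forall>m\<ge>n. \<exists>k\<le>Suc m. l < Y (real k * T / real (Suc m)) \<omega>}"
    unfolding G_def by blast
  moreover have "\<dots> = {\<omega>\<in>space M. \<exists>t\<in>{0..T}. l < Y t \<omega>}"
    by (intro Collect_cong conj_cong refl exceedance_iff_grid[OF T, symmetric] right)
  ultimately show ?thesis by simp
qed

text \<open>V(t, X t) has the right-continuity that passes from grids to [0, T]: \<open>X\<close> is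
  constant just after \<open>t\<close> and \<open>V\<close> is continuous in time. Every grid ends
  at \<open>T\<close>, so nonnegativity at \<open>T\<close> is what the grid inequality asks
  for.\<close>

lemma (in prob_space) markov_chain_maximal:
  fixes V V' :: "real \<Rightarrow> 'c \<Rightarrow> real"
  assumes mc: "markov_chain M C r X" and fin: "finite C"
    and V: "\<And>t d. 0 \<le> t \<Longrightarrow> d \<in> C \<Longrightarrow> ((\<lambda>t. V t d) has_real_derivative V' t d) (at t within {0..})"
    and super: "\<And>t d. 0 \<le> t \<Longrightarrow> d \<in> C \<Longrightarrow> V' t d + (\<Sum>e\<in>C. generator C r d e * V t e) \<le> 0"
    and V0: "\<And>d. d \<in> C \<Longrightarrow> 0 \<le> V T d"
    and T: "0 < T" and l: "0 < l"
  shows "{\<omega>\<in>space M. \<exists>t\<in>{0..T}. l < V t (X t \<omega>)} \<in> events"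
    and "prob {\<omega>\<in>space M. \<exists>t\<in>{0..T}. l < V t (X t \<omega>)} \<le> expectation (\<lambda>\<omega>. V 0 (X 0 \<omega>)) / l"
proof -
  have X: "X t \<in> measurable M (count_space C)" if "0 \<le> t" for t
    using mc that unfolding markov_chain_def by blast
  have meas: "{\<omega>\<in>space M. l < V t (X t \<omega>)} \<in> events" if "0 \<le> t" for t
  proof -
    from measurable_compose[OF X[OF that], of "V t" borel]
    have "(\<lambda>\<omega>. V t (X t \<omega>)) \<in> borel_measurable M" by simp
    then show ?thesis by simp
  qed
  have right: "\<forall>\<^sub>F s in at_right t. l < V s (X s \<omega>)"
    if \<omega>: "\<omega> \<in> space M" and t: "0 \<le> t" "t < T" "l < V t (X t \<omega>)" for \<omega> t
  proof -
    have "X t \<omega> \<in> C" using measurable_space[OF X[OF t(1)] \<omega>] by simp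
    then have "((\<lambda>s. V s (X t \<omega>)) \<longlongrightarrow> V t (X t \<omega>)) (at t within {0..})"
      using DERIV_continuous[OF V[OF t(1)]] by (auto simp: continuous_within)
    then have "((\<lambda>s. V s (X t \<omega>)) \<longlongrightarrow> V t (X t \<omega>)) (at_right t)"
      by (rule tendsto_within_subset) (use t in auto)
    then have "\<forall>\<^sub>F s in at_right t. l < V s (X t \<omega>)" using t(3) by (rule order_tendstoD)
    moreover have "\<forall>\<^sub>F s in at_right t. X s \<omega> = X t \<omega>" using mc \<omega> t unfolding markov_chain_def by blast
    ultimately show ?thesis by eventually_elim simp
  qed
  show "{\<omega>\<in>space M. \<exists>t\<in>{0..T}. l < V t (X t \<omega>)} \<in> events"
    by (rule exceedance_measurable[OF T right meas])
  show "prob {\<omega>\<in>space M. \<exists>t\<in>{0..T}. l < V t (X t \<omega>)} \<le> expectation (\<lambda>\<omega>. V 0 (X 0 \<omega>)) / l"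
  proof (rule exceedance_prob_le[OF T right meas])
    fix m
    have "l * prob {\<omega>\<in>space M. \<exists>k\<le>Suc m. V (real k * T / real (Suc m)) (X (real k * T / real (Suc m)) \<omega>) > l}
        \<le> expectation (\<lambda>\<omega>. V 0 (X 0 \<omega>))"
      by (rule markov_chain_maximal_grid[OF mc fin V super, of "\<lambda>k. real k * T / real (Suc m)"])
        (use T V0 in \<open>auto simp: mono_def divide_right_mono mult_right_mono\<close>)
    then show "prob {\<omega>\<in>space M. \<exists>k\<le>Suc m. l < V (real k * T / real (Suc m)) (X (real k * T / real (Suc m)) \<omega>)}
        \<le> expectation (\<lambda>\<omega>. V 0 (X 0 \<omega>)) / l"
      using l by (simp add: field_simps)
  qed
qed

section \<open>The generator of the local process\<close>

lemma sum_generator: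
  assumes "finite C" and "c \<in> C"
  shows "(\<Sum>d\<in>C. generator C r c d * F d) = (\<Sum>d\<in>C - {c}. r c d * (F d - F c))"
proof -
  have "(\<Sum>d\<in>C. generator C r c d * F d) = generator C r c c * F c + (\<Sum>d\<in>C - {c}. generator C r c d * F d)"
    using assms by (simp add: sum.remove)
  also have "(\<Sum>d\<in>C - {c}. generator C r c d * F d) = (\<Sum>d\<in>C - {c}. r c d * F d)"
    by (intro sum.cong) (auto simp: generator_def)
  finally show ?thesis
    by (simp add: generator_def sum_distrib_right sum_subtractf right_diff_distrib)
qed

lemma finite_configurations: "finite (configurations N :: (nat \<Rightarrow> 's::finite) set)"
  unfolding configurations_def by (intro finite_PiE) auto

lemma configurations_update:
  "c \<in> configurations N \<Longrightarrow> i \<in> {1..N} \<Longrightarrow> c(i := k) \<in> configurations N"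
  by (auto simp: configurations_def PiE_def extensional_def)

text \<open>\<open>jump_rate\<close> is a sum of point masses at one-vertex changes, so after
  swapping sums the target \<open>d\<close> collapses to \<open>c(i := k)\<close>. The restriction
  to \<open>k\<close> different from \<open>c i\<close> guarantees that this differs from
  \<open>c\<close>.\<close>

lemma sum_generator_jump_rate:
  fixes q :: "'s::finite \<Rightarrow> 's \<Rightarrow> real ^ 's \<Rightarrow> real"
  assumes c: "c \<in> configurations N"
  shows "(\<Sum>d\<in>configurations N. generator (configurations N) (jump_rate N p q g) c d * F d)
    = (\<Sum>i=1..N. \<Sum>k\<in>UNIV - {c i}.
        q k (c i) (neighbourhood_density N p g (state_indicator c) i) * (F (c(i := k)) - F c))"
proof -
  let ?C = "configurations N :: (nat \<Rightarrow> 's) set"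
  let ?q = "\<lambda>i k. q k (c i) (neighbourhood_density N p g (state_indicator c) i)"
  have "(\<Sum>d\<in>?C. generator ?C (jump_rate N p q g) c d * F d)
      = (\<Sum>d\<in>?C - {c}. \<Sum>i=1..N. \<Sum>k\<in>UNIV - {c i}. (if d = c(i := k) then ?q i k else 0) * (F d - F c))"
    by (subst sum_generator[OF finite_configurations c]) (simp add: jump_rate_def sum_distrib_right)
  also have "\<dots> = (\<Sum>i=1..N. \<Sum>d\<in>?C - {c}. \<Sum>k\<in>UNIV - {c i}. (if d = c(i := k) then ?q i k else 0) * (F d - F c))"
    by (rule sum.swap)
  also have "\<dots> = (\<Sum>i=1..N. \<Sum>k\<in>UNIV - {c i}. \<Sum>d\<in>?C - {c}. (if d = c(i := k) then ?q i k else 0) * (F d - F c))"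
    by (rule sum.cong[OF refl], rule sum.swap)
  also have "\<dots> = (\<Sum>i=1..N. \<Sum>k\<in>UNIV - {c i}. ?q i k * (F (c(i := k)) - F c))"
  proof (intro sum.cong refl)
    fix i k assume i: "i \<in> {1..N}" and k: "k \<in> UNIV - {c i}"
    have "c(i := k) \<noteq> c" using k by (metis DiffD2 fun_upd_same insertI1)
    then have m: "c(i := k) \<in> ?C - {c}" using configurations_update[OF c i] by simp
    have "(\<Sum>d\<in>?C - {c}. (if d = c(i := k) then ?q i k else 0) * (F d - F c))
        = (\<Sum>d\<in>?C - {c}. if d = c(i := k) then ?q i k * (F (c(i := k)) - F c) else 0)"
      by (intro sum.cong) auto
    then show "(\<Sum>d\<in>?C - {c}. (if d = c(i := k) then ?q i k else 0) * (F d - F c)) = ?q i k * (F (c(i := k)) - F c)"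
      using m by (simp add: finite_configurations)
  qed
  finally show ?thesis .
qed

lemma vertex_mean_state_update:
  fixes c :: "nat \<Rightarrow> 's::finite"
  assumes i: "i \<in> {1..N}"
  shows "vertex_mean N (state_indicator (c(i := k)))
    = vertex_mean N (state_indicator c) + (1 / real N) *\<^sub>R (axis k 1 - axis (c i) 1)"
proof -
  have "(\<Sum>j=1..N. state_indicator (c(i := k)) j)
      = (\<Sum>j=1..N. state_indicator c j + (if j = i then axis k 1 - axis (c i) 1 else 0))"
    by (intro sum.cong) (auto simp: state_indicator_def)
  also have "\<dots> = (\<Sum>j=1..N. state_indicator c j) + (axis k 1 - axis (c i) 1)"
    using i by (simp add: sum.distrib)
  finally show ?thesis by (simp add: vertex_mean_def scaleR_add_right)
qed

lemma state_indicator_in_prob_simplex: "state_indicator c i \<in> prob_simplex"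
  by (simp add: state_indicator_def axis_in_prob_simplex)

text \<open>The first-order part of the generator is the drift of the mean-field vector field; the
  second-order part is \<open>O(1/N)\<close> because each of the at most \<open>R N\<close> jumps per unit time moves the
  mean by a vector of squared length \<open>2/N\<^sup>2\<close>.\<close>

lemma generator_squared_distance_le:
  fixes q :: "'s::finite \<Rightarrow> 's \<Rightarrow> real ^ 's \<Rightarrow> real"
  assumes N: "2 \<le> N" and c: "c \<in> configurations N"
    and q0: "\<And>k s \<phi>. k \<noteq> s \<Longrightarrow> \<phi> \<in> K \<Longrightarrow> 0 \<le> q k s \<phi>"
    and R: "\<And>\<phi> s. \<phi> \<in> K \<Longrightarrow> (\<Sum>k\<in>UNIV - {s}. q k s \<phi>) \<le> R"
    and K: "\<And>i. i \<in> {1..N} \<Longrightarrow> neighbourhood_density N p g (state_indicator c) i \<in> K"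
  defines "\<phi> \<equiv> neighbourhood_density N p g (state_indicator c)"
  shows "(\<Sum>d\<in>configurations N. generator (configurations N) (jump_rate N p q g) c d
      * (norm (vertex_mean N (state_indicator d) - u))\<^sup>2)
    \<le> 2 * ((vertex_mean N (state_indicator c) - u) \<bullet>
        vertex_mean N (\<lambda>i. rate_matrix q (\<phi> i) *v state_indicator c i)) + 2 * R / real N"
proof -
  define w where "w = vertex_mean N (state_indicator c) - u"
  define F where "F d = (norm (vertex_mean N (state_indicator d) - u))\<^sup>2" for d :: "nat \<Rightarrow> 's"
  let ?e = "\<lambda>i k. axis k 1 - axis (c i) 1 :: real ^ 's"
  \<comment> \<open>The squared norm is quadratic, so the expansion is exact: its last term is 1/N^2
    times the squared length 2 of a difference of distinct unit vectors.\<close>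
  have diff: "F (c(i := k)) - F c = 2 / real N * (w \<bullet> ?e i k) + 2 / (real N)\<^sup>2"
    if i: "i \<in> {1..N}" and k: "k \<in> UNIV - {c i}" for i k
  proof -
    have e2: "?e i k \<bullet> ?e i k = 2"
      using k by (simp add: inner_diff_left inner_diff_right inner_axis_axis)
    have "vertex_mean N (state_indicator (c(i := k))) - u = w + (1 / real N) *\<^sub>R ?e i k"
      unfolding w_def vertex_mean_state_update[OF i] by simp
    then have "F (c(i := k)) = (w + (1 / real N) *\<^sub>R ?e i k) \<bullet> (w + (1 / real N) *\<^sub>R ?e i k)"
      by (simp add: F_def power2_norm_eq_inner)
    also have "\<dots> = w \<bullet> w + 2 / real N * (w \<bullet> ?e i k) + (1 / real N)\<^sup>2 * (?e i k \<bullet> ?e i k)"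
      by (simp only: inner_add_left inner_add_right inner_scaleR_left inner_scaleR_right
          inner_commute[of "?e i k" w] power2_eq_square) (simp add: algebra_simps)
    also have "\<dots> = F c + 2 / real N * (w \<bullet> ?e i k) + 2 / (real N)\<^sup>2"
      unfolding e2 by (simp add: F_def w_def power2_norm_eq_inner power_divide)
    finally show ?thesis by simp
  qed
  have "(\<Sum>d\<in>configurations N. generator (configurations N) (jump_rate N p q g) c d * F d)
      = (\<Sum>i=1..N. \<Sum>k\<in>UNIV - {c i}. q k (c i) (\<phi> i) * (F (c(i := k)) - F c))"
    unfolding \<phi>_def by (rule sum_generator_jump_rate[OF c])
  also have "\<dots> = (\<Sum>i=1..N. \<Sum>k\<in>UNIV - {c i}. 2 / real N * (w \<bullet> (q k (c i) (\<phi> i) *\<^sub>R ?e i k))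
      + 2 / (real N)\<^sup>2 * q k (c i) (\<phi> i))"
    by (intro sum.cong refl) (simp add: diff algebra_simps)
  \<comment> \<open>\<open>rate_matrix_axis\<close> folds the jumps of vertex \<open>i\<close> into
    its drift; the quadratic terms leave the total jump rate, at most \<open>R\<close>.\<close>
  also have "\<dots> = (\<Sum>i=1..N. 2 / real N * (w \<bullet> (rate_matrix q (\<phi> i) *v state_indicator c i))
      + 2 / (real N)\<^sup>2 * (\<Sum>k\<in>UNIV - {c i}. q k (c i) (\<phi> i)))"
    unfolding state_indicator_def rate_matrix_axis
    by (intro sum.cong refl) (simp only: sum.distrib sum_distrib_left inner_sum_right)
  also have "\<dots> \<le> (\<Sum>i=1..N. 2 / real N * (w \<bullet> (rate_matrix q (\<phi> i) *v state_indicator c i))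
      + 2 / (real N)\<^sup>2 * R)"
    by (intro sum_mono add_left_mono mult_left_mono R) (use K in \<open>auto simp: \<phi>_def\<close>)
  also have "\<dots> = 2 * (w \<bullet> vertex_mean N (\<lambda>i. rate_matrix q (\<phi> i) *v state_indicator c i)) + 2 * R / real N"
    using N by (simp add: sum.distrib vertex_mean_def inner_sum_right sum_distrib_left power2_eq_square)
  finally show ?thesis by (simp add: F_def w_def)
qed

section \<open>The Lyapunov function\<close>

lemma DERIV_norm_squared_diff:
  fixes v w :: "real \<Rightarrow> 'a::real_inner"
  assumes "(v has_vector_derivative v') (at t within S)" and "(w has_vector_derivative w') (at t within S)"
  shows "((\<lambda>t. (norm (v t - w t))\<^sup>2) has_real_derivative 2 * ((v t - w t) \<bullet> (v' - w'))) (at t within S)"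
proof -
  have d: "((\<lambda>t. v t - w t) has_vector_derivative (v' - w')) (at t within S)"
    by (intro has_vector_derivative_diff assms)
  have "((\<lambda>t. (v t - w t) \<bullet> (v t - w t)) has_vector_derivative
      ((v t - w t) \<bullet> (v' - w') + (v' - w') \<bullet> (v t - w t))) (at t within S)"
    by (rule bounded_bilinear.has_vector_derivative[OF bounded_bilinear_inner d d])
  then show ?thesis
    by (simp add: power2_norm_eq_inner has_real_derivative_iff_has_vector_derivative inner_commute)
qed

lemma decreasing_on_half_line:
  fixes h :: "real \<Rightarrow> real"
  assumes h: "\<And>t. 0 \<le> t \<Longrightarrow> (h has_real_derivative h' t) (at t within {0..})"
    and neg: "\<And>t. 0 \<le> t \<Longrightarrow> h' t \<le> 0" and t: "0 \<le> t"
  shows "h t \<le> h 0"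
proof (rule DERIV_nonpos_imp_decreasing_open[OF t])
  fix x assume x: "0 < x" "x < t"
  have "(h has_real_derivative h' x) (at x within {0<..})"
    by (rule DERIV_subset[OF h]) (use x in auto)
  then have "(h has_real_derivative h' x) (at x)"
    using x by (simp add: at_within_open[of x "{0<..}"])
  then show "\<exists>y. (h has_real_derivative y) (at x) \<and> y \<le> 0" using neg x by force
next
  have "continuous_on {0..} h" by (rule DERIV_continuous_on[OF h]) auto
  then show "continuous_on {0..t} h" by (rule continuous_on_subset) auto
qed

text \<open>The constants are fixed once, on the densities of total mass at most 1/p, and are shared
  by all N and all graphs before any limit is taken.\<close>

locale mean_field_model =
  fixes q :: "'s::finite \<Rightarrow> 's \<Rightarrow> real ^ 's \<Rightarrow> real" and p L R :: real and u :: "real \<Rightarrow> real ^ 's"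
  assumes p: "0 < p" "p \<le> 1" and L: "0 \<le> L" and R: "0 \<le> R"
    and lip: "\<And>\<phi> \<psi> w. \<phi> \<in> density_region (1 / p) \<Longrightarrow> \<psi> \<in> density_region (1 / p) \<Longrightarrow>
       norm (rate_matrix q \<phi> *v w - rate_matrix q \<psi> *v w) \<le> L * norm (\<phi> - \<psi>) * norm w"
    and bnd: "\<And>\<phi> w. \<phi> \<in> density_region (1 / p) \<Longrightarrow> norm (rate_matrix q \<phi> *v w) \<le> R * norm w"
    and rate_le: "\<And>\<phi> s. \<phi> \<in> density_region (1 / p) \<Longrightarrow> (\<Sum>k\<in>UNIV - {s}. q k s \<phi>) \<le> R"
    and rate_nonneg: "\<And>k s \<phi>. k \<noteq> s \<Longrightarrow> \<phi> \<in> density_region (1 / p) \<Longrightarrow> 0 \<le> q k s \<phi>"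
    and u: "homogeneous_mean_field q u"
begin

definition growth :: real where "growth = 2 * (L + R) + 1"

text \<open>The first summand is the cost of replacing local densities by the mean; the second is
  the second-order part of the chain's generator. NIMFA has no noise, but a common error keeps a
  single Lyapunov function for both processes.\<close>

definition drift_error :: "nat \<Rightarrow> (nat \<Rightarrow> nat \<Rightarrow> bool) \<Rightarrow> real" where
  "drift_error N g = L\<^sup>2 * (real CARD('s) * density_error N p g) + 2 * R / real N"

text \<open>The exponential weight cancels the growth of the squared distance and, being at most 1
  for nonnegative times, does not enlarge the error. The linear term falls at the rate
  \<open>drift_error\<close> and stays nonnegative up to the horizon \<open>T\<close>.\<close>

definition lyapunov :: "nat \<Rightarrow> (nat \<Rightarrow> nat \<Rightarrow> bool) \<Rightarrow> real \<Rightarrow> real \<Rightarrow> real ^ 's \<Rightarrow> real" where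
  "lyapunov N g T t v = exp (- growth * t) * (norm (v - u t))\<^sup>2 + drift_error N g * (T - t)"

lemma drift_error_nonneg: "0 \<le> drift_error N g"
  unfolding drift_error_def using R density_error_nonneg
  by (intro add_nonneg_nonneg mult_nonneg_nonneg divide_nonneg_nonneg) auto

lemma u_in_prob_simplex: "0 \<le> t \<Longrightarrow> u t \<in> prob_simplex"
  using u by (simp add: homogeneous_mean_field_def)

lemma u_derivative:
  "0 \<le> t \<Longrightarrow> (u has_vector_derivative (rate_matrix q (u t) *v u t)) (at t within {0..})"
  using u by (simp add: homogeneous_mean_field_def)

lemma prob_simplex_subset: "prob_simplex \<subseteq> (density_region (1 / p) :: (real ^ 's) set)"
  using p by (intro prob_simplex_subset_density_region) (simp add: field_simps)

lemma drift_le: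
  assumes N: "2 \<le> N" and irr: "\<And>i. i \<in> {1..N} \<Longrightarrow> \<not> g i i"
    and v: "\<And>i. i \<in> {1..N} \<Longrightarrow> v i \<in> prob_simplex" and t: "0 \<le> t"
  shows "2 * ((vertex_mean N v - u t) \<bullet>
      (vertex_mean N (\<lambda>i. rate_matrix q (neighbourhood_density N p g v i) *v v i) - rate_matrix q (u t) *v u t))
     \<le> growth * (norm (vertex_mean N v - u t))\<^sup>2 + L\<^sup>2 * (real CARD('s) * density_error N p g)"
proof -
  have reg: "neighbourhood_density N p g v i \<in> density_region (1 / p)" if "i \<in> {1..N}" for i
    using N p(1) irr[OF that] that v by (rule neighbourhood_density_in_region)
  have "2 * ((vertex_mean N v - u t) \<bullet>
      (vertex_mean N (\<lambda>i. rate_matrix q (neighbourhood_density N p g v i) *v v i) - rate_matrix q (u t) *v u t))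
     \<le> (2 * (L + R) + 1) * (norm (vertex_mean N v - u t))\<^sup>2
        + L\<^sup>2 * ((\<Sum>i=1..N. (norm (neighbourhood_density N p g v i - vertex_mean N v))\<^sup>2) / real N)"
    by (rule mean_field_drift_bound[OF L lip bnd prob_simplex_subset])
      (use N v reg u_in_prob_simplex t in auto)
  also have "(\<Sum>i=1..N. (norm (neighbourhood_density N p g v i - vertex_mean N v))\<^sup>2) / real N
      \<le> real CARD('s) * density_error N p g"
    using N p(1) irr v by (rule mean_square_density_error_le)
  finally show ?thesis by (simp add: growth_def mult_left_mono)
qed

text \<open>Meant for two readings of \<open>v\<close>: the moving NIMFA mean, and a constant path,
  where it gives the time derivative at a frozen configuration of the chain.\<close>

lemma lyapunov_derivative:
  assumes v: "(v has_vector_derivative v') (at t within {0..})" and t: "0 \<le> t"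
  shows "((\<lambda>t. lyapunov N g T t (v t)) has_real_derivative
    (exp (- growth * t) * (2 * ((v t - u t) \<bullet> (v' - rate_matrix q (u t) *v u t)) - growth * (norm (v t - u t))\<^sup>2)
      - drift_error N g)) (at t within {0..})"
  unfolding lyapunov_def
  by (rule derivative_eq_intros DERIV_norm_squared_diff[OF v u_derivative[OF t]] refl | simp)+
    (simp add: algebra_simps)

lemma weighted_distance_le_lyapunov:
  "t \<le> T \<Longrightarrow> exp (- growth * t) * (norm (v - u t))\<^sup>2 \<le> lyapunov N g T t v"
  using drift_error_nonneg by (simp add: lyapunov_def)

lemma exp_growth_le: "0 \<le> t \<Longrightarrow> exp (- growth * t) \<le> 1"
proof -
  assume "0 \<le> t"
  then have "0 \<le> growth * t" using L R by (intro mult_nonneg_nonneg) (auto simp: growth_def)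
  then show ?thesis by simp
qed

lemma nimfa_lyapunov_le:
  assumes N: "2 \<le> N" and irr: "\<And>i. i \<in> {1..N} \<Longrightarrow> \<not> g i i" and z: "nimfa N p q g z"
    and t: "0 \<le> t" "t \<le> T"
  shows "exp (- growth * t) * (norm (vertex_mean N (z t) - u t))\<^sup>2
     \<le> (norm (vertex_mean N (z 0) - u 0))\<^sup>2 + drift_error N g * T"
proof -
  let ?v' = "\<lambda>t. vertex_mean N (\<lambda>i. rate_matrix q (neighbourhood_density N p g (z t) i) *v z t i)"
  have dv: "((\<lambda>t. vertex_mean N (z t)) has_vector_derivative ?v' t) (at t within {0..})"
    if "0 \<le> t" for t
    unfolding vertex_mean_def scaleR_sum_right using z that
    by (intro has_vector_derivative_sum bounded_linear.has_vector_derivative[OF bounded_linear_scaleR_right])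
      (auto simp: nimfa_def)
  have "lyapunov N g T t (vertex_mean N (z t)) \<le> lyapunov N g T 0 (vertex_mean N (z 0))"
  proof (rule decreasing_on_half_line[OF lyapunov_derivative[OF dv] _ t(1)])
    fix t :: real assume t: "0 \<le> t"
    have "2 * ((vertex_mean N (z t) - u t) \<bullet> (?v' t - rate_matrix q (u t) *v u t))
        - growth * (norm (vertex_mean N (z t) - u t))\<^sup>2 \<le> drift_error N g"
    proof -
      have "2 * ((vertex_mean N (z t) - u t) \<bullet> (?v' t - rate_matrix q (u t) *v u t))
          \<le> growth * (norm (vertex_mean N (z t) - u t))\<^sup>2 + L\<^sup>2 * (real CARD('s) * density_error N p g)"
        by (rule drift_le[OF N irr _ t]) (use z t in \<open>auto simp: nimfa_def\<close>)
      moreover have "0 \<le> 2 * R / real N" using R by simp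
      ultimately show ?thesis by (simp add: drift_error_def)
    qed
    then have "exp (- growth * t) * (2 * ((vertex_mean N (z t) - u t) \<bullet> (?v' t - rate_matrix q (u t) *v u t))
        - growth * (norm (vertex_mean N (z t) - u t))\<^sup>2) \<le> exp (- growth * t) * drift_error N g"
      by (rule mult_left_mono) simp
    also have "\<dots> \<le> 1 * drift_error N g"
      by (rule mult_right_mono[OF exp_growth_le[OF t] drift_error_nonneg])
    finally show "exp (- growth * t) * (2 * ((vertex_mean N (z t) - u t) \<bullet> (?v' t - rate_matrix q (u t) *v u t))
        - growth * (norm (vertex_mean N (z t) - u t))\<^sup>2) - drift_error N g \<le> 0" by simp
  qed
  then show ?thesis using weighted_distance_le_lyapunov[OF t(2), of "vertex_mean N (z t)" N g]
    by (simp add: lyapunov_def)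
qed

text \<open>\<open>M\<close> is arbitrary because the lemma is applied to the measure conditioned on
  the graph being \<open>g\<close>, under which the error is a constant.\<close>

lemma markov_chain_exceedance_le:
  assumes N: "2 \<le> N" and irr: "\<And>i. i \<in> {1..N} \<Longrightarrow> \<not> g i i" and M: "prob_space M"
    and X: "markov_chain M (configurations N) (jump_rate N p q g) X" and T: "0 < T" and l: "0 < l"
  shows "measure M {\<omega>\<in>space M. \<exists>t\<in>{0..T}.
        l < exp (- growth * t) * (norm (vertex_mean N (state_indicator (X t \<omega>)) - u t))\<^sup>2}
     \<le> (integral\<^sup>L M (\<lambda>\<omega>. (norm (vertex_mean N (state_indicator (X 0 \<omega>)) - u 0))\<^sup>2) + drift_error N g * T) / l"
proof -
  interpret prob_space M by (rule M)
  define f where "f c = vertex_mean N (state_indicator c)" for c :: "nat \<Rightarrow> 's"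
  let ?C = "configurations N :: (nat \<Rightarrow> 's) set"
  let ?G = "generator ?C (jump_rate N p q g)"
  let ?V = "\<lambda>t c. lyapunov N g T t (f c)"
  \<comment> \<open>A frozen configuration has velocity 0; its motion enters through the generator,
    which supplies the drift \<open>?D\<close> below.\<close>
  let ?V' = "\<lambda>t c. exp (- growth * t) * (2 * ((f c - u t) \<bullet> (0 - rate_matrix q (u t) *v u t))
     - growth * (norm (f c - u t))\<^sup>2) - drift_error N g"
  have dV: "((\<lambda>t. ?V t c) has_real_derivative ?V' t c) (at t within {0..})"
    if "0 \<le> t" "c \<in> ?C" for t c
    by (rule lyapunov_derivative[OF has_vector_derivative_const that(1)])
  have super: "?V' t c + (\<Sum>d\<in>?C. ?G c d * ?V t d) \<le> 0" if t: "0 \<le> t" and c: "c \<in> ?C" for t c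
  proof -
    let ?\<phi> = "neighbourhood_density N p g (state_indicator c)"
    let ?D = "vertex_mean N (\<lambda>i. rate_matrix q (?\<phi> i) *v state_indicator c i)"
    \<comment> \<open>The generator annihilates constants, so the linear term of the Lyapunov
      function contributes only its time derivative.\<close>
    have zero: "(\<Sum>d\<in>?C. ?G c d) = 0"
      using sum_generator[OF finite_configurations c, of "jump_rate N p q g" "\<lambda>_. 1"] by simp
    have reg: "?\<phi> i \<in> density_region (1 / p)" if "i \<in> {1..N}" for i
      using N p(1) irr[OF that] that by (rule neighbourhood_density_in_region) (rule state_indicator_in_prob_simplex)
    have gen: "(\<Sum>d\<in>?C. ?G c d * (norm (f d - u t))\<^sup>2) \<le> 2 * ((f c - u t) \<bullet> ?D) + 2 * R / real N"
      unfolding f_def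
      by (rule generator_squared_distance_le[OF N c rate_nonneg rate_le reg])
    have "(\<Sum>d\<in>?C. ?G c d * ?V t d)
        = exp (- growth * t) * (\<Sum>d\<in>?C. ?G c d * (norm (f d - u t))\<^sup>2) + drift_error N g * (T - t) * (\<Sum>d\<in>?C. ?G c d)"
      by (simp add: lyapunov_def sum_distrib_left distrib_left sum.distrib mult_ac)
    then have "?V' t c + (\<Sum>d\<in>?C. ?G c d * ?V t d)
        = exp (- growth * t) * (2 * ((f c - u t) \<bullet> (0 - rate_matrix q (u t) *v u t))
           - growth * (norm (f c - u t))\<^sup>2 + (\<Sum>d\<in>?C. ?G c d * (norm (f d - u t))\<^sup>2)) - drift_error N g"
      unfolding zero by (simp add: algebra_simps)
    also have "\<dots> \<le> exp (- growth * t) * drift_error N g - drift_error N g"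
    proof (intro diff_right_mono mult_left_mono)
      have "2 * ((f c - u t) \<bullet> (?D - rate_matrix q (u t) *v u t))
          \<le> growth * (norm (f c - u t))\<^sup>2 + L\<^sup>2 * (real CARD('s) * density_error N p g)"
        unfolding f_def by (rule drift_le[OF N irr state_indicator_in_prob_simplex t])
      then show "2 * ((f c - u t) \<bullet> (0 - rate_matrix q (u t) *v u t)) - growth * (norm (f c - u t))\<^sup>2
          + (\<Sum>d\<in>?C. ?G c d * (norm (f d - u t))\<^sup>2) \<le> drift_error N g"
        using gen by (simp add: drift_error_def inner_diff_right)
    qed simp
    also have "\<dots> \<le> 0"
      using mult_right_mono[OF exp_growth_le[OF t] drift_error_nonneg, of N g] by simp
    finally show ?thesis .
  qed
  have VT: "0 \<le> ?V T c" if "c \<in> ?C" for c by (simp add: lyapunov_def)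
  note max = markov_chain_maximal[OF X finite_configurations dV super VT T l]
  have "prob {\<omega>\<in>space M. \<exists>t\<in>{0..T}. l < exp (- growth * t) * (norm (f (X t \<omega>) - u t))\<^sup>2}
      \<le> prob {\<omega>\<in>space M. \<exists>t\<in>{0..T}. l < ?V t (X t \<omega>)}"
  proof (rule finite_measure_mono)
    show "{\<omega>\<in>space M. \<exists>t\<in>{0..T}. l < ?V t (X t \<omega>)} \<in> events" by (rule max(1))
    show "{\<omega>\<in>space M. \<exists>t\<in>{0..T}. l < exp (- growth * t) * (norm (f (X t \<omega>) - u t))\<^sup>2}
        \<subseteq> {\<omega>\<in>space M. \<exists>t\<in>{0..T}. l < ?V t (X t \<omega>)}"
    proof (intro Collect_mono impI, elim conjE bexE, intro conjI bexI)
      fix \<omega> t assume "t \<in> {0..T}" "l < exp (- growth * t) * (norm (f (X t \<omega>) - u t))\<^sup>2"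
      then show "l < ?V t (X t \<omega>)"
        using weighted_distance_le_lyapunov[of t T "f (X t \<omega>)" N g] by simp
    qed
  qed
  also have "\<dots> \<le> expectation (\<lambda>\<omega>. ?V 0 (X 0 \<omega>)) / l" by (rule max(2))
  also have "expectation (\<lambda>\<omega>. ?V 0 (X 0 \<omega>)) = expectation (\<lambda>\<omega>. (norm (f (X 0 \<omega>) - u 0))\<^sup>2 + drift_error N g * T)"
    by (simp add: lyapunov_def)
  also have "\<dots> = expectation (\<lambda>\<omega>. (norm (f (X 0 \<omega>) - u 0))\<^sup>2) + drift_error N g * T"
  proof -
    have X0: "X 0 \<in> measurable M (count_space ?C)" using X unfolding markov_chain_def by blast
    have "integrable M (\<lambda>\<omega>. (norm (f (X 0 \<omega>) - u 0))\<^sup>2)"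
    proof (rule integrable_const_bound[of _ 4])
      show "AE \<omega> in M. norm ((norm (f (X 0 \<omega>) - u 0))\<^sup>2) \<le> 4"
      proof (rule AE_I2)
        fix \<omega>
        have "norm (f (X 0 \<omega>) - u 0) \<le> 2" unfolding f_def
          using N by (intro norm_prob_simplex_diff_le vertex_mean_in_prob_simplex state_indicator_in_prob_simplex u_in_prob_simplex) auto
        from power_mono[OF this norm_ge_zero, of 2] show "norm ((norm (f (X 0 \<omega>) - u 0))\<^sup>2) \<le> 4" by simp
      qed
      from measurable_compose[OF X0, of "\<lambda>c. (norm (f c - u 0))\<^sup>2" borel]
      show "(\<lambda>\<omega>. (norm (f (X 0 \<omega>) - u 0))\<^sup>2) \<in> borel_measurable M" by simp
    qed
    then show ?thesis by (simp add: prob_space)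
  qed
  finally show ?thesis by (simp add: f_def)
qed

end

section \<open>Measurability of NIMFA solutions\<close>

lemma l1_norm_le: "l1_norm v \<le> real CARD('s) * norm (v :: real ^ 's::finite)"
proof -
  have "(\<Sum>s\<in>UNIV. \<bar>v $ s\<bar>) \<le> (\<Sum>s\<in>(UNIV::'s set). norm v)"
    by (intro sum_mono component_le_norm_cart)
  then show ?thesis by (simp add: l1_norm_def)
qed

lemma abs_l1_norm_diff_le: "\<bar>l1_norm v - l1_norm w\<bar> \<le> l1_norm (v - w)"
proof -
  have "\<bar>l1_norm v - l1_norm w\<bar> = \<bar>\<Sum>s\<in>UNIV. \<bar>v $ s\<bar> - \<bar>w $ s\<bar>\<bar>"
    by (simp add: l1_norm_def sum_subtractf)
  also have "\<dots> \<le> (\<Sum>s\<in>UNIV. \<bar>\<bar>v $ s\<bar> - \<bar>w $ s\<bar>\<bar>)" by (rule sum_abs)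
  also have "\<dots> \<le> l1_norm (v - w)" unfolding l1_norm_def by (intro sum_mono) simp
  finally show ?thesis .
qed

lemma norm_vertex_mean_squared_le:
  assumes N: "0 < N"
  shows "(norm (vertex_mean N v))\<^sup>2 \<le> (\<Sum>i=1..N. (norm (v i))\<^sup>2)"
proof -
  have "(norm (vertex_mean N v))\<^sup>2 \<le> ((\<Sum>i=1..N. norm (v i)) / real N)\<^sup>2"
    by (intro power_mono norm_vertex_mean_le) simp
  also have "\<dots> \<le> (real N * (\<Sum>i=1..N. (norm (v i))\<^sup>2)) / (real N)\<^sup>2"
    unfolding power_divide by (intro divide_right_mono sum_squared_le_card) auto
  also have "\<dots> = (\<Sum>i=1..N. (norm (v i))\<^sup>2) / real N" by (simp add: power2_eq_square)
  also have "\<dots> \<le> (\<Sum>i=1..N. (norm (v i))\<^sup>2) / 1"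
    using N by (intro divide_left_mono sum_nonneg) auto
  finally show ?thesis by simp
qed

text \<open>The set is the preimage of an open set under finitely many measurable coordinates.\<close>

lemma exceedance_measurable_if_continuous_in_coordinates:
  fixes Z :: "nat \<Rightarrow> 'w \<Rightarrow> 'b::{metric_space, second_countable_topology}" and h :: "'w \<Rightarrow> real"
  assumes A: "A \<in> sets M" and I: "finite I" and Z: "\<And>i. i \<in> I \<Longrightarrow> Z i \<in> borel_measurable M"
    and cont: "\<And>\<omega> e. \<omega> \<in> A \<Longrightarrow> 0 < e \<Longrightarrow>
      \<exists>d>0. \<forall>\<omega>'\<in>A. (\<forall>i\<in>I. dist (Z i \<omega>) (Z i \<omega>') < d) \<longrightarrow> \<bar>h \<omega> - h \<omega>'\<bar> < e"
  shows "{\<omega>\<in>A. l < h \<omega>} \<in> sets M"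
proof -
  \<comment> \<open>Around each point of the set a radius is chosen within which \<open>h\<close>
    moves by less than its excess over \<open>l\<close>.\<close>
  have "\<exists>d. \<forall>\<omega>\<in>A. l < h \<omega> \<longrightarrow>
      0 < d \<omega> \<and> (\<forall>\<omega>'\<in>A. (\<forall>i\<in>I. dist (Z i \<omega>) (Z i \<omega>') < d \<omega>) \<longrightarrow> \<bar>h \<omega> - h \<omega>'\<bar> < h \<omega> - l)"
    using cont by (intro bchoice) (metis diff_gt_0_iff_gt)
  then obtain d where d: "\<And>\<omega>. \<omega> \<in> A \<Longrightarrow> l < h \<omega> \<Longrightarrow> 0 < d \<omega>"
    "\<And>\<omega> \<omega>'. \<omega> \<in> A \<Longrightarrow> l < h \<omega> \<Longrightarrow> \<omega>' \<in> A \<Longrightarrow> (\<forall>i\<in>I. dist (Z i \<omega>) (Z i \<omega>') < d \<omega>) \<Longrightarrow>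
      \<bar>h \<omega> - h \<omega>'\<bar> < h \<omega> - l" by blast
  \<comment> \<open>A constant default outside \<open>I\<close> makes \<open>W\<close> a measurable
    map into the full product space, so that a single open set can be pulled back.\<close>
  define W where "W \<omega> i = (if i \<in> I then Z i \<omega> else undefined)" for \<omega> i
  \<comment> \<open>The union may be uncountable; \<open>U\<close> is measurable because it is
    open.\<close>
  define U where "U = (\<Union>\<omega>\<in>{\<omega>\<in>A. l < h \<omega>}. \<Inter>i\<in>I. (\<lambda>f. f i) -` ball (Z i \<omega>) (d \<omega>))"
  have "open U"
    unfolding U_def using I
    by (intro open_UN ballI open_INT open_vimage open_ball continuous_on_product_coordinates)
  moreover have "W \<in> borel_measurable M"
  proof (rule measurable_coordinatewise_then_product)
    fix i show "(\<lambda>\<omega>. W \<omega> i) \<in> borel_measurable M"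
      unfolding W_def using Z by (cases "i \<in> I") auto
  qed
  ultimately have "W -` U \<inter> space M \<in> sets M" by (auto intro: measurable_sets)
  with A have "A \<inter> (W -` U \<inter> space M) \<in> sets M" by blast
  moreover have "{\<omega>\<in>A. l < h \<omega>} = A \<inter> (W -` U \<inter> space M)"
  proof (intro equalityI subsetI)
    fix \<omega> assume \<omega>: "\<omega> \<in> {\<omega>\<in>A. l < h \<omega>}"
    then have "W \<omega> \<in> U" unfolding U_def W_def using d(1) by auto
    then show "\<omega> \<in> A \<inter> (W -` U \<inter> space M)" using \<omega> sets.sets_into_space[OF A] by auto
  next
    fix \<omega>' assume \<omega>': "\<omega>' \<in> A \<inter> (W -` U \<inter> space M)"
    then obtain \<omega> where \<omega>: "\<omega> \<in> A" "l < h \<omega>" and "\<forall>i\<in>I. W \<omega>' i \<in> ball (Z i \<omega>) (d \<omega>)"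
      unfolding U_def by auto
    then have "\<forall>i\<in>I. dist (Z i \<omega>) (Z i \<omega>') < d \<omega>" by (auto simp: W_def)
    from d(2)[OF \<omega> _ this] \<omega>' show "\<omega>' \<in> {\<omega>\<in>A. l < h \<omega>}" by auto
  qed
  ultimately show ?thesis by simp
qed

lemma neighbourhood_density_diff_le:
  assumes N: "2 \<le> N" and p: "0 < p"
  shows "norm (neighbourhood_density N p g v i - neighbourhood_density N p g w i)
    \<le> (\<Sum>j=1..N. norm (v j - w j)) / mean_degree N p"
proof -
  have d: "0 < mean_degree N p" using N p by (simp add: mean_degree_def)
  have "neighbourhood_density N p g v i - neighbourhood_density N p g w i
      = (1 / mean_degree N p) *\<^sub>R (\<Sum>j=1..N. of_bool (g i j) *\<^sub>R (v j - w j))"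
    by (simp only: neighbourhood_density_def scaleR_diff_right sum_subtractf)
  also have "norm \<dots> = norm (\<Sum>j=1..N. of_bool (g i j) *\<^sub>R (v j - w j)) / mean_degree N p"
    using d by simp
  also have "\<dots> \<le> (\<Sum>j=1..N. norm (v j - w j)) / mean_degree N p"
    using d by (intro divide_right_mono sum_norm_le) auto
  finally show ?thesis .
qed

section \<open>Continuous dependence of NIMFA on its initial values\<close>

context mean_field_model
begin

text \<open>Gronwall's inequality for the sum of squared distances on one fixed graph. In particular
  a solution is determined by its initial values, so y at time t becomes a function of them, and a
  continuous one.\<close>

lemma nimfa_distance_le:
  assumes N: "2 \<le> N" and irr: "\<And>i. i \<in> {1..N} \<Longrightarrow> \<not> g i i"
    and z: "nimfa N p q g z" and z': "nimfa N p q g z'" and t: "0 \<le> t"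
  shows "(\<Sum>i=1..N. (norm (z t i - z' t i))\<^sup>2)
    \<le> exp ((2 * L * real N / mean_degree N p + 2 * R) * t) * (\<Sum>i=1..N. (norm (z 0 i - z' 0 i))\<^sup>2)"
proof -
  let ?d = "mean_degree N p"
  \<comment> \<open>The first part comes from the densities, where the coupling through
    \<open>W\<close> costs a factor N by Cauchy-Schwarz; the second from the matrix acting on the
    difference of the solutions.\<close>
  define \<kappa> where "\<kappa> = 2 * L * real N / ?d + 2 * R"
  define E where "E t = (\<Sum>i=1..N. (norm (z t i - z' t i))\<^sup>2)" for t
  define v where "v z t i = rate_matrix q (neighbourhood_density N p g (z t) i) *v z t i" for z :: "real \<Rightarrow> nat \<Rightarrow> real ^ 's" and t i
  define E' where "E' t = (\<Sum>i=1..N. 2 * ((z t i - z' t i) \<bullet> (v z t i - v z' t i)))" for t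
  have d: "0 < ?d" using N p by (simp add: mean_degree_def)
  have dE: "(E has_real_derivative E' t) (at t within {0..})" if "0 \<le> t" for t
    unfolding E_def[abs_def] E'_def v_def
    by (intro DERIV_sum DERIV_norm_squared_diff) (use z z' that in \<open>auto simp: nimfa_def\<close>)
  have E': "E' t \<le> \<kappa> * E t" if t: "0 \<le> t" for t
  proof -
    define W where "W = (\<Sum>j=1..N. norm (z t j - z' t j))"
    have summand: "2 * ((z t i - z' t i) \<bullet> (v z t i - v z' t i))
        \<le> 2 * L * W / ?d * norm (z t i - z' t i) + 2 * R * (norm (z t i - z' t i))\<^sup>2"
      if i: "i \<in> {1..N}" for i
    proof -
      let ?\<rho> = "neighbourhood_density N p g (z t) i" and ?\<rho>' = "neighbourhood_density N p g (z' t) i"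
      let ?w = "norm (z t i - z' t i)"
      have s: "z t j \<in> prob_simplex" "z' t j \<in> prob_simplex" if "j \<in> {1..N}" for j
        using z z' t that by (auto simp: nimfa_def)
      have reg: "?\<rho> \<in> density_region (1 / p)" "?\<rho>' \<in> density_region (1 / p)"
        using neighbourhood_density_in_region[of N p g i, OF N p(1) irr[OF i] i] s by blast+
      have "v z t i - v z' t i = (rate_matrix q ?\<rho> *v z t i - rate_matrix q ?\<rho>' *v z t i)
          + rate_matrix q ?\<rho>' *v (z t i - z' t i)"
        by (simp add: v_def matrix_vector_mult_diff_distrib)
      also have "norm \<dots> \<le> norm (rate_matrix q ?\<rho> *v z t i - rate_matrix q ?\<rho>' *v z t i)
          + norm (rate_matrix q ?\<rho>' *v (z t i - z' t i))"
        by (rule norm_triangle_ineq)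
      also have "\<dots> \<le> L * norm (?\<rho> - ?\<rho>') * norm (z t i) + R * ?w"
        by (intro add_mono lip bnd reg)
      also have "L * norm (?\<rho> - ?\<rho>') * norm (z t i) \<le> L * (W / ?d) * 1"
        unfolding W_def using L d prob_simplexD(3)[OF s(1)[OF i]]
        by (intro mult_mono neighbourhood_density_diff_le N p)
            (auto intro!: divide_nonneg_pos mult_nonneg_nonneg sum_nonneg)
      finally have nv: "norm (v z t i - v z' t i) \<le> L * (W / ?d) + R * ?w" by simp
      have "(z t i - z' t i) \<bullet> (v z t i - v z' t i) \<le> ?w * norm (v z t i - v z' t i)"
        by (rule norm_cauchy_schwarz)
      also have "\<dots> \<le> ?w * (L * (W / ?d) + R * ?w)" by (intro mult_left_mono nv) simp
      also have "\<dots> = L * W / ?d * ?w + R * ?w\<^sup>2" by (simp add: power2_eq_square algebra_simps)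
      finally have "(z t i - z' t i) \<bullet> (v z t i - v z' t i) \<le> L * W / ?d * ?w + R * ?w\<^sup>2" .
      moreover have "2 * (L * W / ?d * ?w + R * ?w\<^sup>2) = 2 * L * W / ?d * ?w + 2 * R * ?w\<^sup>2" by simp
      ultimately show ?thesis by linarith
    qed
    have "E' t \<le> (\<Sum>i=1..N. 2 * L * W / ?d * norm (z t i - z' t i) + 2 * R * (norm (z t i - z' t i))\<^sup>2)"
      unfolding E'_def by (intro sum_mono summand)
    also have "\<dots> = 2 * L * W / ?d * W + 2 * R * E t"
      by (simp only: sum.distrib sum_distrib_left[symmetric] W_def E_def)
    also have "2 * L * W / ?d * W = 2 * L / ?d * W\<^sup>2" by (simp add: power2_eq_square)
    also have "\<dots> \<le> 2 * L / ?d * (real N * E t)"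
      unfolding W_def E_def using L d by (intro mult_left_mono sum_squared_le_card) auto
    finally show ?thesis by (simp add: \<kappa>_def distrib_right)
  qed
  have "exp (- \<kappa> * t) * E t \<le> exp (- \<kappa> * 0) * E 0"
  proof (rule decreasing_on_half_line[where h' = "\<lambda>t. exp (- \<kappa> * t) * (E' t - \<kappa> * E t)", OF _ _ t])
    fix t :: real assume t: "0 \<le> t"
    show "((\<lambda>t. exp (- \<kappa> * t) * E t) has_real_derivative exp (- \<kappa> * t) * (E' t - \<kappa> * E t)) (at t within {0..})"
      by (rule derivative_eq_intros dE[OF t] refl | simp)+ (simp add: algebra_simps)
    show "exp (- \<kappa> * t) * (E' t - \<kappa> * E t) \<le> 0"
      using E'[OF t] by (intro mult_nonneg_nonpos) auto
  qed
  then have "exp (\<kappa> * t) * (exp (- \<kappa> * t) * E t) \<le> exp (\<kappa> * t) * E 0"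
    by (intro mult_left_mono) auto
  moreover have "exp (\<kappa> * t) * (exp (- \<kappa> * t) * E t) = E t"
    by (simp add: mult.assoc[symmetric] mult_exp_exp)
  ultimately have "E t \<le> exp (\<kappa> * t) * E 0" by (simp only:)
  then show ?thesis unfolding E_def \<kappa>_def .
qed

text \<open>NIMFA solutions are measurable by assumption at time 0; for later times measurability is
  derived here, on an event where the graph is constant.\<close>

lemma nimfa_exceedance_measurable:
  fixes z :: "real \<Rightarrow> 'w \<Rightarrow> nat \<Rightarrow> real ^ 's"
  assumes N: "2 \<le> N" and irr: "\<And>i. i \<in> {1..N} \<Longrightarrow> \<not> g i i" and A: "A \<in> sets M"
    and z: "\<And>\<omega>. \<omega> \<in> A \<Longrightarrow> nimfa N p q g (\<lambda>t. z t \<omega>)"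
    and z0: "\<And>i. i \<in> {1..N} \<Longrightarrow> (\<lambda>\<omega>. z 0 \<omega> i) \<in> borel_measurable M" and t: "0 \<le> t"
  shows "{\<omega>\<in>A. l < l1_norm (vertex_mean N (z t \<omega>) - c)} \<in> sets M"
proof (rule exceedance_measurable_if_continuous_in_coordinates[OF A, of "{1..N}" "\<lambda>i \<omega>. z 0 \<omega> i"])
  fix \<omega> e assume \<omega>: "\<omega> \<in> A" and e: "0 < (e :: real)"
  define H where "H = exp ((2 * L * real N / mean_degree N p + 2 * R) * t) * real N"
  define S where "S = real CARD('s) * sqrt H"
  \<comment> \<open>The summand 1 keeps the radius positive when \<open>S\<close> is 0 and makes the
    final estimate strict.\<close>
  define d where "d = e / (S + 1)"
  have H: "0 \<le> H" by (simp add: H_def)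
  have S: "0 \<le> S" using H by (simp add: S_def)
  have d: "0 < d" using e S by (simp add: d_def)
  show "\<exists>d>0. \<forall>\<omega>'\<in>A. (\<forall>i\<in>{1..N}. dist (z 0 \<omega> i) (z 0 \<omega>' i) < d) \<longrightarrow>
      \<bar>l1_norm (vertex_mean N (z t \<omega>) - c) - l1_norm (vertex_mean N (z t \<omega>') - c)\<bar> < e"
  proof (intro exI[of _ d] conjI d ballI impI)
    fix \<omega>' assume \<omega>': "\<omega>' \<in> A" and close: "\<forall>i\<in>{1..N}. dist (z 0 \<omega> i) (z 0 \<omega>' i) < d"
    let ?D = "vertex_mean N (z t \<omega>) - vertex_mean N (z t \<omega>')"
    have "(norm ?D)\<^sup>2 = (norm (vertex_mean N (\<lambda>i. z t \<omega> i - z t \<omega>' i)))\<^sup>2"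
      by (simp add: vertex_mean_def sum_subtractf scaleR_diff_right)
    also have "\<dots> \<le> (\<Sum>i=1..N. (norm (z t \<omega> i - z t \<omega>' i))\<^sup>2)"
      using N by (intro norm_vertex_mean_squared_le) simp
    also have "\<dots> \<le> exp ((2 * L * real N / mean_degree N p + 2 * R) * t) * (\<Sum>i=1..N. (norm (z 0 \<omega> i - z 0 \<omega>' i))\<^sup>2)"
      by (rule nimfa_distance_le[OF N irr z[OF \<omega>] z[OF \<omega>'] t])
    also have "\<dots> \<le> exp ((2 * L * real N / mean_degree N p + 2 * R) * t) * (\<Sum>i=1..N. d\<^sup>2)"
      using close by (intro mult_left_mono sum_mono power_mono) (auto simp: dist_norm intro: less_imp_le)
    also have "\<dots> = H * d\<^sup>2" by (simp add: H_def)
    also have "\<dots> = (sqrt H * d)\<^sup>2" using H by (simp add: power_mult_distrib)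
    finally have D: "norm ?D \<le> sqrt H * d"
      by (rule power2_le_imp_le) (use H d in auto)
    have "\<bar>l1_norm (vertex_mean N (z t \<omega>) - c) - l1_norm (vertex_mean N (z t \<omega>') - c)\<bar> \<le> l1_norm ?D"
      using abs_l1_norm_diff_le[of "vertex_mean N (z t \<omega>) - c" "vertex_mean N (z t \<omega>') - c"] by simp
    also have "\<dots> \<le> real CARD('s) * norm ?D" by (rule l1_norm_le)
    also have "\<dots> \<le> real CARD('s) * (sqrt H * d)" by (intro mult_left_mono D) simp
    also have "\<dots> = S * d" by (simp add: S_def)
    also have "\<dots> < (S + 1) * d" using d by (simp add: distrib_right)
    also have "\<dots> = e" using S by (simp add: d_def)
    finally show "\<bar>l1_norm (vertex_mean N (z t \<omega>) - c) - l1_norm (vertex_mean N (z t \<omega>') - c)\<bar> < e" .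
  qed
qed (use z0 in auto)

end

section \<open>Averaging over the random graph\<close>

lemma (in prob_space) integral_uniform_measure:
  fixes f :: "'a \<Rightarrow> real"
  assumes A: "A \<in> events" and pos: "0 < prob A" and f: "f \<in> borel_measurable M"
  shows "integral\<^sup>L (uniform_measure M A) f = expectation (\<lambda>\<omega>. indicator A \<omega> * f \<omega>) / prob A"
proof -
  have eq: "uniform_measure M A = density M (\<lambda>\<omega>. ennreal (indicator A \<omega> / prob A))"
    unfolding uniform_measure_def
    by (rule arg_cong[where f = "density M"])
      (use pos in \<open>auto simp: fun_eq_iff emeasure_eq_measure divide_ennreal ennreal_1[symmetric] indicator_def simp del: ennreal_1\<close>)
  have "integral\<^sup>L (uniform_measure M A) f = expectation (\<lambda>\<omega>. (indicator A \<omega> / prob A) *\<^sub>R f \<omega>)"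
    unfolding eq using A f by (intro integral_density) auto
  then show ?thesis by simp
qed

text \<open>For bounded distances, convergence in probability gives convergence in mean square, by
  splitting at a threshold. The exceedance bounds take the initial second moment as their
  input.\<close>

lemma expectation_dist_squared_tendsto_0:
  fixes X :: "nat \<Rightarrow> 'w \<Rightarrow> 'v::{metric_space, second_countable_topology}"
  assumes M: "\<And>N. 2 \<le> N \<Longrightarrow> prob_space (M N)"
    and X: "tendsto_in_prob M X c"
    and bounded: "\<And>N \<omega>. 2 \<le> N \<Longrightarrow> \<omega> \<in> space (M N) \<Longrightarrow> dist (X N \<omega>) c \<le> B"
  shows "(\<lambda>N. integral\<^sup>L (M N) (\<lambda>\<omega>. (dist (X N \<omega>) c)\<^sup>2)) \<longlonglongrightarrow> 0"
proof (rule tendsto_0_le[where K = 1 and f = "\<lambda>N. integral\<^sup>L (M N) (\<lambda>\<omega>. (dist (X N \<omega>) c)\<^sup>2)"])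
  let ?I = "\<lambda>N. integral\<^sup>L (M N) (\<lambda>\<omega>. (dist (X N \<omega>) c)\<^sup>2)"
  show "?I \<longlonglongrightarrow> 0"
  proof (rule LIMSEQ_I)
    fix r :: real assume r: "0 < r"
    \<comment> \<open>Half of the tolerance is spent below the threshold, the other half is left for
      the tail.\<close>
    define e where "e = sqrt (r / 2)"
    have e: "0 < e" and e2: "e\<^sup>2 = r / 2" using r by (auto simp: e_def)
    have "(\<lambda>N. \<P>(\<omega> in M N. dist (X N \<omega>) c > e)) \<longlonglongrightarrow> 0"
      using X e by (simp add: tendsto_in_prob_def)
    then have "(\<lambda>N. e\<^sup>2 + B\<^sup>2 * \<P>(\<omega> in M N. dist (X N \<omega>) c > e)) \<longlonglongrightarrow> e\<^sup>2 + B\<^sup>2 * 0"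
      by (intro tendsto_intros)
    then have ev: "\<forall>\<^sub>F N in sequentially. e\<^sup>2 + B\<^sup>2 * \<P>(\<omega> in M N. dist (X N \<omega>) c > e) < r"
      by (rule order_tendstoD) (use e2 r in simp)
    have "\<forall>\<^sub>F N in sequentially. X N \<in> borel_measurable (M N)" using X by (simp add: tendsto_in_prob_def)
    with ev eventually_ge_at_top[of 2] have "\<forall>\<^sub>F N in sequentially. norm (?I N - 0) < r"
    proof eventually_elim
      case (elim N)
      interpret prob_space "M N" by (rule M[OF elim(2)])
      have [measurable]: "X N \<in> borel_measurable (M N)" by (rule elim(3))
      let ?A = "{\<omega>\<in>space (M N). dist (X N \<omega>) c > e}"
      have "?I N \<le> expectation (\<lambda>\<omega>. e\<^sup>2 + B\<^sup>2 * indicator ?A \<omega>)"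
      proof (rule integral_mono)
        show "integrable (M N) (\<lambda>\<omega>. (dist (X N \<omega>) c)\<^sup>2)"
          by (rule integrable_const_bound[of _ "B\<^sup>2"])
            (use bounded[OF elim(2)] in \<open>auto intro!: power_mono\<close>)
        show "integrable (M N) (\<lambda>\<omega>. e\<^sup>2 + B\<^sup>2 * indicator ?A \<omega>)" by (simp add: less_top[symmetric])
        fix \<omega> assume \<omega>: "\<omega> \<in> space (M N)"
        show "(dist (X N \<omega>) c)\<^sup>2 \<le> e\<^sup>2 + B\<^sup>2 * indicator ?A \<omega>"
        proof (cases "\<omega> \<in> ?A")
          case True
          then show ?thesis using power_mono[OF bounded[OF elim(2) \<omega>], of 2] by (simp add: add_increasing)
        next
          case False
          then show ?thesis using \<omega> power_mono[of "dist (X N \<omega>) c" e 2] by simp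
        qed
      qed
      also have "\<dots> = e\<^sup>2 + B\<^sup>2 * prob ?A" by (simp add: prob_space less_top[symmetric])
      finally have "?I N < r" using elim(1) by simp
      moreover have "0 \<le> ?I N" by simp
      ultimately show ?case by simp
    qed
    then show "\<exists>n0. \<forall>N\<ge>n0. norm (?I N - 0) < r" by (simp add: eventually_sequentially)
  qed
qed simp

text \<open>Graphs are coded by edge sets: the finitely many ones in \<open>graphs N\<close> have
  events that partition the space, whereas relations on all natural numbers would describe each
  event many times.\<close>

definition graph_event ::
  "'w measure \<Rightarrow> nat \<Rightarrow> ('w \<Rightarrow> nat \<Rightarrow> nat \<Rightarrow> bool) \<Rightarrow> (nat \<times> nat) set \<Rightarrow> 'w set" where
  "graph_event M N a E = {\<omega>\<in>space M. \<forall>i\<in>{1..N}. \<forall>j\<in>{1..N}. a \<omega> i j \<longleftrightarrow> (i, j) \<in> E}"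

definition graphs :: "nat \<Rightarrow> (nat \<times> nat) set set" where
  "graphs N = Pow ({1..N} \<times> {1..N})"

lemma finite_graphs: "finite (graphs N)"
  by (simp add: graphs_def)

lemma sum_indicator_graph_event:
  assumes \<omega>: "\<omega> \<in> space M"
  shows "(\<Sum>E\<in>graphs N. indicator (graph_event M N a E) \<omega> * f E :: real)
    = f {(i, j). i \<in> {1..N} \<and> j \<in> {1..N} \<and> a \<omega> i j}"
proof -
  let ?E = "{(i, j). i \<in> {1..N} \<and> j \<in> {1..N} \<and> a \<omega> i j}"
  have "(\<Sum>E\<in>graphs N. indicator (graph_event M N a E) \<omega> * f E) = (\<Sum>E\<in>graphs N. if E = ?E then f E else 0)"
  proof (intro sum.cong refl)
    fix E assume "E \<in> graphs N"
    then have "\<omega> \<in> graph_event M N a E \<longleftrightarrow> E = ?E"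
      using \<omega> by (auto simp: graph_event_def graphs_def)
    then show "indicator (graph_event M N a E) \<omega> * f E = (if E = ?E then f E else 0)"
      by (simp add: indicator_def)
  qed
  also have "\<dots> = f ?E" using finite_graphs by (subst sum.delta) (auto simp: graphs_def)
  finally show ?thesis .
qed

lemma (in prob_space) graph_event_measurable:
  assumes "erdos_renyi M N p a"
  shows "graph_event M N a E \<in> events"
proof -
  have "{\<omega>\<in>space M. a \<omega> i j \<longleftrightarrow> (i, j) \<in> E} \<in> events" if "i \<in> {1..N}" "j \<in> {1..N}" for i j
  proof -
    have [measurable]: "(\<lambda>\<omega>. a \<omega> i j) \<in> measurable M (count_space UNIV)"
      using assms that by (rule erdos_renyi_edge_measurable)
    show ?thesis by measurable
  qed
  then show ?thesis unfolding graph_event_def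
    by (intro sets.sets_Collect_finite_All) auto
qed

lemma (in prob_space) expectation_graph_decomposition:
  fixes f :: "'a \<Rightarrow> real"
  assumes er: "erdos_renyi M N p a" and f: "integrable M f"
  shows "expectation f = (\<Sum>E\<in>graphs N. expectation (\<lambda>\<omega>. indicator (graph_event M N a E) \<omega> * f \<omega>))"
proof -
  have "expectation f = expectation (\<lambda>\<omega>. \<Sum>E\<in>graphs N. indicator (graph_event M N a E) \<omega> * f \<omega>)"
    by (intro Bochner_Integration.integral_cong refl) (simp add: sum_indicator_graph_event)
  also have "\<dots> = (\<Sum>E\<in>graphs N. expectation (\<lambda>\<omega>. indicator (graph_event M N a E) \<omega> * f \<omega>))"
    by (intro Bochner_Integration.integral_sum)
      (use integrable_mult_indicator[OF graph_event_measurable[OF er] f] in simp)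
  finally show ?thesis .
qed

text \<open>The random relation may be arbitrary outside {1..N}, so it need agree with its edge set
  only on those vertices; this and the following congruences allow passing from one to the
  other.\<close>

lemma density_error_cong:
  assumes "\<And>i j. i \<in> {1..N} \<Longrightarrow> j \<in> {1..N} \<Longrightarrow> g i j = h i j"
  shows "density_error N p g = density_error N p h"
proof -
  have "codegree_deviation N p g = codegree_deviation N p h"
    unfolding codegree_deviation_def
    by (intro sum.cong refl arg_cong[where f = abs]) (use assms in \<open>auto simp: centred_edge_def\<close>)
  then show ?thesis by (simp add: density_error_def)
qed

lemma neighbourhood_density_cong:
  assumes "\<And>i j. i \<in> {1..N} \<Longrightarrow> j \<in> {1..N} \<Longrightarrow> g i j = h i j" and "i \<in> {1..N}"
  shows "neighbourhood_density N p g v i = neighbourhood_density N p h v i"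
proof -
  have "(\<Sum>j=1..N. of_bool (g i j) *\<^sub>R v j) = (\<Sum>j=1..N. of_bool (h i j) *\<^sub>R v j)"
    by (intro sum.cong refl) (use assms in auto)
  then show ?thesis by (simp add: neighbourhood_density_def)
qed

lemma nimfa_cong:
  assumes "\<And>i j. i \<in> {1..N} \<Longrightarrow> j \<in> {1..N} \<Longrightarrow> g i j = h i j" and "nimfa N p q g z"
  shows "nimfa N p q h z"
  unfolding nimfa_def
proof (intro ballI)
  fix i assume i: "i \<in> {1..N}"
  have eq: "neighbourhood_density N p h v i = neighbourhood_density N p g v i" for v :: "nat \<Rightarrow> real ^ 'a"
    by (rule neighbourhood_density_cong[OF assms(1)[symmetric] i])
  show "\<forall>t\<ge>0. z t i \<in> prob_simplex \<and> ((\<lambda>t. z t i) has_vector_derivative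
      (rate_matrix q (neighbourhood_density N p h (z t) i) *v z t i)) (at t within {0..})"
    unfolding eq using assms(2) i unfolding nimfa_def by blast
qed

lemma vertex_mean_state_restrict:
  "vertex_mean N (state_indicator (restrict c {1..N})) = vertex_mean N (state_indicator c)"
  unfolding vertex_mean_def state_indicator_def
  by (intro arg_cong[where f = "scaleR (1 / real N)"] sum.cong refl) simp

lemma (in prob_space) exists_graph_positive_prob:
  assumes er: "erdos_renyi M N p a"
  obtains E where "0 < prob (graph_event M N a E)"
proof -
  have "1 = expectation (\<lambda>_. 1 :: real)" by (simp add: prob_space)
  also have "\<dots> = (\<Sum>E\<in>graphs N. expectation (\<lambda>\<omega>. indicator (graph_event M N a E) \<omega> * 1))"
    by (rule expectation_graph_decomposition[OF er]) simp
  also have "\<dots> = (\<Sum>E\<in>graphs N. prob (graph_event M N a E))"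
    using graph_event_measurable[OF er] by simp
  finally have "\<exists>E\<in>graphs N. prob (graph_event M N a E) \<noteq> 0"
    by (metis sum.neutral zero_neq_one)
  then show ?thesis using that by (auto simp: zero_less_measure_iff)
qed

lemma (in prob_space) markov_chain_given_graph:
  assumes er: "erdos_renyi M N p a" and proc: "local_density_dependent_process M N p q a \<sigma>"
    and pos: "0 < prob (graph_event M N a E)"
  shows "markov_chain (uniform_measure M (graph_event M N a E)) (configurations N)
      (jump_rate N p q (\<lambda>i j. (i, j) \<in> E)) (\<lambda>t \<omega>. restrict (\<sigma> t \<omega>) {1..N})"
  using proc[unfolded local_density_dependent_process_def, THEN spec, of "\<lambda>i j. (i, j) \<in> E"] pos
  unfolding graph_event_def by blast

text \<open>The process is specified through conditional measures, but conditioning changes neither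
  the sigma-algebra nor the sample space. So one graph of positive probability yields measurability
  and path regularity under \<open>M\<close> itself.\<close>

lemma (in prob_space) process_regular:
  assumes er: "erdos_renyi M N p a" and proc: "local_density_dependent_process M N p q a \<sigma>" and t: "0 \<le> t"
  shows "(\<lambda>\<omega>. vertex_mean N (state_indicator (\<sigma> t \<omega>))) \<in> borel_measurable M"
    and "\<omega> \<in> space M \<Longrightarrow> ((\<lambda>s. vertex_mean N (state_indicator (\<sigma> s \<omega>)))
      \<longlongrightarrow> vertex_mean N (state_indicator (\<sigma> t \<omega>))) (at_right t)"
proof -
  obtain E where pos: "0 < prob (graph_event M N a E)" using exists_graph_positive_prob[OF er] .
  note mc = markov_chain_given_graph[OF er proc pos]
  let ?f = "\<lambda>c. vertex_mean N (state_indicator c)"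
  have "(\<lambda>\<omega>. restrict (\<sigma> t \<omega>) {1..N}) \<in> measurable (uniform_measure M (graph_event M N a E)) (count_space (configurations N))"
    using mc t unfolding markov_chain_def by blast
  then have "(\<lambda>\<omega>. restrict (\<sigma> t \<omega>) {1..N}) \<in> measurable M (count_space (configurations N))"
    unfolding measurable_cong_sets[OF sets_uniform_measure refl] .
  from measurable_compose[OF this, of ?f borel]
  show "(\<lambda>\<omega>. ?f (\<sigma> t \<omega>)) \<in> borel_measurable M" unfolding vertex_mean_state_restrict by simp
  assume "\<omega> \<in> space M"
  then have "\<forall>\<^sub>F s in at_right t. restrict (\<sigma> s \<omega>) {1..N} = restrict (\<sigma> t \<omega>) {1..N}"
    using mc t unfolding markov_chain_def by simp
  then have "\<forall>\<^sub>F s in at_right t. ?f (\<sigma> s \<omega>) = ?f (\<sigma> t \<omega>)"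
    by eventually_elim (metis vertex_mean_state_restrict)
  then show "((\<lambda>s. ?f (\<sigma> s \<omega>)) \<longlongrightarrow> ?f (\<sigma> t \<omega>)) (at_right t)" by (rule tendsto_eventually)
qed

section \<open>Exceedance probabilities and convergence of the suprema\<close>

context mean_field_model
begin

lemma u_right_continuous: "0 \<le> t \<Longrightarrow> (u \<longlongrightarrow> u t) (at_right t)"
proof -
  assume t: "0 \<le> t"
  then have "(u \<longlongrightarrow> u t) (at t within {0..})"
    using has_vector_derivative_continuous[OF u_derivative[OF t]] by (simp add: continuous_within)
  then show ?thesis by (rule tendsto_within_subset) (use t in auto)
qed

lemma drift_error_cong:
  assumes "\<And>i j. i \<in> {1..N} \<Longrightarrow> j \<in> {1..N} \<Longrightarrow> g i j = h i j"
  shows "drift_error N g = drift_error N h"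
  using density_error_cong[of N g h p, OF assms] by (simp add: drift_error_def)

lemma graph_event_irreflexive:
  assumes er: "erdos_renyi M N p a" and ne: "graph_event M N a E \<noteq> {}" and i: "i \<in> {1..N}"
  shows "(i, i) \<notin> E"
  using er ne i unfolding erdos_renyi_def graph_event_def by blast

lemma expectation_drift_error_le:
  assumes M: "prob_space M" and er: "erdos_renyi M N p a" and N: "2 \<le> N"
  shows "integrable M (\<lambda>\<omega>. drift_error N (a \<omega>))"
    and "integral\<^sup>L M (\<lambda>\<omega>. drift_error N (a \<omega>)) \<le> L\<^sup>2 * (real CARD('s) *
       (2 * ((real N)\<^sup>2 * sqrt (real N) + (real N)\<^sup>2) / (real N * (mean_degree N p)\<^sup>2) + 2 / (real N - 1)\<^sup>2))
       + 2 * R / real N"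
proof -
  interpret prob_space M by (rule M)
  note de = expectation_density_error_le[OF er p N]
  show "integrable M (\<lambda>\<omega>. drift_error N (a \<omega>))" unfolding drift_error_def using de(1) by simp
  have "expectation (\<lambda>\<omega>. drift_error N (a \<omega>))
      = L\<^sup>2 * (real CARD('s) * expectation (\<lambda>\<omega>. density_error N p (a \<omega>))) + 2 * R / real N"
    unfolding drift_error_def using de(1) by (simp add: prob_space)
  also have "\<dots> \<le> L\<^sup>2 * (real CARD('s) *
       (2 * ((real N)\<^sup>2 * sqrt (real N) + (real N)\<^sup>2) / (real N * (mean_degree N p)\<^sup>2) + 2 / (real N - 1)\<^sup>2))
       + 2 * R / real N"
    by (intro add_right_mono mult_left_mono de(2)) auto
  finally show "integral\<^sup>L M (\<lambda>\<omega>. drift_error N (a \<omega>)) \<le> L\<^sup>2 * (real CARD('s) *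
       (2 * ((real N)\<^sup>2 * sqrt (real N) + (real N)\<^sup>2) / (real N * (mean_degree N p)\<^sup>2) + 2 / (real N - 1)\<^sup>2))
       + 2 * R / real N" .
qed

lemma expectation_drift_error_tendsto_0:
  assumes M: "\<And>N. 2 \<le> N \<Longrightarrow> prob_space (M N)" and er: "\<And>N. 2 \<le> N \<Longrightarrow> erdos_renyi (M N) N p (a N)"
  shows "(\<lambda>N. integral\<^sup>L (M N) (\<lambda>\<omega>. drift_error N (a N \<omega>))) \<longlonglongrightarrow> 0"
proof (rule tendsto_sandwich)
  show "\<forall>\<^sub>F N in sequentially. 0 \<le> integral\<^sup>L (M N) (\<lambda>\<omega>. drift_error N (a N \<omega>))"
    by (simp add: drift_error_nonneg)
  show "\<forall>\<^sub>F N in sequentially. integral\<^sup>L (M N) (\<lambda>\<omega>. drift_error N (a N \<omega>)) \<le> L\<^sup>2 * (real CARD('s) *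
       (2 * ((real N)\<^sup>2 * sqrt (real N) + (real N)\<^sup>2) / (real N * (mean_degree N p)\<^sup>2) + 2 / (real N - 1)\<^sup>2))
       + 2 * R / real N"
    using eventually_ge_at_top[of 2] by eventually_elim (intro expectation_drift_error_le M er)
  have "(\<lambda>N. L\<^sup>2 * (real CARD('s) *
       (2 * ((real N)\<^sup>2 * sqrt (real N) + (real N)\<^sup>2) / (real N * (mean_degree N p)\<^sup>2) + 2 / (real N - 1)\<^sup>2))
       + 2 * R / real N) \<longlonglongrightarrow> L\<^sup>2 * (real CARD('s) * 0) + 0"
    by (intro tendsto_add tendsto_mult tendsto_const tendsto_density_error_bound p lim_const_over_n)
  then show "(\<lambda>N. L\<^sup>2 * (real CARD('s) *
       (2 * ((real N)\<^sup>2 * sqrt (real N) + (real N)\<^sup>2) / (real N * (mean_degree N p)\<^sup>2) + 2 / (real N - 1)\<^sup>2))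
       + 2 * R / real N) \<longlonglongrightarrow> 0" by simp
qed simp

text \<open>The weighted squared Euclidean distance passes this level whenever the l1 distance
  passes \<open>e\<close> at a time up to \<open>T\<close>: the number of states compares the norms,
  and the weight is smallest at \<open>T\<close>.\<close>

definition level :: "real \<Rightarrow> real \<Rightarrow> real" where
  "level T e = exp (- growth * T) * (e / real CARD('s))\<^sup>2"

lemma level_pos: "0 < e \<Longrightarrow> 0 < level T e"
  by (simp add: level_def)

lemma level_less:
  assumes t: "t \<le> T" and e: "0 < e" and v: "e < l1_norm (v :: real ^ 's)"
  shows "level T e < exp (- growth * t) * (norm v)\<^sup>2"
proof -
  have "e / real CARD('s) < norm v"
    using less_le_trans[OF v l1_norm_le] by (simp add: field_simps)
  then have "(e / real CARD('s))\<^sup>2 < (norm v)\<^sup>2" using e by (intro power_strict_mono) auto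
  then have "level T e < exp (- growth * T) * (norm v)\<^sup>2" by (simp add: level_def)
  also have "\<dots> \<le> exp (- growth * t) * (norm v)\<^sup>2"
    using t L R by (intro mult_right_mono) (auto simp: growth_def intro!: mult_left_mono)
  finally show ?thesis .
qed

text \<open>The chain bound is applied under each conditional measure and averaged with the graph
  probabilities. The initial states may depend on the graph, since the initial second moment is
  conditioned as well.\<close>

lemma process_exceedance_le:
  assumes N: "2 \<le> N" and M: "prob_space M" and er: "erdos_renyi M N p a"
    and proc: "local_density_dependent_process M N p q a \<sigma>" and T: "0 < T" and e: "0 < e"
  defines "x \<equiv> \<lambda>t \<omega>. vertex_mean N (state_indicator (\<sigma> t \<omega>))"
  shows "measure M {\<omega>\<in>space M. \<exists>t\<in>{0..T}. e < l1_norm (x t \<omega> - u t)}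
     \<le> (integral\<^sup>L M (\<lambda>\<omega>. (dist (x 0 \<omega>) (u 0))\<^sup>2) + integral\<^sup>L M (\<lambda>\<omega>. drift_error N (a \<omega>)) * T) / level T e"
proof -
  interpret prob_space M by (rule M)
  let ?l = "level T e"
  have l: "0 < ?l" using e by (rule level_pos)
  let ?A = "graph_event M N a"
  let ?B = "{\<omega>\<in>space M. \<exists>t\<in>{0..T}. ?l < exp (- growth * t) * (norm (x t \<omega> - u t))\<^sup>2}"
  let ?f = "\<lambda>\<omega>. (dist (x 0 \<omega>) (u 0))\<^sup>2" and ?d = "\<lambda>\<omega>. drift_error N (a \<omega>)"
  note A = graph_event_measurable[OF er]
  have xm: "x t \<in> borel_measurable M" if "0 \<le> t" for t
    unfolding x_def using er proc that by (rule process_regular(1))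
  have xr: "((\<lambda>s. x s \<omega>) \<longlongrightarrow> x t \<omega>) (at_right t)" if "0 \<le> t" "\<omega> \<in> space M" for t \<omega>
    unfolding x_def using er proc that by (rule process_regular(2))
  have xs: "x t \<omega> \<in> prob_simplex" for t \<omega>
    unfolding x_def using N by (intro vertex_mean_in_prob_simplex state_indicator_in_prob_simplex) auto
  \<comment> \<open>Measurability under \<open>M\<close> lets the conditional probability of
    \<open>?B\<close> be written as a quotient.\<close>
  have B: "?B \<in> events"
  proof (rule exceedance_measurable[OF T])
    fix \<omega> t assume \<omega>: "\<omega> \<in> space M" and t: "0 \<le> t" "t < T" and lt: "?l < exp (- growth * t) * (norm (x t \<omega> - u t))\<^sup>2"
    have "((\<lambda>s. exp (- growth * s) * (norm (x s \<omega> - u s))\<^sup>2) \<longlongrightarrow> exp (- growth * t) * (norm (x t \<omega> - u t))\<^sup>2) (at_right t)"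
      by (intro tendsto_intros xr u_right_continuous t \<omega>)
    then show "\<forall>\<^sub>F s in at_right t. ?l < exp (- growth * s) * (norm (x s \<omega> - u s))\<^sup>2"
      using lt by (rule order_tendstoD)
  next
    fix t :: real assume "0 \<le> t"
    from xm[OF this] have [measurable]: "x t \<in> borel_measurable M" .
    show "{\<omega>\<in>space M. ?l < exp (- growth * t) * (norm (x t \<omega> - u t))\<^sup>2} \<in> events" by measurable
  qed
  have [measurable]: "x 0 \<in> borel_measurable M" by (rule xm) simp
  have fint: "integrable M ?f"
  proof (rule integrable_const_bound[of _ 4])
    show "AE \<omega> in M. norm (?f \<omega>) \<le> 4"
    proof (rule AE_I2)
      fix \<omega>
      have "dist (x 0 \<omega>) (u 0) \<le> 2"
        unfolding dist_norm by (intro norm_prob_simplex_diff_le xs u_in_prob_simplex) simp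
      from power_mono[OF this zero_le_dist, of 2] show "norm (?f \<omega>) \<le> 4" by simp
    qed
  qed measurable
  have dint: "integrable M ?d" by (rule expectation_drift_error_le(1)[OF M er N])
  \<comment> \<open>Written with integrals over the graph event and not with conditional means, so
    that it also holds for graphs of probability 0, where the process is unspecified.\<close>
  have part: "prob (?A E \<inter> ?B) \<le> (expectation (\<lambda>\<omega>. indicator (?A E) \<omega> * ?f \<omega>)
      + expectation (\<lambda>\<omega>. indicator (?A E) \<omega> * ?d \<omega>) * T) / ?l" for E
  proof (cases "prob (?A E) = 0")
    case True
    have "prob (?A E \<inter> ?B) \<le> prob (?A E)" by (intro finite_measure_mono A) auto
    also have "\<dots> = 0" by (rule True)
    also have "0 \<le> (expectation (\<lambda>\<omega>. indicator (?A E) \<omega> * ?f \<omega>)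
      + expectation (\<lambda>\<omega>. indicator (?A E) \<omega> * ?d \<omega>) * T) / ?l"
      using T l drift_error_nonneg
      by (intro divide_nonneg_nonneg add_nonneg_nonneg mult_nonneg_nonneg Bochner_Integration.integral_nonneg) auto
    finally show ?thesis .
  next
    case False
    then have pos: "0 < prob (?A E)" by (simp add: zero_less_measure_iff)
    let ?U = "uniform_measure M (?A E)"
    let ?g = "\<lambda>i j. (i, j) \<in> E"
    have ne: "?A E \<noteq> {}" using False by auto
    have U: "prob_space ?U" using pos by (intro prob_space_uniform_measure) (auto simp: emeasure_eq_measure)
    have "measure ?U ?B \<le> (integral\<^sup>L ?U ?f + drift_error N ?g * T) / ?l"
      using markov_chain_exceedance_le[OF N graph_event_irreflexive[OF er ne] U markov_chain_given_graph[OF er proc pos] T l]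
      unfolding vertex_mean_state_restrict x_def dist_norm space_uniform_measure .
    moreover have "measure ?U ?B = prob (?A E \<inter> ?B) / prob (?A E)"
      using pos B by (subst measure_uniform_measure) (auto simp: emeasure_eq_measure)
    moreover have "integral\<^sup>L ?U ?f = expectation (\<lambda>\<omega>. indicator (?A E) \<omega> * ?f \<omega>) / prob (?A E)"
      using A pos by (intro integral_uniform_measure) auto
    ultimately have le: "prob (?A E \<inter> ?B) / prob (?A E)
        \<le> (expectation (\<lambda>\<omega>. indicator (?A E) \<omega> * ?f \<omega>) / prob (?A E) + drift_error N ?g * T) / ?l" by simp
    have "expectation (\<lambda>\<omega>. indicator (?A E) \<omega> * ?d \<omega>) = expectation (\<lambda>\<omega>. indicator (?A E) \<omega> * drift_error N ?g)"
    proof (intro Bochner_Integration.integral_cong refl)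
      fix \<omega>
      have "?d \<omega> = drift_error N ?g" if "\<omega> \<in> ?A E"
        by (rule drift_error_cong) (use that in \<open>auto simp: graph_event_def\<close>)
      then show "indicator (?A E) \<omega> * ?d \<omega> = indicator (?A E) \<omega> * drift_error N ?g"
        by (auto simp: indicator_def)
    qed
    also have "\<dots> = prob (?A E) * drift_error N ?g" using A by simp
    finally have d: "expectation (\<lambda>\<omega>. indicator (?A E) \<omega> * ?d \<omega>) = prob (?A E) * drift_error N ?g" .
    have "prob (?A E \<inter> ?B) = prob (?A E) * (prob (?A E \<inter> ?B) / prob (?A E))" using pos by simp
    also have "\<dots> \<le> prob (?A E) * ((expectation (\<lambda>\<omega>. indicator (?A E) \<omega> * ?f \<omega>) / prob (?A E) + drift_error N ?g * T) / ?l)"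
      by (intro mult_left_mono le) simp
    also have "\<dots> = (expectation (\<lambda>\<omega>. indicator (?A E) \<omega> * ?f \<omega>)
      + expectation (\<lambda>\<omega>. indicator (?A E) \<omega> * ?d \<omega>) * T) / ?l"
      unfolding d using pos by (simp add: distrib_left)
    finally show ?thesis .
  qed
  have "prob {\<omega>\<in>space M. \<exists>t\<in>{0..T}. e < l1_norm (x t \<omega> - u t)} \<le> prob ?B"
  proof (rule finite_measure_mono[OF _ B], intro Collect_mono impI, elim conjE bexE, intro conjI bexI)
    fix \<omega> t assume "t \<in> {0..T}" "e < l1_norm (x t \<omega> - u t)"
    then show "?l < exp (- growth * t) * (norm (x t \<omega> - u t))\<^sup>2" using e by (intro level_less) auto
  qed
  also have "\<dots> = expectation (indicator ?B)" using B by simp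
  also have "\<dots> = (\<Sum>E\<in>graphs N. expectation (\<lambda>\<omega>. indicator (?A E) \<omega> * indicator ?B \<omega>))"
    using B by (intro expectation_graph_decomposition[OF er]) (simp add: less_top[symmetric])
  also have "\<dots> = (\<Sum>E\<in>graphs N. prob (?A E \<inter> ?B))"
    using A B by (simp add: indicator_inter_arith[symmetric])
  also have "\<dots> \<le> (\<Sum>E\<in>graphs N. (expectation (\<lambda>\<omega>. indicator (?A E) \<omega> * ?f \<omega>)
      + expectation (\<lambda>\<omega>. indicator (?A E) \<omega> * ?d \<omega>) * T) / ?l)"
    by (intro sum_mono part)
  also have "\<dots> = (expectation ?f + expectation ?d * T) / ?l"
    unfolding expectation_graph_decomposition[OF er fint] expectation_graph_decomposition[OF er dint]
    by (simp only: sum_divide_distrib[symmetric] sum.distrib sum_distrib_right)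
  finally show ?thesis .
qed

text \<open>The Lyapunov bound holds along every single solution, so an exceedance at any time
  forces one random variable, formed from the initial distance and the graph, up to the level.
  Markov's inequality then takes the place of the maximal inequality.\<close>

lemma nimfa_exceedance_le:
  assumes N: "2 \<le> N" and M: "prob_space M" and er: "erdos_renyi M N p a"
    and z0: "\<And>i. i \<in> {1..N} \<Longrightarrow> (\<lambda>\<omega>. z 0 \<omega> i) \<in> borel_measurable M"
    and z: "\<And>\<omega>. \<omega> \<in> space M \<Longrightarrow> nimfa N p q (a \<omega>) (\<lambda>t. z t \<omega>)" and T: "0 < T" and e: "0 < e"
  defines "y \<equiv> \<lambda>t \<omega>. vertex_mean N (z t \<omega>)"
  shows "measure M {\<omega>\<in>space M. \<exists>t\<in>{0..T}. e < l1_norm (y t \<omega> - u t)}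
     \<le> (integral\<^sup>L M (\<lambda>\<omega>. (dist (y 0 \<omega>) (u 0))\<^sup>2) + integral\<^sup>L M (\<lambda>\<omega>. drift_error N (a \<omega>)) * T) / level T e"
proof -
  interpret prob_space M by (rule M)
  let ?l = "level T e"
  let ?f = "\<lambda>\<omega>. (dist (y 0 \<omega>) (u 0))\<^sup>2" and ?d = "\<lambda>\<omega>. drift_error N (a \<omega>)"
  have [measurable]: "y 0 \<in> borel_measurable M"
    unfolding y_def vertex_mean_def using z0 by (intro borel_measurable_scaleR borel_measurable_sum) auto
  have fint: "integrable M ?f"
  proof (rule integrable_const_bound[of _ 4])
    show "AE \<omega> in M. norm (?f \<omega>) \<le> 4"
    proof (rule AE_I2)
      fix \<omega> assume "\<omega> \<in> space M"
      then have "dist (y 0 \<omega>) (u 0) \<le> 2"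
        unfolding dist_norm y_def using N z
        by (intro norm_prob_simplex_diff_le vertex_mean_in_prob_simplex u_in_prob_simplex) (auto simp: nimfa_def)
      from power_mono[OF this zero_le_dist, of 2] show "norm (?f \<omega>) \<le> 4" by simp
    qed
  qed measurable
  have dint: "integrable M ?d" by (rule expectation_drift_error_le(1)[OF M er N])
  have int: "integrable M (\<lambda>\<omega>. ?f \<omega> + ?d \<omega> * T)"
    using fint dint by simp
  have "prob {\<omega>\<in>space M. \<exists>t\<in>{0..T}. e < l1_norm (y t \<omega> - u t)}
      \<le> prob {\<omega>\<in>space M. ?l \<le> ?f \<omega> + ?d \<omega> * T}"
  proof (rule finite_measure_mono)
    have "(\<lambda>\<omega>. ?f \<omega> + ?d \<omega> * T) \<in> borel_measurable M" using int by (rule borel_measurable_integrable)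
    then show "{\<omega>\<in>space M. ?l \<le> ?f \<omega> + ?d \<omega> * T} \<in> events" by simp
    show "{\<omega>\<in>space M. \<exists>t\<in>{0..T}. e < l1_norm (y t \<omega> - u t)}
        \<subseteq> {\<omega>\<in>space M. ?l \<le> ?f \<omega> + ?d \<omega> * T}"
    proof (intro Collect_mono impI, elim conjE bexE, intro conjI)
      fix \<omega> t assume \<omega>: "\<omega> \<in> space M" and t: "t \<in> {0..T}"
        and lt: "e < l1_norm (y t \<omega> - u t)"
      have irr: "\<not> a \<omega> i i" if "i \<in> {1..N}" for i using er \<omega> that by (simp add: erdos_renyi_def)
      show "?l \<le> ?f \<omega> + ?d \<omega> * T"
        using level_less[OF _ e lt, of t T] nimfa_lyapunov_le[OF N irr z[OF \<omega>], of t T] t by (simp add: y_def dist_norm)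
    qed
  qed
  also have "\<dots> \<le> expectation (\<lambda>\<omega>. ?f \<omega> + ?d \<omega> * T) / ?l"
    by (rule integral_Markov_inequality_measure[OF int, of "space M"])
      (use level_pos[OF e] T drift_error_nonneg in auto)
  also have "\<dots> = (expectation ?f + expectation ?d * T) / ?l" using fint dint by simp
  finally show ?thesis .
qed

text \<open>The supremum is measurable because right-continuity reduces it to a countable one.\<close>

lemma tendsto_in_prob_sup_distance:
  fixes w :: "nat \<Rightarrow> real \<Rightarrow> 'w \<Rightarrow> real ^ 's"
  assumes M: "\<And>N. 2 \<le> N \<Longrightarrow> prob_space (M N)" and er: "\<And>N. 2 \<le> N \<Longrightarrow> erdos_renyi (M N) N p (a N)"
    and simplex: "\<And>N t \<omega>. 2 \<le> N \<Longrightarrow> 0 \<le> t \<Longrightarrow> \<omega> \<in> space (M N) \<Longrightarrow> w N t \<omega> \<in> prob_simplex"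
    and right: "\<And>N t \<omega>. 2 \<le> N \<Longrightarrow> 0 \<le> t \<Longrightarrow> \<omega> \<in> space (M N) \<Longrightarrow> ((\<lambda>s. w N s \<omega>) \<longlongrightarrow> w N t \<omega>) (at_right t)"
    and meas: "\<And>N t l. 2 \<le> N \<Longrightarrow> 0 \<le> t \<Longrightarrow> {\<omega>\<in>space (M N). l < l1_norm (w N t \<omega> - u t)} \<in> sets (M N)"
    and exceed: "\<And>N e. 2 \<le> N \<Longrightarrow> 0 < e \<Longrightarrow>
      measure (M N) {\<omega>\<in>space (M N). \<exists>t\<in>{0..T}. e < l1_norm (w N t \<omega> - u t)}
       \<le> (integral\<^sup>L (M N) (\<lambda>\<omega>. (dist (w N 0 \<omega>) (u 0))\<^sup>2) + integral\<^sup>L (M N) (\<lambda>\<omega>. drift_error N (a N \<omega>)) * T) / level T e"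
    and init: "tendsto_in_prob M (\<lambda>N. w N 0) (u 0)" and T: "0 < T"
  shows "tendsto_in_prob M (\<lambda>N \<omega>. SUP t\<in>{0..T}. l1_norm (w N t \<omega> - u t)) 0"
proof -
  let ?S = "\<lambda>N \<omega>. SUP t\<in>{0..T}. l1_norm (w N t \<omega> - u t)"
  have le2: "l1_norm (w N t \<omega> - u t) \<le> real CARD('s) * 2"
    if "2 \<le> N" "0 \<le> t" "\<omega> \<in> space (M N)" for N t \<omega>
  proof -
    have "norm (w N t \<omega> - u t) \<le> 2"
      using that by (intro norm_prob_simplex_diff_le simplex u_in_prob_simplex)
    then show ?thesis using l1_norm_le[of "w N t \<omega> - u t"]
      by (meson mult_left_mono of_nat_0_le_iff order_trans)
  qed
  \<comment> \<open>The real \<open>SUP\<close> is meaningful for bounded families; here distances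
    within the simplex are bounded.\<close>
  have bdd: "bdd_above ((\<lambda>t. l1_norm (w N t \<omega> - u t)) ` {0..T})"
    if "2 \<le> N" "\<omega> \<in> space (M N)" for N \<omega>
    by (rule bdd_aboveI2[of _ _ "real CARD('s) * 2"]) (use le2 that in auto)
  have iff: "e < ?S N \<omega> \<longleftrightarrow> (\<exists>t\<in>{0..T}. e < l1_norm (w N t \<omega> - u t))"
    if "2 \<le> N" "\<omega> \<in> space (M N)" for N \<omega> e
    using T by (intro less_cSUP_iff bdd that) auto
  have nonneg: "0 \<le> ?S N \<omega>" if "2 \<le> N" "\<omega> \<in> space (M N)" for N \<omega>
  proof -
    have "0 \<le> l1_norm (w N 0 \<omega> - u 0)" by (simp add: l1_norm_def sum_nonneg)
    also have "\<dots> \<le> ?S N \<omega>" using T by (intro cSUP_upper bdd that) auto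
    finally show ?thesis .
  qed
  have S: "?S N \<in> borel_measurable (M N)" if N: "2 \<le> N" for N
  proof (rule borel_measurable_iff_greater[THEN iffD2], rule allI)
    fix e
    have "{\<omega>\<in>space (M N). e < ?S N \<omega>} = {\<omega>\<in>space (M N). \<exists>t\<in>{0..T}. e < l1_norm (w N t \<omega> - u t)}"
      by (intro Collect_cong conj_cong refl iff N)
    also have "\<dots> \<in> sets (M N)"
    proof (rule exceedance_measurable[OF T _ meas[OF N]])
      fix \<omega> t assume \<omega>: "\<omega> \<in> space (M N)" and t: "0 \<le> t" "t < T" and lt: "e < l1_norm (w N t \<omega> - u t)"
      have "((\<lambda>s. l1_norm (w N s \<omega> - u s)) \<longlongrightarrow> l1_norm (w N t \<omega> - u t)) (at_right t)"
        unfolding l1_norm_def by (intro tendsto_intros right u_right_continuous N t \<omega>)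
      then show "\<forall>\<^sub>F s in at_right t. e < l1_norm (w N s \<omega> - u s)" using lt by (rule order_tendstoD)
    qed
    finally show "{\<omega>\<in>space (M N). e < ?S N \<omega>} \<in> sets (M N)" .
  qed
  have "(\<lambda>N. \<P>(\<omega> in M N. dist (?S N \<omega>) 0 > e)) \<longlonglongrightarrow> 0" if e: "0 < e" for e
  proof -
    let ?b = "\<lambda>N. (integral\<^sup>L (M N) (\<lambda>\<omega>. (dist (w N 0 \<omega>) (u 0))\<^sup>2)
      + integral\<^sup>L (M N) (\<lambda>\<omega>. drift_error N (a N \<omega>)) * T) / level T e"
    have "\<P>(\<omega> in M N. dist (?S N \<omega>) 0 > e) \<le> ?b N" if N: "2 \<le> N" for N
    proof -
      have "{\<omega>\<in>space (M N). dist (?S N \<omega>) 0 > e} = {\<omega>\<in>space (M N). \<exists>t\<in>{0..T}. e < l1_norm (w N t \<omega> - u t)}"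
      proof (intro Collect_cong conj_cong refl)
        fix \<omega> assume \<omega>: "\<omega> \<in> space (M N)"
        have "dist (?S N \<omega>) 0 = ?S N \<omega>" using nonneg[OF N \<omega>] by (simp only: dist_real_def diff_0_right abs_of_nonneg)
        then show "dist (?S N \<omega>) 0 > e \<longleftrightarrow> (\<exists>t\<in>{0..T}. e < l1_norm (w N t \<omega> - u t))"
          by (simp only: iff[OF N \<omega>])
      qed
      then show ?thesis using exceed[OF N e] by simp
    qed
    then have upper: "\<forall>\<^sub>F N in sequentially. \<P>(\<omega> in M N. dist (?S N \<omega>) 0 > e) \<le> ?b N"
      using eventually_ge_at_top[of 2] by (rule eventually_mono[rotated])
    have "(\<lambda>N. integral\<^sup>L (M N) (\<lambda>\<omega>. (dist (w N 0 \<omega>) (u 0))\<^sup>2)) \<longlonglongrightarrow> 0"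
      by (rule expectation_dist_squared_tendsto_0[OF M init, of 2])
        (auto simp: dist_norm intro!: norm_prob_simplex_diff_le simplex u_in_prob_simplex)
    then have "?b \<longlonglongrightarrow> (0 + 0 * T) / level T e"
      using level_pos[OF e, of T]
      by (intro tendsto_divide tendsto_add tendsto_mult tendsto_const
          expectation_drift_error_tendsto_0 M er) auto
    then have "?b \<longlonglongrightarrow> 0" by simp
    then show ?thesis
      by (intro tendsto_sandwich[OF _ upper tendsto_const]) (auto simp: measure_nonneg)
  qed
  moreover have "\<forall>\<^sub>F N in sequentially. ?S N \<in> borel_measurable (M N)"
    using eventually_ge_at_top[of 2] by eventually_elim (rule S)
  ultimately show ?thesis by (simp add: tendsto_in_prob_def)
qed

end

theorem theorem1:
  fixes M :: "nat \<Rightarrow> 'w measure"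
    and a :: "nat \<Rightarrow> 'w \<Rightarrow> nat \<Rightarrow> nat \<Rightarrow> bool"
    and q :: "'s::finite \<Rightarrow> 's \<Rightarrow> real ^ 's \<Rightarrow> real"
    and \<sigma> :: "nat \<Rightarrow> real \<Rightarrow> 'w \<Rightarrow> nat \<Rightarrow> 's"
    and z :: "nat \<Rightarrow> real \<Rightarrow> 'w \<Rightarrow> nat \<Rightarrow> real ^ 's"
    and x y :: "nat \<Rightarrow> real \<Rightarrow> 'w \<Rightarrow> real ^ 's"
    and u :: "real \<Rightarrow> real ^ 's"
    and p T :: real
  assumes "\<And>N. 2 \<le> N \<Longrightarrow> prob_space (M N)"
    and "0 < p" and "p \<le> 1"
    and "\<And>N. 2 \<le> N \<Longrightarrow> erdos_renyi (M N) N p (a N)"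
    and "\<And>k s. k \<noteq> s \<Longrightarrow> locally_lipschitz (q k s)"
    and "\<And>k s \<phi>. k \<noteq> s \<Longrightarrow> (\<And>l. 0 \<le> \<phi> $ l) \<Longrightarrow> 0 \<le> q k s \<phi>"
    and "\<And>N. 2 \<le> N \<Longrightarrow> local_density_dependent_process (M N) N p q (a N) (\<sigma> N)"
    and "\<And>N t \<omega>. x N t \<omega> = vertex_mean N (state_indicator (\<sigma> N t \<omega>))"
    and "\<And>N i. 2 \<le> N \<Longrightarrow> i \<in> {1..N} \<Longrightarrow> (\<lambda>\<omega>. z N 0 \<omega> i) \<in> borel_measurable (M N)"
    and "\<And>N \<omega>. 2 \<le> N \<Longrightarrow> \<omega> \<in> space (M N) \<Longrightarrow> nimfa N p q (a N \<omega>) (\<lambda>t. z N t \<omega>)"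
    and "\<And>N t \<omega>. y N t \<omega> = vertex_mean N (z N t \<omega>)"
    and "homogeneous_mean_field q u"
    and "tendsto_in_prob M (\<lambda>N. x N 0) (u 0)"
    and "tendsto_in_prob M (\<lambda>N. y N 0) (u 0)"
    and "0 < T"
  shows "tendsto_in_prob M (\<lambda>N \<omega>. SUP t\<in>{0..T}. l1_norm (x N t \<omega> - u t)) 0 \<and>
         tendsto_in_prob M (\<lambda>N \<omega>. SUP t\<in>{0..T}. l1_norm (y N t \<omega> - u t)) 0"
proof -
  obtain L R where LR: "0 \<le> L" "0 \<le> R"
    "\<And>\<phi> \<psi> w. \<phi> \<in> density_region (1 / p) \<Longrightarrow> \<psi> \<in> density_region (1 / p) \<Longrightarrow>
       norm (rate_matrix q \<phi> *v w - rate_matrix q \<psi> *v w) \<le> L * norm (\<phi> - \<psi>) * norm w"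
    "\<And>\<phi> w. \<phi> \<in> density_region (1 / p) \<Longrightarrow> norm (rate_matrix q \<phi> *v w) \<le> R * norm w"
    "\<And>\<phi> s. \<phi> \<in> density_region (1 / p) \<Longrightarrow> (\<Sum>k\<in>UNIV - {s}. q k s \<phi>) \<le> R"
    by (rule rate_matrix_regular[of q "density_region (1 / p)", OF assms(5) compact_density_region])
      (assumption | (rule that; blast))+
  interpret mean_field_model q p L R u
  proof
    fix k s :: 's and \<phi> :: "real ^ 's"
    assume "k \<noteq> s" "\<phi> \<in> density_region (1 / p)"
    then show "0 \<le> q k s \<phi>" by (intro assms(6)) (auto simp: density_region_def)
  qed (fact assms(2,3,12) LR)+
  note M = assms(1) and er = assms(4) and proc = assms(7) and z0 = assms(9) and nimfa = assms(10)
  have x: "x N t = (\<lambda>\<omega>. vertex_mean N (state_indicator (\<sigma> N t \<omega>)))" for N t by (rule ext) (rule assms(8))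
  have y: "y N t = (\<lambda>\<omega>. vertex_mean N (z N t \<omega>))" for N t by (rule ext) (rule assms(11))
  have "tendsto_in_prob M (\<lambda>N \<omega>. SUP t\<in>{0..T}. l1_norm (x N t \<omega> - u t)) 0"
  proof (rule tendsto_in_prob_sup_distance[where M = M and a = a and w = x and T = T, OF M er _ _ _ _ assms(13,15)])
    fix N :: nat and t l :: real and \<omega> assume N: "2 \<le> N" and t: "0 \<le> t"
    interpret MN: prob_space "M N" by (rule M[OF N])
    show "x N t \<omega> \<in> prob_simplex" unfolding x
      using N by (intro vertex_mean_in_prob_simplex state_indicator_in_prob_simplex) auto
    show "\<omega> \<in> space (M N) \<Longrightarrow> ((\<lambda>s. x N s \<omega>) \<longlongrightarrow> x N t \<omega>) (at_right t)"
      unfolding x by (rule MN.process_regular(2)[OF er[OF N] proc[OF N] t])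
    have [measurable]: "x N t \<in> borel_measurable (M N)"
      unfolding x by (rule MN.process_regular(1)[OF er[OF N] proc[OF N] t])
    show "{\<omega>\<in>space (M N). l < l1_norm (x N t \<omega> - u t)} \<in> sets (M N)"
      unfolding l1_norm_def by measurable
  next
    fix N :: nat and e :: real assume "2 \<le> N" "0 < e"
    then show "measure (M N) {\<omega>\<in>space (M N). \<exists>t\<in>{0..T}. e < l1_norm (x N t \<omega> - u t)}
       \<le> (integral\<^sup>L (M N) (\<lambda>\<omega>. (dist (x N 0 \<omega>) (u 0))\<^sup>2) + integral\<^sup>L (M N) (\<lambda>\<omega>. drift_error N (a N \<omega>)) * T) / level T e"
      unfolding x by (intro process_exceedance_le M er proc assms(15))
  qed
  moreover have "tendsto_in_prob M (\<lambda>N \<omega>. SUP t\<in>{0..T}. l1_norm (y N t \<omega> - u t)) 0"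
  proof (rule tendsto_in_prob_sup_distance[where M = M and a = a and w = y and T = T, OF M er _ _ _ _ assms(14,15)])
    fix N :: nat and t :: real and \<omega> assume N: "2 \<le> N" and t: "0 \<le> t" and \<omega>: "\<omega> \<in> space (M N)"
    show "y N t \<omega> \<in> prob_simplex" unfolding y
      using N nimfa[OF N \<omega>] t by (intro vertex_mean_in_prob_simplex) (auto simp: nimfa_def)
    have "((\<lambda>s. z N s \<omega> i) \<longlongrightarrow> z N t \<omega> i) (at_right t)" if "i \<in> {1..N}" for i
    proof -
      have "((\<lambda>s. z N s \<omega> i) \<longlongrightarrow> z N t \<omega> i) (at t within {0..})"
        using nimfa[OF N \<omega>] that t unfolding nimfa_def
        by (blast dest: has_vector_derivative_continuous[unfolded continuous_within])
      then show ?thesis by (rule tendsto_within_subset) (use t in auto)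
    qed
    then show "((\<lambda>s. y N s \<omega>) \<longlongrightarrow> y N t \<omega>) (at_right t)"
      unfolding y vertex_mean_def by (intro tendsto_intros)
  next
    fix N :: nat and t l :: real assume N: "2 \<le> N" and t: "0 \<le> t"
    interpret MN: prob_space "M N" by (rule M[OF N])
    \<comment> \<open>\<open>nimfa_exceedance_measurable\<close> works on one graph at a time, so
      the event is cut along the finitely many graph events.\<close>
    let ?A = "graph_event (M N) N (a N)"
    have "{\<omega>\<in>?A E. l < l1_norm (y N t \<omega> - u t)} \<in> sets (M N)" for E
    \<comment> \<open>For a nonempty graph event a sample point shows that \<open>E\<close> has no
      loops on the vertices; the empty case is trivial.\<close>
    proof (cases "?A E = {}")
      case False
      show ?thesis unfolding y
      proof (rule nimfa_exceedance_measurable[where z = "z N", OF N graph_event_irreflexive[OF er[OF N] False]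
            MN.graph_event_measurable[OF er[OF N]] _ z0[OF N] t])
        fix \<omega> assume "\<omega> \<in> ?A E"
        then show "nimfa N p q (\<lambda>i j. (i, j) \<in> E) (\<lambda>t. z N t \<omega>)"
          using nimfa_cong[OF _ nimfa[OF N], of \<omega>] by (auto simp: graph_event_def)
      qed
    qed simp
    then have "(\<Union>E\<in>graphs N. {\<omega>\<in>?A E. l < l1_norm (y N t \<omega> - u t)}) \<in> sets (M N)"
      by (intro sets.finite_UN finite_graphs)
    moreover have "(\<Union>E\<in>graphs N. {\<omega>\<in>?A E. l < l1_norm (y N t \<omega> - u t)})
        = {\<omega>\<in>space (M N). l < l1_norm (y N t \<omega> - u t)}"
    proof -
      have "\<exists>E\<in>graphs N. \<omega> \<in> ?A E" if "\<omega> \<in> space (M N)" for \<omega>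
        using that by (intro bexI[of _ "{(i, j). i \<in> {1..N} \<and> j \<in> {1..N} \<and> a N \<omega> i j}"])
          (auto simp: graph_event_def graphs_def)
      moreover have "?A E \<subseteq> space (M N)" for E by (auto simp: graph_event_def)
      ultimately show ?thesis by blast
    qed
    ultimately show "{\<omega>\<in>space (M N). l < l1_norm (y N t \<omega> - u t)} \<in> sets (M N)" by simp
  next
    fix N :: nat and e :: real assume "2 \<le> N" "0 < e"
    then show "measure (M N) {\<omega>\<in>space (M N). \<exists>t\<in>{0..T}. e < l1_norm (y N t \<omega> - u t)}
       \<le> (integral\<^sup>L (M N) (\<lambda>\<omega>. (dist (y N 0 \<omega>) (u 0))\<^sup>2) + integral\<^sup>L (M N) (\<lambda>\<omega>. drift_error N (a N \<omega>)) * T) / level T e"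
      unfolding y by (intro nimfa_exceedance_le M er z0 nimfa assms(15))
  qed
  ultimately show ?thesis ..
qed

end
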